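(* \textsc{Generalized Fair Matching} can be solved in time $O(2^{\mathrm{fes}}\, n\log n)$, where $n$ is the number of vertices and $\mathrm{fes}$ is the feedback edge number of the input graph.
   Context: Let $G=(U\cup V,E)$ be a bipartite graph with bipartition $(U,V)$. For $x\in U\cup V$ and $M\subseteq E$, let $M(x)=\{y : xy\in M\}$. A subset $M\subseteq E$ is a left-perfect many-to-one matching if $|M(u)|=1$ for every $u\in U$. Let $C$ be a finite set of colors and $\mathrm{col}:U\to C$ a coloring; for $U'\subseteq U$ and $c\in C$, $U'_c$ denotes the set of vertices of $U'$ of color $c$. For an integer $\ell\ge 0$, $U'$ is $\ell$-fair if $\max_{c\in C}|U'_c|-\min_{c\in C}|U'_c|\le \ell$ (min and max range over all colors of $C$). Given a threshold function $L:V\to\mathbb{N}\cup\{0\}$, a many-to-one matching $M$ is $L$-fair if $M(v)$ is $L(v)$-fair for every $v\in V$. \textsc{Generalized Fair Matching}: given a bipartite graph $G=(U\cup V,E)$, a set of colors $C$, a coloring $\mathrm{col}:U\to C$ and a threshold function $L:V\to\mathbb{N}\cup\{0\}$, decide whether $G$ has a left-perfect many-to-one matching that is $L$-fair. The feedback edge number of a graph is the minimum size of a set of edges whose removal makes the graph acyclic. *)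

theory Defs
  imports Complex_Main
begin

section \<open>Graphs and the feedback edge number\<close>

text \<open>A simple undirected graph is given by a vertex set and a set of two-element vertex sets.\<close>

definition is_cycle :: "nat set set \<Rightarrow> nat list \<Rightarrow> bool" where
  "is_cycle E p \<longleftrightarrow> 3 \<le> length p \<and> distinct p \<and>
     (\<forall>i < length p. {p ! i, p ! (Suc i mod length p)} \<in> E)"

definition acyclic_graph :: "nat set set \<Rightarrow> bool" where
  "acyclic_graph E \<longleftrightarrow> (\<nexists>p. is_cycle E p)"

definition feedback_edge_number :: "nat set set \<Rightarrow> nat" where
  "feedback_edge_number E = Min (card ` {F. F \<subseteq> E \<and> acyclic_graph (E - F)})"

definition bipartite :: "nat set \<Rightarrow> nat set \<Rightarrow> nat set set \<Rightarrow> bool" where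
  "bipartite U V E \<longleftrightarrow> U \<inter> V = {} \<and> E \<subseteq> {{u, v} | u v. u \<in> U \<and> v \<in> V}"

section \<open>Generalized Fair Matching\<close>

text \<open>Vertices and colors are natural numbers. Since the sets below are arbitrary finite sets of
  naturals, this is no restriction up to renaming; it keeps all instances in one type, so that a
  single program can be quantified before them.\<close>

record gfm =
  left :: "nat set"
  right :: "nat set"
  edges :: "nat set set"
  colors :: "nat set"
  color :: "nat \<Rightarrow> nat"
  threshold :: "nat \<Rightarrow> nat"

definition gfm_instance :: "gfm \<Rightarrow> bool" where
  "gfm_instance I \<longleftrightarrow> finite (left I) \<and> finite (right I) \<and>
     bipartite (left I) (right I) (edges I) \<and>
     finite (colors I) \<and> color I ` left I \<subseteq> colors I"

definition partners :: "nat set set \<Rightarrow> nat \<Rightarrow> nat set" where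
  "partners M x = {y. {x, y} \<in> M}"

definition left_perfect_matching :: "gfm \<Rightarrow> nat set set \<Rightarrow> bool" where
  "left_perfect_matching I M \<longleftrightarrow> M \<subseteq> edges I \<and> (\<forall>u \<in> left I. card (partners M u) = 1)"

definition color_class :: "gfm \<Rightarrow> nat set \<Rightarrow> nat \<Rightarrow> nat set" where
  "color_class I X c = {u \<in> X. color I u = c}"

text \<open>The maximum and minimum are meaningless for an empty set of colors. Such an instance has no
  left vertices, and its only set \<open>X\<close> of left vertices, the empty one, counts as fair.
  The subtraction on naturals does not truncate, as the maximum is at least the minimum.\<close>

definition is_fair :: "gfm \<Rightarrow> nat \<Rightarrow> nat set \<Rightarrow> bool" where
  "is_fair I l X \<longleftrightarrow> (colors I \<noteq> {} \<longrightarrow>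
     Max ((\<lambda>c. card (color_class I X c)) ` colors I)
     - Min ((\<lambda>c. card (color_class I X c)) ` colors I) \<le> l)"

definition fair_matching :: "gfm \<Rightarrow> nat set set \<Rightarrow> bool" where
  "fair_matching I M \<longleftrightarrow> (\<forall>v \<in> right I. is_fair I (threshold I v) (partners M v))"

definition gfm_yes :: "gfm \<Rightarrow> bool" where
  "gfm_yes I \<longleftrightarrow> (\<exists>M. left_perfect_matching I M \<and> fair_matching I M)"

definition num_vertices :: "gfm \<Rightarrow> nat" where
  "num_vertices I = card (left I \<union> right I)"

text \<open>Input format: four header words (numbers of left vertices, right vertices, colors, edges), the
  color of every left vertex, the threshold of every right vertex, and the list of edges, two words
  per edge. Left vertices, right vertices and colors are each numbered from 0 in an arbitrary
  order \<open>us\<close>, \<open>vs\<close>, \<open>cs\<close>; the edges \<open>es\<close> come in an arbitrary order without repetition.\<close>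

definition encodes :: "nat list \<Rightarrow> gfm \<Rightarrow> bool" where
  "encodes x I \<longleftrightarrow> (\<exists>us vs cs ks es.
     distinct us \<and> set us = left I \<and>
     distinct vs \<and> set vs = right I \<and>
     distinct cs \<and> set cs = colors I \<and>
     length ks = length us \<and>
     (\<forall>i < length us. ks ! i < length cs \<and> color I (us ! i) = cs ! (ks ! i)) \<and>
     distinct es \<and> set es \<subseteq> {..<length us} \<times> {..<length vs} \<and>
     edges I = (\<lambda>(i, j). {us ! i, vs ! j}) ` set es \<and>
     x = [length us, length vs, length cs, length es] @ ks @ map (threshold I) vs
         @ concat (map (\<lambda>(i, j). [i, j]) es))"

section \<open>Word RAM\<close>

text \<open>Structured programs for a random access machine with \<open>w\<close>-bit words: arithmetic is modulo
  \<open>2 ^ w\<close> (with subtraction cut off at 0), every operation and every memory access takes one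
  time unit. A program can mention only finitely many registers; the memory is addressed
  indirectly.\<close>

datatype binop = Add | Sub | Mul | Div | Mod | Less | Equal

datatype exp = Const nat | Reg nat | Load exp | Bin binop exp exp

datatype com =
    Skip
  | Assign nat exp
  | Store exp exp
  | Seq com com
  | If exp com com
  | While exp com

record state =
  regs :: "nat \<Rightarrow> nat"
  mem :: "nat \<Rightarrow> nat"

fun binop_val :: "binop \<Rightarrow> nat \<Rightarrow> nat \<Rightarrow> nat" where
  "binop_val Add a b = a + b"
| "binop_val Sub a b = a - b"
| "binop_val Mul a b = a * b"
| "binop_val Div a b = a div b"
| "binop_val Mod a b = a mod b"
| "binop_val Less a b = (if a < b then 1 else 0)"
| "binop_val Equal a b = (if a = b then 1 else 0)"

fun exp_val :: "nat \<Rightarrow> state \<Rightarrow> exp \<Rightarrow> nat" where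
  "exp_val w s (Const a) = a mod 2 ^ w"
| "exp_val w s (Reg r) = regs s r"
| "exp_val w s (Load e) = mem s (exp_val w s e)"
| "exp_val w s (Bin f e1 e2) = binop_val f (exp_val w s e1) (exp_val w s e2) mod 2 ^ w"

fun exp_time :: "exp \<Rightarrow> nat" where
  "exp_time (Const a) = 1"
| "exp_time (Reg r) = 1"
| "exp_time (Load e) = 1 + exp_time e"
| "exp_time (Bin f e1 e2) = 1 + exp_time e1 + exp_time e2"

text \<open>\<open>run w P s t s'\<close>: with word size \<open>w\<close>, program \<open>P\<close> started in state \<open>s\<close> halts after
  exactly \<open>t\<close> time units in state \<open>s'\<close>.\<close>

inductive run :: "nat \<Rightarrow> com \<Rightarrow> state \<Rightarrow> nat \<Rightarrow> state \<Rightarrow> bool" for w :: nat where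
  Skip: "run w Skip s 1 s"
| Assign: "run w (Assign r e) s (1 + exp_time e) (s\<lparr>regs := (regs s)(r := exp_val w s e)\<rparr>)"
| Store: "run w (Store a e) s (1 + exp_time a + exp_time e)
            (s\<lparr>mem := (mem s)(exp_val w s a := exp_val w s e)\<rparr>)"
| Seq: "run w P s t s' \<Longrightarrow> run w Q s' t' s'' \<Longrightarrow> run w (Seq P Q) s (t + t') s''"
| IfTrue: "exp_val w s e \<noteq> 0 \<Longrightarrow> run w P s t s' \<Longrightarrow> run w (If e P Q) s (1 + exp_time e + t) s'"
| IfFalse: "exp_val w s e = 0 \<Longrightarrow> run w Q s t s' \<Longrightarrow> run w (If e P Q) s (1 + exp_time e + t) s'"
| WhileTrue: "exp_val w s e \<noteq> 0 \<Longrightarrow> run w P s t s' \<Longrightarrow> run w (While e P) s' t' s'' \<Longrightarrow>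
    run w (While e P) s (1 + exp_time e + t + t') s''"
| WhileFalse: "exp_val w s e = 0 \<Longrightarrow> run w (While e P) s (1 + exp_time e) s"

inductive_cases SkipE: "run w Skip s t s'"
inductive_cases AssignE: "run w (Assign r e) s t s'"
inductive_cases StoreE: "run w (Store a e) s t s'"
inductive_cases SeqE: "run w (Seq P Q) s t s'"
inductive_cases IfE: "run w (If e P Q) s t s'"
inductive_cases WhileE: "run w (While e P) s t s'"

lemma run_deterministic:
  "run w P s t s' \<Longrightarrow> run w P s u s'' \<Longrightarrow> t = u \<and> s' = s''"
proof (induction arbitrary: u s'' rule: run.induct)
  case (Skip s)
  then show ?case by (rule SkipE) simp
next
  case (Assign r e s)
  then show ?case by (rule AssignE) simp
next
  case (Store a e s)
  then show ?case by (rule StoreE) simp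
next
  case (Seq P s t s' Q t' s2)
  from Seq.prems show ?case
  proof (rule SeqE)
    fix t1 r t2
    assume "u = t1 + t2" "run w P s t1 r" "run w Q r t2 s''"
    then show ?thesis using Seq.IH by metis
  qed
next
  case (IfTrue s e P t s' Q)
  from IfTrue.prems show ?case
    by (rule IfE) (use IfTrue.hyps IfTrue.IH in \<open>metis neq0_conv plus_1_eq_Suc add_Suc\<close>)+
next
  case (IfFalse s e Q t s' P)
  from IfFalse.prems show ?case
    by (rule IfE) (use IfFalse.hyps IfFalse.IH in \<open>metis neq0_conv plus_1_eq_Suc add_Suc\<close>)+
next
  case (WhileTrue s e P t s' t' s2)
  from WhileTrue.prems show ?case
    by (rule WhileE) (use WhileTrue.hyps WhileTrue.IH in \<open>metis neq0_conv plus_1_eq_Suc add_Suc\<close>)+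
next
  case (WhileFalse s e P)
  from WhileFalse.prems show ?case
    by (rule WhileE) (use WhileFalse.hyps in \<open>metis neq0_conv plus_1_eq_Suc add_Suc\<close>)+
qed

definition initial_state :: "nat list \<Rightarrow> state" where
  "initial_state x = \<lparr>regs = (\<lambda>_. 0), mem = (\<lambda>a. if a < length x then x ! a else 0)\<rparr>"

text \<open>Words have \<open>\<Theta>(log N)\<close> bits or more, where \<open>N\<close> is the number of input words plus the
  largest of them; \<open>d\<close> is the hidden constant.\<close>

definition word_size_suffices :: "nat \<Rightarrow> nat list \<Rightarrow> nat \<Rightarrow> bool" where
  "word_size_suffices d x w \<longleftrightarrow> (length x + Max (set x)) ^ d \<le> 2 ^ w \<and> (\<forall>a \<in> set x. a < 2 ^ w)"

text \<open>Program \<open>P\<close> solves the problem in time \<open>T I\<close> on instance \<open>I\<close>; the answer is left in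
  register 0.\<close>

definition solves_gfm_in_time :: "com \<Rightarrow> nat \<Rightarrow> (gfm \<Rightarrow> real) \<Rightarrow> bool" where
  "solves_gfm_in_time P d T \<longleftrightarrow>
     (\<forall>I x w. gfm_instance I \<longrightarrow> encodes x I \<longrightarrow> word_size_suffices d x w \<longrightarrow>
       (\<exists>t s. run w P (initial_state x) t s \<and>
              regs s 0 = (if gfm_yes I then 1 else 0) \<and> real t \<le> T I))"

end

theory Submission imports Defs
begin

text \<open>Fix a breadth-first spanning forest. For every left vertex the program guesses which of its non-tree
  edges is in the matching, if any; a left vertex with \<open>k\<close> non-tree edges has \<open>k + 1 \<le> 2 ^ k\<close>
  choices, and by counting edges the forest leaves at most \<open>fes\<close> non-tree edges, so an odometer runs
  through at most \<open>2 ^ fes\<close> guesses. For a fixed guess, one pass over the forest in reverse search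
  order determines for each vertex whether the edge to its parent may be, and may be absent from,
  the matching. At a right vertex the number of matched vertices of color \<open>c\<close> then ranges over an
  interval from \<open>LO c\<close> to \<open>HI c\<close>, and these numbers can be chosen within \<open>l\<close> of each other if and
  only if \<open>max LO \<le> l + min HI\<close>. Arrays are indexed by vertex and color directly, without sorting, so
  the pass takes linear time; the factor \<open>log n\<close> is not needed.\<close>

section \<open>Programs with arrays\<close>

text \<open>The time bound does not mention the number of colors, which may far exceed the number of
  vertices. So no round may loop over the colors or wipe a two-dimensional array: memory is zero at
  the start, every cell written in a color-indexed table is logged, and fairness is read off a
  running maximum and a table of counts. A round makes at most \<open>2 * n\<close> such updates,
  which bounds the log.

  Minimality of the feedback edge set enters only through a counting inequality. Component numbers
  are constant along edges and differ between roots; the same labelling, on the acyclic graph left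
  by an optimal set, bounds the number of edges. Spanning forests never have to be compared with
  each other.

  The values computed at a vertex are meaningful only if each of its children has a possible state.
  The evaluation nevertheless runs on after a failure and only raises a flag: one vertex without a
  possible state already refutes the guess.

  Reading the input takes time linear in the numbers of vertices and edges. There are at most
  \<open>n + fes\<close> edges, so this fits into the bound.\<close>

text \<open>A layer above the word RAM with unbounded numbers and two-dimensional arrays: entry \<open>(a, b)\<close> of
  array \<open>j\<close> is memory cell \<open>(j * M + a) * M + b\<close>, where \<open>M\<close> is kept in register 1. Runs exist only as
  long as all indices and results stay below \<open>M\<close>, which is what makes the compilation exact.\<close>

datatype ax = Num nat | Var nat | Arr nat ax ax | Op binop ax ax

datatype ac =
    Nop
  | SetR nat ax
  | Put nat ax ax ax
  | Then ac ac (infixr ";;" 60)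
  | Cond ax ac ac
  | Loop ax ac

record ast =
  rg :: "nat \<Rightarrow> nat"
  ar :: "nat \<Rightarrow> nat \<Rightarrow> nat \<Rightarrow> nat"

abbreviation upd_reg :: "ast \<Rightarrow> nat \<Rightarrow> nat \<Rightarrow> ast" where
  "upd_reg s r v \<equiv> s\<lparr>rg := (rg s)(r := v)\<rparr>"

abbreviation upd_arr :: "ast \<Rightarrow> nat \<Rightarrow> nat \<Rightarrow> nat \<Rightarrow> nat \<Rightarrow> ast" where
  "upd_arr s j a b v \<equiv> s\<lparr>ar := (ar s)(j := (ar s j)(a := (ar s j a)(b := v)))\<rparr>"

fun aval :: "ast \<Rightarrow> ax \<Rightarrow> nat" where
  "aval s (Num a) = a"
| "aval s (Var r) = rg s r"
| "aval s (Arr j a b) = ar s j (aval s a) (aval s b)"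
| "aval s (Op f a b) = binop_val f (aval s a) (aval s b)"

text \<open>Only indices, constants and results of operations are bounded by \<open>M\<close>; a
  loaded value is not. Thresholds may therefore exceed \<open>M\<close>: they occur only as
  subtrahends. Register 1 is excluded because it holds \<open>M\<close> itself, which the abstract
  state does not record.\<close>

fun aok :: "nat \<Rightarrow> ast \<Rightarrow> ax \<Rightarrow> bool" where
  "aok M s (Num a) \<longleftrightarrow> a < M"
| "aok M s (Var r) \<longleftrightarrow> r \<noteq> 1"
| "aok M s (Arr j a b) \<longleftrightarrow> j < 32 \<and> aok M s a \<and> aok M s b \<and> aval s a < M \<and> aval s b < M"
| "aok M s (Op f a b) \<longleftrightarrow> aok M s a \<and> aok M s b \<and> binop_val f (aval s a) (aval s b) < M"

definition cell :: "nat \<Rightarrow> exp \<Rightarrow> exp \<Rightarrow> exp" where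
  "cell j a b = Bin Add (Bin Mul (Bin Add (Bin Mul (Const j) (Reg 1)) a) (Reg 1)) b"

fun cx :: "ax \<Rightarrow> exp" where
  "cx (Num a) = Const a"
| "cx (Var r) = Reg r"
| "cx (Arr j a b) = Load (cell j (cx a) (cx b))"
| "cx (Op f a b) = Bin f (cx a) (cx b)"

fun cc :: "ac \<Rightarrow> com" where
  "cc Nop = Skip"
| "cc (SetR r e) = Assign r (cx e)"
| "cc (Put j a b e) = Store (cell j (cx a) (cx b)) (cx e)"
| "cc (P ;; Q) = Seq (cc P) (cc Q)"
| "cc (Cond e P Q) = If (cx e) (cc P) (cc Q)"
| "cc (Loop e P) = While (cx e) (cc P)"

section \<open>Execution of array programs and exactness of their compilation\<close>

inductive arun :: "nat \<Rightarrow> ac \<Rightarrow> ast \<Rightarrow> nat \<Rightarrow> ast \<Rightarrow> bool" for M :: nat where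
  Nop: "arun M Nop s 1 s"
| SetR: "aok M s e \<Longrightarrow> r \<noteq> 1 \<Longrightarrow> arun M (SetR r e) s (1 + exp_time (cx e)) (upd_reg s r (aval s e))"
| Put: "aok M s (Arr j a b) \<Longrightarrow> aok M s e \<Longrightarrow>
    arun M (Put j a b e) s (1 + exp_time (cell j (cx a) (cx b)) + exp_time (cx e))
      (upd_arr s j (aval s a) (aval s b) (aval s e))"
| Then: "arun M P s t s' \<Longrightarrow> arun M Q s' t' s'' \<Longrightarrow> arun M (P ;; Q) s (t + t') s''"
| CondT: "aok M s e \<Longrightarrow> aval s e \<noteq> 0 \<Longrightarrow> arun M P s t s' \<Longrightarrow>
    arun M (Cond e P Q) s (1 + exp_time (cx e) + t) s'"
| CondF: "aok M s e \<Longrightarrow> aval s e = 0 \<Longrightarrow> arun M Q s t s' \<Longrightarrow>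
    arun M (Cond e P Q) s (1 + exp_time (cx e) + t) s'"
| LoopT: "aok M s e \<Longrightarrow> aval s e \<noteq> 0 \<Longrightarrow> arun M P s t s' \<Longrightarrow> arun M (Loop e P) s' t' s'' \<Longrightarrow>
    arun M (Loop e P) s (1 + exp_time (cx e) + t + t') s''"
| LoopF: "aok M s e \<Longrightarrow> aval s e = 0 \<Longrightarrow> arun M (Loop e P) s (1 + exp_time (cx e)) s"

definition addr :: "nat \<Rightarrow> nat \<Rightarrow> nat \<Rightarrow> nat \<Rightarrow> nat" where
  "addr M j a b = (j * M + a) * M + b"

definition represents :: "nat \<Rightarrow> state \<Rightarrow> ast \<Rightarrow> bool" where
  "represents M z s \<longleftrightarrow> regs z 1 = M \<and> (\<forall>r. r \<noteq> 1 \<longrightarrow> regs z r = rg s r) \<and>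
     (\<forall>j a b. j < 32 \<longrightarrow> a < M \<longrightarrow> b < M \<longrightarrow> mem z (addr M j a b) = ar s j a b)"

lemma mixed_radix_unique:
  fixes M :: nat
  assumes "a * M + b = a' * M + b'" "b < M" "b' < M"
  shows "a = a'" "b = b'"
proof -
  have "(a * M + b) div M = a" "(a' * M + b') div M = a'" using assms(2,3) by auto
  then show "a = a'" using assms(1) by simp
  then show "b = b'" using assms(1) by simp
qed

lemma addr_inject:
  assumes "addr M j a b = addr M j' a' b'" "a < M" "b < M" "a' < M" "b' < M"
  shows "j = j' \<and> a = a' \<and> b = b'"
  using assms mixed_radix_unique unfolding addr_def by metis

lemma addr_less:
  assumes "j < 32" "a < M" "b < M"
  shows "addr M j a b < 32 * M * M"
proof -
  have "j * M + a < (j + 1) * M" using assms by simp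
  also have "\<dots> \<le> 32 * M" using assms by (intro mult_right_mono) auto
  finally have "j * M + a + 1 \<le> 32 * M" by simp
  then have "(j * M + a + 1) * M \<le> 32 * M * M" by (rule mult_right_mono) simp
  then show ?thesis unfolding addr_def using assms by simp
qed

text \<open>In Horner's scheme every intermediate value is at most the final address, as
  \<open>0 < M\<close>. That address is below \<open>32 * M * M\<close>, so nothing wraps around
  modulo \<open>2 ^ w\<close>.\<close>

lemma cell_val:
  assumes "32 * M * M \<le> 2 ^ w" "regs z 1 = M" "j < 32"
    and "exp_val w z a = x" "exp_val w z b = y" "x < M" "y < M"
  shows "exp_val w z (cell j a b) = addr M j x y"
proof -
  have M: "0 < M" using assms by simp
  have l: "addr M j x y < 2 ^ w" using addr_less assms by (meson less_le_trans)
  have l2: "(j * M + x) * M < 2 ^ w" using l unfolding addr_def by simp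
  have "j * M + x \<le> (j * M + x) * M" using M by simp
  then have l3: "j * M + x < 2 ^ w" using l2 by linarith
  have l4: "j * M < 2 ^ w" using l3 by simp
  have "j \<le> j * M" using M by simp
  then have l5: "j < 2 ^ w" using l4 by linarith
  show ?thesis unfolding cell_def using assms l l2 l3 l4 l5 by (simp add: addr_def)
qed

lemma cx_val:
  assumes "32 * M * M \<le> 2 ^ w" "represents M z s" "aok M s e"
  shows "exp_val w z (cx e) = aval s e"
  using assms(3)
proof (induction e)
  case (Num a)
  then have "a < 2 ^ w" using assms(1) by (cases M) auto
  then show ?case by simp
next
  case (Var r)
  then show ?case using assms(2) by (simp add: represents_def)
next
  case (Arr j a b)
  have "exp_val w z (cell j (cx a) (cx b)) = addr M j (aval s a) (aval s b)"
    using Arr assms(1,2) by (intro cell_val) (auto simp: represents_def)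
  then show ?case using Arr assms(2) by (simp add: represents_def)
next
  case (Op f a b)
  then have "binop_val f (aval s a) (aval s b) < 2 ^ w" using assms(1) by (cases M) auto
  then show ?case using Op by simp
qed

text \<open>Times in \<open>arun\<close> are those of the compiled expressions, so the simulation
  keeps \<open>t\<close> unchanged and the cost analysis can stay with unbounded numbers.\<close>

lemma compile_correct:
  assumes "arun M P s t s'" "32 * M * M \<le> 2 ^ w" "represents M z s"
  shows "\<exists>z'. run w (cc P) z t z' \<and> represents M z' s'"
  using assms(1,3)
proof (induction arbitrary: z rule: arun.induct)
  case (Nop s)
  show ?case unfolding cc.simps using run.Skip Nop by blast
next
  case (SetR s e r)
  have 1: "represents M (z\<lparr>regs := (regs z)(r := aval s e)\<rparr>) (upd_reg s r (aval s e))"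
    using SetR by (auto simp: represents_def)
  show ?case unfolding cc.simps
    using run.Assign[of w r "cx e" z, unfolded cx_val[OF assms(2) SetR.prems SetR.hyps(1)]] 1 by blast
next
  case (Put s j a b e)
  have c: "exp_val w z (cell j (cx a) (cx b)) = addr M j (aval s a) (aval s b)"
    using Put assms(2) cx_val[OF assms(2) Put.prems] by (intro cell_val) (auto simp: represents_def)
  have 1: "represents M (z\<lparr>mem := (mem z)(addr M j (aval s a) (aval s b) := aval s e)\<rparr>)
      (upd_arr s j (aval s a) (aval s b) (aval s e))"
    unfolding represents_def
  proof (intro conjI allI impI)
    fix j' a' b' :: nat assume "j' < 32" "a' < M" "b' < M"
    then show "mem (z\<lparr>mem := (mem z)(addr M j (aval s a) (aval s b) := aval s e)\<rparr>) (addr M j' a' b') =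
      ar (upd_arr s j (aval s a) (aval s b) (aval s e)) j' a' b'"
      using addr_inject[of M j' a' b' j "aval s a" "aval s b"] Put.hyps Put.prems
      by (cases "j' = j \<and> a' = aval s a \<and> b' = aval s b") (auto simp: represents_def)
  qed (use Put.prems in \<open>auto simp: represents_def\<close>)
  show ?case unfolding cc.simps
    using run.Store[of w "cell j (cx a) (cx b)" "cx e" z,
        unfolded c cx_val[OF assms(2) Put.prems Put.hyps(2)]] 1 by blast
next
  case (Then P s t s' Q t' s'')
  obtain z1 where 1: "run w (cc P) z t z1" "represents M z1 s'" using Then.IH(1)[OF Then.prems] by blast
  obtain z2 where 2: "run w (cc Q) z1 t' z2" "represents M z2 s''" using Then.IH(2)[OF 1(2)] by blast
  show ?case unfolding cc.simps using run.Seq[OF 1(1) 2(1)] 2(2) by blast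
next
  case (CondT s e P t s' Q)
  obtain z1 where 1: "run w (cc P) z t z1" "represents M z1 s'" using CondT.IH[OF CondT.prems] by blast
  have "exp_val w z (cx e) \<noteq> 0" using cx_val[OF assms(2) CondT.prems] CondT.hyps by simp
  then show ?case unfolding cc.simps using run.IfTrue[OF _ 1(1)] 1(2) by blast
next
  case (CondF s e Q t s' P)
  obtain z1 where 1: "run w (cc Q) z t z1" "represents M z1 s'" using CondF.IH[OF CondF.prems] by blast
  have "exp_val w z (cx e) = 0" using cx_val[OF assms(2) CondF.prems] CondF.hyps by simp
  then show ?case unfolding cc.simps using run.IfFalse[OF _ 1(1)] 1(2) by blast
next
  case (LoopT s e P t s' t' s'')
  obtain z1 where 1: "run w (cc P) z t z1" "represents M z1 s'" using LoopT.IH(1)[OF LoopT.prems] by blast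
  obtain z2 where 2: "run w (cc (Loop e P)) z1 t' z2" "represents M z2 s''"
    using LoopT.IH(2)[OF 1(2)] by blast
  have "exp_val w z (cx e) \<noteq> 0" using cx_val[OF assms(2) LoopT.prems] LoopT.hyps by simp
  then show ?case using run.WhileTrue[OF _ 1(1) 2(1)[unfolded cc.simps]] 2(2) unfolding cc.simps by blast
next
  case (LoopF s e P)
  have "exp_val w z (cx e) = 0" using cx_val[OF assms(2) LoopF.prems] LoopF.hyps by simp
  from run.WhileFalse[OF this] show ?case unfolding cc.simps using LoopF.prems by blast
qed

section \<open>Write sets and timed total correctness\<close>

fun mreg :: "ac \<Rightarrow> nat set" where
  "mreg Nop = {}"
| "mreg (SetR r e) = {r}"
| "mreg (Put j a b e) = {}"
| "mreg (P ;; Q) = mreg P \<union> mreg Q"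
| "mreg (Cond e P Q) = mreg P \<union> mreg Q"
| "mreg (Loop e P) = mreg P"

fun marr :: "ac \<Rightarrow> nat set" where
  "marr Nop = {}"
| "marr (SetR r e) = {}"
| "marr (Put j a b e) = {j}"
| "marr (P ;; Q) = marr P \<union> marr Q"
| "marr (Cond e P Q) = marr P \<union> marr Q"
| "marr (Loop e P) = marr P"

text \<open>The write sets are syntactic, so this relation comes for free with every run, and
  invariants need not list what a phase leaves alone.\<close>

definition frame :: "ac \<Rightarrow> ast \<Rightarrow> ast \<Rightarrow> bool" where
  "frame P s s' \<longleftrightarrow> (\<forall>r. r \<notin> mreg P \<longrightarrow> rg s' r = rg s r) \<and> (\<forall>j. j \<notin> marr P \<longrightarrow> ar s' j = ar s j)"

lemma frame_refl: "frame P s s"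
  by (simp add: frame_def)

lemma frame_trans: "frame P s s' \<Longrightarrow> frame P s' s'' \<Longrightarrow> frame P s s''"
  by (simp add: frame_def)

lemma arun_frame: "arun M P s t s' \<Longrightarrow> frame P s s'"
  by (induction rule: arun.induct) (auto simp: frame_def)

definition tri :: "nat \<Rightarrow> ac \<Rightarrow> ast \<Rightarrow> nat \<Rightarrow> (ast \<Rightarrow> bool) \<Rightarrow> bool" where
  "tri M P s T Q \<longleftrightarrow> (\<exists>t s'. arun M P s t s' \<and> t \<le> T \<and> Q s')"

lemma triI: "arun M P s t s' \<Longrightarrow> t \<le> T \<Longrightarrow> Q s' \<Longrightarrow> tri M P s T Q"
  unfolding tri_def by blast

lemma tri_frame: "tri M P s T Q \<Longrightarrow> tri M P s T (\<lambda>s'. Q s' \<and> frame P s s')"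
  unfolding tri_def using arun_frame by blast

lemma tri_mono: "tri M P s T Q \<Longrightarrow> T \<le> T' \<Longrightarrow> (\<And>s'. Q s' \<Longrightarrow> Q' s') \<Longrightarrow> tri M P s T' Q'"
  unfolding tri_def by (meson order_trans)

lemma tri_mono_frame:
  assumes "tri M P s T Q" "T \<le> T'" "\<And>s'. Q s' \<Longrightarrow> frame P s s' \<Longrightarrow> Q' s'"
  shows "tri M P s T' Q'"
  using tri_mono[OF tri_frame[OF assms(1)] assms(2)] assms(3) by blast

lemma tri_seq:
  assumes "tri M P s T Q" "\<And>s'. Q s' \<Longrightarrow> frame P s s' \<Longrightarrow> tri M P' s' T' R" "T + T' \<le> T''"
  shows "tri M (P ;; P') s T'' R"
proof -
  obtain t s' where 1: "arun M P s t s'" "t \<le> T" "Q s'" using assms(1) by (auto simp: tri_def)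
  obtain t' s'' where 2: "arun M P' s' t' s''" "t' \<le> T'" "R s''"
    using assms(2)[OF 1(3) arun_frame[OF 1(1)]] by (auto simp: tri_def)
  have "t + t' \<le> T''" using 1 2 assms(3) by simp
  then show ?thesis unfolding tri_def using arun.Then[OF 1(1) 2(1)] 2(3) by blast
qed

text \<open>The index of the invariant bounds the number of remaining iterations.\<close>

lemma tri_loop:
  assumes inv: "Inv k s"
    and ok: "\<And>k' s'. Inv k' s' \<Longrightarrow> frame P s s' \<Longrightarrow> aok M s' e"
    and body: "\<And>k' s'. Inv k' s' \<Longrightarrow> frame P s s' \<Longrightarrow> aval s' e \<noteq> 0 \<Longrightarrow>
      tri M P s' K (\<lambda>s''. \<exists>k'' < k'. Inv k'' s'')"
  shows "tri M (Loop e P) s ((1 + exp_time (cx e) + K) * k + 1 + exp_time (cx e))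
    (\<lambda>s'. (\<exists>k'. Inv k' s') \<and> aval s' e = 0)"
proof -
  have "tri M (Loop e P) s' ((1 + exp_time (cx e) + K) * k' + 1 + exp_time (cx e))
      (\<lambda>s'. (\<exists>k'. Inv k' s') \<and> aval s' e = 0)"
    if "Inv k' s'" "frame P s s'" for k' s'
    using that
  proof (induction k' arbitrary: s' rule: less_induct)
    case (less k')
    show ?case
    proof (cases "aval s' e = 0")
      case True
      then show ?thesis unfolding tri_def using arun.LoopF[OF ok[OF less.prems] True] less.prems
        by (metis add.assoc le_add2)
    next
      case False
      obtain t s1 k1 where 1: "arun M P s' t s1" "t \<le> K" "k1 < k'" "Inv k1 s1"
        using body[OF less.prems False] by (auto simp: tri_def)
      obtain t' s2 where 2: "arun M (Loop e P) s1 t' s2"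
          "t' \<le> (1 + exp_time (cx e) + K) * k1 + 1 + exp_time (cx e)"
          "(\<exists>k'. Inv k' s2) \<and> aval s2 e = 0"
        using less.IH[OF 1(3,4) frame_trans[OF less.prems(2) arun_frame[OF 1(1)]]]
        by (auto simp: tri_def)
      have "(1 + exp_time (cx e) + K) * Suc k1 \<le> (1 + exp_time (cx e) + K) * k'"
        using 1(3) by (intro mult_left_mono) auto
      then have "1 + exp_time (cx e) + t + t' \<le> (1 + exp_time (cx e) + K) * k' + 1 + exp_time (cx e)"
        using 1(2) 2(2) by (simp add: algebra_simps)
      then show ?thesis
        unfolding tri_def using arun.LoopT[OF ok[OF less.prems] False 1(1) 2(1)] 2(3) by blast
    qed
  qed
  then show ?thesis using inv frame_refl by blast
qed

section \<open>Weakest preconditions of loop-free code\<close>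

fun wp :: "nat \<Rightarrow> ac \<Rightarrow> (ast \<Rightarrow> bool) \<Rightarrow> ast \<Rightarrow> bool" where
  "wp M Nop Q s \<longleftrightarrow> Q s"
| "wp M (SetR r e) Q s \<longleftrightarrow> aok M s e \<and> r \<noteq> 1 \<and> Q (upd_reg s r (aval s e))"
| "wp M (Put j a b e) Q s \<longleftrightarrow> aok M s (Arr j a b) \<and> aok M s e \<and>
     Q (upd_arr s j (aval s a) (aval s b) (aval s e))"
| "wp M (P ;; P') Q s \<longleftrightarrow> wp M P (wp M P' Q) s"
| "wp M (Cond e P P') Q s \<longleftrightarrow> aok M s e \<and> (aval s e \<noteq> 0 \<longrightarrow> wp M P Q s) \<and> (aval s e = 0 \<longrightarrow> wp M P' Q s)"
| "wp M (Loop e P) Q s \<longleftrightarrow> False"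

text \<open>An upper bound: both branches of a conditional are charged. Loops are costed by
  \<open>tri_loop\<close>, and \<open>wp\<close> is false on them.\<close>

fun cost :: "ac \<Rightarrow> nat" where
  "cost Nop = 1"
| "cost (SetR r e) = 1 + exp_time (cx e)"
| "cost (Put j a b e) = 1 + exp_time (cell j (cx a) (cx b)) + exp_time (cx e)"
| "cost (P ;; P') = cost P + cost P'"
| "cost (Cond e P P') = 1 + exp_time (cx e) + cost P + cost P'"
| "cost (Loop e P) = 0"

lemma wp_mono:
  assumes "wp M P Q s" "\<And>s'. Q s' \<Longrightarrow> Q' s'"
  shows "wp M P Q' s"
proof -
  have imp: "\<forall>s. Q s \<longrightarrow> Q' s" using assms(2) by blast
  have "\<forall>s. wp M P Q s \<longrightarrow> wp M P Q' s" if "\<forall>s. Q s \<longrightarrow> Q' s" for Q Q' :: "ast \<Rightarrow> bool"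
    using that
  proof (induction P arbitrary: Q Q')
    case (Then P P')
    have "\<forall>s. wp M P' Q s \<longrightarrow> wp M P' Q' s" by (rule Then.IH(2)[OF Then.prems])
    from Then.IH(1)[OF this] show ?case unfolding wp.simps .
  next
    case (Cond e P P')
    show ?case unfolding wp.simps using Cond.IH(1)[OF Cond.prems] Cond.IH(2)[OF Cond.prems] by blast
  qed (simp_all only: wp.simps, blast+)
  from this[OF imp] assms(1) show ?thesis by blast
qed

lemma tri_wp: "wp M P Q s \<Longrightarrow> tri M P s (cost P) Q"
proof (induction P arbitrary: Q s)
  case Nop
  show ?case using Nop by (intro triI[OF arun.Nop]) simp_all
next
  case (SetR r e)
  show ?case using SetR by (intro triI[OF arun.SetR]) simp_all
next
  case (Put j a b e)
  show ?case using Put by (intro triI[OF arun.Put]) simp_all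
next
  case (Then P P')
  then have "tri M P s (cost P) (wp M P' Q)" by simp
  from this Then.IH(2) show ?case by (rule tri_seq[where T'="cost P'"]) simp_all
next
  case (Cond e P P')
  show ?case
  proof (cases "aval s e = 0")
    case True
    then have "tri M P' s (cost P') Q" using Cond by auto
    then obtain t s' where "arun M P' s t s'" "t \<le> cost P'" "Q s'" by (auto simp: tri_def)
    then show ?thesis using Cond.prems True arun.CondF[of M s e P' t s' P]
      unfolding tri_def by (intro exI[of _ "1 + exp_time (cx e) + t"] exI[of _ s']) auto
  next
    case False
    then have "tri M P s (cost P) Q" using Cond by auto
    then obtain t s' where "arun M P s t s'" "t \<le> cost P" "Q s'" by (auto simp: tri_def)
    then show ?thesis using Cond.prems False arun.CondT[of M s e P t s' P']
      unfolding tri_def by (intro exI[of _ "1 + exp_time (cx e) + t"] exI[of _ s']) auto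
  qed
qed auto

lemma wp_then: "wp M (P ;; P') Q = wp M P (wp M P' Q)"
  by (simp add: fun_eq_iff)

lemma wp_frame: "wp M P Q s \<Longrightarrow> wp M P (\<lambda>s'. Q s' \<and> frame P s s') s"
proof (induction P arbitrary: Q s)
  case (Then P P')
  then have "wp M P (wp M P' Q) s" by simp
  from Then.IH(1)[OF this] have "wp M P (wp M P' (\<lambda>s'. Q s' \<and> frame (P ;; P') s s')) s"
  proof (rule wp_mono)
    fix s1 assume 1: "wp M P' Q s1 \<and> frame P s s1"
    then have "wp M P' (\<lambda>s'. Q s' \<and> frame P' s1 s') s1" using Then.IH(2) by blast
    then show "wp M P' (\<lambda>s'. Q s' \<and> frame (P ;; P') s s') s1"
      by (rule wp_mono) (use 1 in \<open>simp add: frame_def\<close>)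
  qed
  then show ?case by simp
next
  case (Cond e P P')
  have "wp M P (\<lambda>s'. Q s' \<and> frame (Cond e P P') s s') s" if "wp M P Q s"
    using Cond.IH(1)[OF that] by (rule wp_mono) (simp add: frame_def)
  moreover have "wp M P' (\<lambda>s'. Q s' \<and> frame (Cond e P P') s s') s" if "wp M P' Q s"
    using Cond.IH(2)[OF that] by (rule wp_mono) (simp add: frame_def)
  ultimately show ?case using Cond.prems by simp
qed (auto simp: frame_def)

definition For :: "nat \<Rightarrow> nat \<Rightarrow> ac \<Rightarrow> ac" where
  "For r b P = SetR r (Num 0) ;; Loop (Op Less (Var r) (Var b)) (P ;; SetR r (Op Add (Var r) (Num 1)))"

lemma mreg_For [simp]: "mreg (For r b P) = insert r (mreg P)"
  by (auto simp: For_def)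

lemma marr_For [simp]: "marr (For r b P) = marr P"
  by (simp add: For_def)

text \<open>The counter is advanced after the body, hence the invariant is asked of the state with
  \<open>r\<close> already set to \<open>Suc i\<close>. Each round pays 4 for the guard and 4 for
  the increment; the 6 outside is 2 for the initialization and 4 for the failing guard.\<close>

lemma tri_for:
  assumes N: "rg s b = N" "N < M" "2 \<le> M"
    and reg: "r \<notin> mreg P" "b \<notin> mreg P" "r \<noteq> b" "r \<noteq> 1" "b \<noteq> 1"
    and inv: "Inv 0 (upd_reg s r 0)"
    and body: "\<And>i s'. i < N \<Longrightarrow> Inv i s' \<Longrightarrow> rg s' r = i \<Longrightarrow> frame (For r b P) s s' \<Longrightarrow>
      tri M P s' K (\<lambda>s''. Inv (Suc i) (upd_reg s'' r (Suc i)))"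
  shows "tri M (For r b P) s ((K + 8) * N + 6) (Inv N)"
proof -
  let ?B = "P ;; SetR r (Op Add (Var r) (Num 1))"
  \<comment> \<open>\<open>tri_loop\<close> counts the remaining rounds, \<open>Inv\<close> the
    completed ones.\<close>
  define J where "J k s' \<longleftrightarrow> k \<le> N \<and> Inv (N - k) s' \<and> rg s' r = N - k" for k s'
  let ?s = "upd_reg s r 0"
  have fr: "frame (For r b P) s s'" if "frame ?B ?s s'" for s'
    using that by (auto simp: frame_def For_def)
  have bN: "rg s' b = N" if "frame ?B ?s s'" for s'
    using that reg N by (auto simp: frame_def)
  have "tri M (Loop (Op Less (Var r) (Var b)) ?B) ?s
    ((1 + exp_time (cx (Op Less (Var r) (Var b))) + (K + 4)) * N + 1 + exp_time (cx (Op Less (Var r) (Var b))))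
    (\<lambda>s'. (\<exists>k'. J k' s') \<and> aval s' (Op Less (Var r) (Var b)) = 0)"
  proof (rule tri_loop)
    show "J N ?s" using inv by (simp add: J_def)
  next
    fix k' s' assume "J k' s'" "frame ?B ?s s'"
    then show "aok M s' (Op Less (Var r) (Var b))" using N reg by simp
  next
    fix k' s' assume J: "J k' s'" and f: "frame ?B ?s s'" and v: "aval s' (Op Less (Var r) (Var b)) \<noteq> 0"
    have k': "0 < k'" "k' \<le> N" using J v bN[OF f] by (auto simp: J_def split: if_splits)
    have t: "tri M P s' K (\<lambda>s''. Inv (Suc (N - k')) (upd_reg s'' r (Suc (N - k'))))"
      using J k' fr[OF f] by (intro body) (auto simp: J_def)
    show "tri M ?B s' (K + 4) (\<lambda>s''. \<exists>k'' < k'. J k'' s'')"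
    proof (rule tri_seq[OF t])
      fix s1 assume 1: "Inv (Suc (N - k')) (upd_reg s1 r (Suc (N - k')))" "frame P s' s1"
      have "rg s1 r = N - k'" using 1(2) reg J by (auto simp: frame_def J_def)
      moreover have "Suc (N - k') = N - (k' - 1)" using k' by simp
      ultimately have "wp M (SetR r (Op Add (Var r) (Num 1))) (J (k' - 1)) s1"
        using 1 k' N reg by (auto simp: J_def)
      from tri_wp[OF this] show "tri M (SetR r (Op Add (Var r) (Num 1))) s1 4 (\<lambda>s''. \<exists>k'' < k'. J k'' s'')"
        using k' by (elim tri_mono) (auto intro: exI[of _ "k' - 1"])
    qed simp
  qed
  then have 1: "tri M (Loop (Op Less (Var r) (Var b)) ?B) ?s ((K + 8) * N + 4) (Inv N)"
  proof (rule tri_mono_frame)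
    fix s' assume "(\<exists>k'. J k' s') \<and> aval s' (Op Less (Var r) (Var b)) = 0"
      "frame (Loop (Op Less (Var r) (Var b)) ?B) ?s s'"
    moreover from this(2) have "frame ?B ?s s'" by (simp add: frame_def)
    ultimately obtain k' where k': "J k' s'" "\<not> rg s' r < N" using bN by (auto split: if_splits)
    then have "N - k' = N" by (auto simp: J_def)
    with k' show "Inv N s'" by (simp add: J_def)
  qed simp
  show ?thesis unfolding For_def
  proof (rule tri_seq[OF tri_wp])
    show "wp M (SetR r (Num 0)) (\<lambda>s'. s' = ?s) s" using N reg by simp
  qed (use 1 in auto)
qed

section \<open>Edges of acyclic graphs\<close>

lemma acyclic_graph_mono: "acyclic_graph A \<Longrightarrow> A' \<subseteq> A \<Longrightarrow> acyclic_graph A'"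
  unfolding acyclic_graph_def is_cycle_def by blast

text \<open>Without a leaf, the first vertex of a longest path has a second neighbour. By maximality
  this neighbour lies on the path, and it closes a cycle.\<close>

lemma acyclic_leaf:
  assumes ac: "acyclic_graph A" and fin: "finite A" and ne: "A \<noteq> {}"
    and pairs: "A \<subseteq> {{x, y} | x y. x \<noteq> y}"
  shows "\<exists>x y. {x, y} \<in> A \<and> (\<forall>z. {x, z} \<in> A \<longrightarrow> z = y)"
proof (rule ccontr)
  assume neg: "\<not> ?thesis"
  define path where
    "path p \<longleftrightarrow> 2 \<le> length p \<and> distinct p \<and> (\<forall>i. Suc i < length p \<longrightarrow> {p ! i, p ! Suc i} \<in> A)" for p
  have finU: "finite (\<Union>A)" using fin pairs by fastforce
  have sub: "set p \<subseteq> \<Union>A" if "path p" for p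
  proof
    fix x assume "x \<in> set p"
    then obtain i where i: "i < length p" "x = p ! i" by (auto simp: in_set_conv_nth)
    show "x \<in> \<Union>A"
    proof (cases "Suc i < length p")
      case True
      then have "{p ! i, p ! Suc i} \<in> A" using that by (auto simp: path_def)
      then show ?thesis using i by blast
    next
      case False
      then have "Suc (i - 1) < length p" "Suc (i - 1) = i" using i that by (auto simp: path_def)
      then have "{p ! (i - 1), p ! i} \<in> A" using that unfolding path_def by metis
      then show ?thesis using i by blast
    qed
  qed
  have len: "length p \<le> card (\<Union>A)" if "path p" for p
    using card_mono[OF finU sub[OF that]] that by (simp add: path_def distinct_card)
  obtain e where "e \<in> A" using ne by blast
  then obtain a b where ab: "{a, b} \<in> A" "a \<noteq> b" using pairs by blast
  have "path [a, b]" using ab by (auto simp: path_def less_Suc_eq)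
  then obtain p where p: "path p" and max: "\<And>p'. path p' \<Longrightarrow> length p' \<le> length p"
    using len arg_max_nat_lemma[of path "[a, b]" length "card (\<Union>A) + 1"]
    by (metis le_imp_less_Suc Suc_eq_plus1)
  have 2: "2 \<le> length p" "distinct p" "{p ! 0, p ! 1} \<in> A" using p by (auto simp: path_def)
  obtain y where y: "{p ! 0, y} \<in> A" "y \<noteq> p ! 1" using neg 2 by metis
  have y0: "y \<noteq> p ! 0"
  proof
    assume "y = p ! 0"
    then have "{p ! 0} \<in> A" using y by simp
    then show False using pairs by fastforce
  qed
  have "y \<in> set p"
  proof (rule ccontr)
    assume n: "y \<notin> set p"
    have "{(y # p) ! i, (y # p) ! Suc i} \<in> A" if "Suc i < length (y # p)" for i
    proof (cases i)
      case 0
      then show ?thesis using y by (simp add: insert_commute)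
    next
      case (Suc j)
      then show ?thesis using that p by (simp add: path_def)
    qed
    then have "path (y # p)" using p n by (simp add: path_def)
    then show False using max by fastforce
  qed
  then obtain k where k: "k < length p" "y = p ! k" by (auto simp: in_set_conv_nth)
  have k2: "2 \<le> k"
  proof (rule ccontr)
    assume "\<not> 2 \<le> k"
    then have "k = 0 \<or> k = 1" by auto
    then show False using k y y0 by blast
  qed
  \<comment> \<open>The prefix up to \<open>k\<close> is closed by the edge from
    \<open>p ! k\<close> back to \<open>p ! 0\<close>; \<open>2 \<le> k\<close> makes it long enough
    to be a cycle.\<close>
  have "is_cycle A (take (Suc k) p)"
    unfolding is_cycle_def
  proof (intro conjI allI impI)
    show "3 \<le> length (take (Suc k) p)" using k k2 by simp
    show "distinct (take (Suc k) p)" using 2 by simp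
    fix i assume "i < length (take (Suc k) p)"
    then have i: "i \<le> k" using k by simp
    show "{take (Suc k) p ! i, take (Suc k) p ! (Suc i mod length (take (Suc k) p))} \<in> A"
    proof (cases "i = k")
      case True
      then show ?thesis using k y by (simp add: insert_commute)
    next
      case False
      then show ?thesis using k i p by (simp add: path_def)
    qed
  qed
  then show False using ac by (auto simp: acyclic_graph_def)
qed

text \<open>A forest has as many edges as vertices minus components, and a labelling constant along
  edges has no more labels than there are components. Deleting a leaf proves the combination
  directly, without defining components.\<close>

lemma acyclic_card:
  assumes "finite S" "acyclic_graph A" "A \<subseteq> {{x, y} | x y. x \<in> S \<and> y \<in> S \<and> x \<noteq> y}"
    and "\<And>x y. {x, y} \<in> A \<Longrightarrow> g x = g y"
  shows "card A + card (g ` S) \<le> card S"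
  using assms
proof (induction "card S" arbitrary: S A)
  case 0
  then have "S = {}" by simp
  moreover from this have "A = {}" using 0 by auto
  ultimately show ?case by simp
next
  case (Suc k)
  have finA: "finite A"
  proof (rule finite_subset)
    show "A \<subseteq> Pow S" using Suc.prems(3) by auto
  qed (use Suc.prems in simp)
  show ?case
  proof (cases "A = {}")
    case True
    then show ?thesis using Suc.prems card_image_le by simp
  next
    case False
    have "A \<subseteq> {{x, y} | x y. x \<noteq> y}" using Suc.prems(3) by blast
    from acyclic_leaf[OF Suc.prems(2) finA False this]
    obtain x y where xy: "{x, y} \<in> A" "\<And>z. {x, z} \<in> A \<Longrightarrow> z = y" by blast
    have S: "x \<in> S" "y \<in> S" "x \<noteq> y" using xy(1) Suc.prems(3) by (auto simp: doubleton_eq_iff)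
    let ?S = "S - {x}" and ?A = "A - {{x, y}}"
    have "card ?A + card (g ` ?S) \<le> card ?S"
    proof (rule Suc.hyps(1))
      show "k = card ?S" using Suc.hyps(2) S Suc.prems(1) by simp
      show "acyclic_graph ?A" using Suc.prems(2) by (rule acyclic_graph_mono) blast
      show "?A \<subseteq> {{x, y} | x y. x \<in> ?S \<and> y \<in> ?S \<and> x \<noteq> y}"
      proof
        fix e assume e: "e \<in> ?A"
        then obtain a b where ab: "e = {a, b}" "a \<in> S" "b \<in> S" "a \<noteq> b" using Suc.prems(3) by blast
        have "a \<noteq> x" using ab e xy(2)[of b] by auto
        moreover have "b \<noteq> x" using ab e xy(2)[of a] by (auto simp: insert_commute)
        ultimately show "e \<in> {{x, y} | x y. x \<in> ?S \<and> y \<in> ?S \<and> x \<noteq> y}" using ab by blast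
      qed
    qed (use Suc.prems in auto)
    \<comment> \<open>The leaf shares its label with its neighbour, so no label is lost.\<close>
    moreover have "g ` S \<subseteq> g ` ?S"
    proof
      fix c assume "c \<in> g ` S"
      then obtain z where z: "z \<in> S" "c = g z" by blast
      show "c \<in> g ` ?S"
      proof (cases "z = x")
        case True
        then have "c = g y" using z Suc.prems(4)[OF xy(1)] by simp
        then show ?thesis using S by blast
      qed (use z in blast)
    qed
    then have "card (g ` ?S) = card (g ` S)" by (intro arg_cong[where f=card]) blast
    moreover have "card ?A = card A - 1" "0 < card A" using xy(1) finA by (auto simp: card_gt_0_iff)
    moreover have "card ?S = card S - 1" "0 < card S" using S Suc.prems(1) by (auto simp: card_gt_0_iff)
    ultimately show ?thesis by linarith
  qed
qed

text \<open>An optimal feedback edge set leaves an acyclic graph on which \<open>g\<close> is still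
  constant along edges, so the forest count applies to it. With the component numbers of the search
  as \<open>g\<close>, this bounds the number of non-tree edges.\<close>

lemma card_edges_le:
  assumes "finite S" "E \<subseteq> {{x, y} | x y. x \<in> S \<and> y \<in> S \<and> x \<noteq> y}"
    and "\<And>x y. {x, y} \<in> E \<Longrightarrow> g x = g y"
  shows "card E + card (g ` S) \<le> card S + feedback_edge_number E"
proof -
  have "E \<subseteq> Pow S" using assms(2) by auto
  then have finE: "finite E" using assms(1) by (meson finite_Pow_iff finite_subset)
  let ?X = "card ` {F. F \<subseteq> E \<and> acyclic_graph (E - F)}"
  \<comment> \<open>Removing every edge is always allowed, so the minimum ranges over a nonempty
    set.\<close>
  have "acyclic_graph (E - E)" unfolding acyclic_graph_def is_cycle_def by force
  then have "?X \<noteq> {}" by blast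
  moreover have "finite ?X" using finE by simp
  ultimately have "Min ?X \<in> ?X" by (rule Min_in[rotated])
  then obtain F where F: "F \<subseteq> E" "acyclic_graph (E - F)" "card F = feedback_edge_number E"
    unfolding feedback_edge_number_def by auto
  have "card (E - F) + card (g ` S) \<le> card S"
  proof (rule acyclic_card[OF assms(1) F(2)])
    show "E - F \<subseteq> {{x, y} | x y. x \<in> S \<and> y \<in> S \<and> x \<noteq> y}" using assms(2) by blast
  qed (use assms(3) in blast)
  moreover have "card E = card F + card (E - F)"
    using F finE by (metis add_diff_inverse_nat card_Diff_subset card_mono finite_subset linorder_not_le)
  ultimately show ?thesis using F by simp
qed

section \<open>Mixed radix counters\<close>

definition radix :: "(nat \<Rightarrow> nat) \<Rightarrow> nat \<Rightarrow> nat" where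
  "radix r k = (\<Prod>i<k. r i)"

definition dig :: "(nat \<Rightarrow> nat) \<Rightarrow> nat \<Rightarrow> nat \<Rightarrow> nat" where
  "dig r t k = t div radix r k mod r k"

lemma radix_0 [simp]: "radix r 0 = 1"
  and radix_Suc [simp]: "radix r (Suc k) = radix r k * r k"
  by (simp_all add: radix_def)

lemma radix_pos:
  assumes "\<And>i. i < k \<Longrightarrow> 0 < r i"
  shows "0 < radix r k"
  using assms by (induction k) auto

lemma dig_less: "0 < r k \<Longrightarrow> dig r t k < r k"
  by (simp add: dig_def)

lemma dig_0: "dig r 0 k = 0"
  by (simp add: dig_def)

text \<open>\<open>radix r k dvd Suc t\<close> expresses that all lower positions overflow, that is,
  that the increment carries into position \<open>k\<close>.\<close>

lemma dig_Suc:
  assumes "0 < r k"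
  shows "dig r (Suc t) k =
    (if radix r k dvd Suc t then if dig r t k + 1 < r k then dig r t k + 1 else 0 else dig r t k)"
proof -
  have "Suc (t div radix r k) mod r k = (if dig r t k + 1 < r k then dig r t k + 1 else 0)"
    using dig_less[of r k t, OF assms] unfolding dig_def by (simp add: mod_Suc)
  moreover have "Suc t div radix r k = (if radix r k dvd Suc t then Suc (t div radix r k) else t div radix r k)"
    by (simp only: div_Suc dvd_eq_mod_eq_0)
  ultimately show ?thesis unfolding dig_def by (cases "radix r k dvd Suc t") (simp_all only: if_True if_False simp_thms)
qed

text \<open>The carry leaves position \<open>k\<close> exactly if it arrives there and meets a
  maximal digit. This is the flag that the odometer program passes from digit to digit.\<close>

lemma radix_dvd_Suc:
  assumes "\<And>i. i \<le> k \<Longrightarrow> 0 < r i"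
  shows "radix r (Suc k) dvd Suc t \<longleftrightarrow> radix r k dvd Suc t \<and> \<not> dig r t k + 1 < r k"
proof (cases "radix r k dvd Suc t")
  case True
  have p: "radix r k \<noteq> 0" "0 < r k" using radix_pos[of k r] assms by fastforce+
  obtain a where a: "Suc t = radix r k * a" using True by blast
  have "radix r (Suc k) dvd Suc t \<longleftrightarrow> r k dvd a" unfolding a radix_Suc using p by simp
  also have "\<dots> \<longleftrightarrow> dig r (Suc t) k = 0" unfolding dig_def a using p by (simp add: dvd_eq_mod_eq_0)
  also have "\<dots> \<longleftrightarrow> \<not> dig r t k + 1 < r k" unfolding dig_Suc[of r k t, OF p(2)] using True by simp
  finally show ?thesis using True by simp
next
  case False
  then show ?thesis by (metis dvd_mult_left radix_Suc)
qed

text \<open>Guarantees that running the counter through all its values tries every choice.\<close>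

lemma dig_surj:
  assumes "\<And>i. i < k \<Longrightarrow> q i < r i"
  shows "\<exists>t < radix r k. \<forall>i<k. dig r t i = q i"
  using assms
proof (induction k)
  case 0
  then show ?case by simp
next
  case (Suc k)
  then obtain t where t: "t < radix r k" "\<forall>i<k. dig r t i = q i" by auto
  let ?t = "t + radix r k * q k"
  have r: "0 < r i" if "i \<le> k" for i using Suc.prems[of i] that by simp
  have p: "0 < radix r k" using r by (intro radix_pos) simp
  have qk: "q k < r k" using Suc.prems by simp
  have "?t < radix r k + radix r k * q k" using t by simp
  also have "\<dots> = radix r k * Suc (q k)" by simp
  also have "\<dots> \<le> radix r k * r k" using qk by (intro mult_left_mono) auto
  finally have 1: "?t < radix r (Suc k)" by simp
  have "dig r ?t k = q k" using t p qk by (simp add: dig_def)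
  moreover have "dig r ?t i = q i" if i: "i < k" for i
  proof -
    \<comment> \<open>The added multiple of \<open>radix r k\<close> is a multiple of
      \<open>radix r (Suc i)\<close> too, so it does not disturb digit \<open>i\<close>.\<close>
    have "radix r (Suc i) dvd radix r k"
      unfolding radix_def using i by (intro prod_dvd_prod_subset) auto
    then obtain c where c: "radix r k = radix r i * r i * c" by (auto simp: dvd_def)
    have pi: "0 < radix r i" using r i by (intro radix_pos) simp
    have "?t div radix r i = t div radix r i + r i * c * q k"
      using pi c by (simp add: mult.assoc)
    then have "dig r ?t i = dig r t i" by (simp add: dig_def mult.assoc)
    then show ?thesis using t i by simp
  qed
  ultimately show ?case using 1 less_Suc_eq by metis
qed

section \<open>Dynamic programming on forests\<close>

text \<open>\<open>B x\<close> stands for the bits of \<open>x\<close> that extend to the subtree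
  below it. Its local equation is assumed only when every child has a possible bit, because that is
  all the numerical tables can guarantee. Necessity is proved from the leaves upward; for
  sufficiency the bits are fixed from the roots downward.\<close>

lemma forest_dp:
  fixes ch :: "nat \<Rightarrow> nat set" and rk :: "nat \<Rightarrow> nat" and B :: "nat \<Rightarrow> bool set"
  assumes fin: "finite V"
    and ch: "\<And>x y. x \<in> V \<Longrightarrow> y \<in> ch x \<Longrightarrow> y \<in> V \<and> rk x < rk y"
    and uniq: "\<And>x x' y. y \<in> ch x \<Longrightarrow> y \<in> ch x' \<Longrightarrow> x = x'"
    and cong: "\<And>x \<beta> f f'. x \<in> V \<Longrightarrow> (\<And>y. y \<in> ch x \<Longrightarrow> f y = f' y) \<Longrightarrow> loc x \<beta> f \<Longrightarrow> loc x \<beta> f'"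
    and B: "\<And>x \<beta>. x \<in> V \<Longrightarrow> (\<And>y. y \<in> ch x \<Longrightarrow> B y \<noteq> {}) \<Longrightarrow>
      \<beta> \<in> B x \<longleftrightarrow> (\<exists>f. (\<forall>y \<in> ch x. f y \<in> B y) \<and> loc x \<beta> f)"
  shows "(\<exists>b. \<forall>x \<in> V. loc x (b x) b) \<longleftrightarrow> (\<forall>x \<in> V. B x \<noteq> {})"
proof
  define K where "K = Suc (Max (rk ` V))"
  have K: "rk x < K" if "x \<in> V" for x using that fin by (simp add: K_def le_imp_less_Suc)
  {
    assume "\<exists>b. \<forall>x \<in> V. loc x (b x) b"
    then obtain b where b: "\<forall>x \<in> V. loc x (b x) b" by blast
    have "x \<in> V \<longrightarrow> b x \<in> B x" for x
    proof (induction "K - rk x" arbitrary: x rule: less_induct)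
      case less
      show ?case
      proof
        assume x: "x \<in> V"
        have "b y \<in> B y" if "y \<in> ch x" for y
          using less[of y] ch[OF x that] K[OF x] K[of y] by auto
        then show "b x \<in> B x" using B[OF x, of "b x"] b x by blast
      qed
    qed
    then show "\<forall>x \<in> V. B x \<noteq> {}" by blast
  }
  {
    assume ne: "\<forall>x \<in> V. B x \<noteq> {}"
    \<comment> \<open>At stage \<open>k\<close> the constraints of all vertices of rank below
      \<open>k\<close> are settled; bits further down are provisional members of
      \<open>B\<close>.\<close>
    have "\<exists>b. (\<forall>x \<in> V. b x \<in> B x) \<and> (\<forall>x \<in> V. rk x < k \<longrightarrow> loc x (b x) b)" for k
    proof (induction k)
      case 0
      have "\<forall>x \<in> V. (SOME \<beta>. \<beta> \<in> B x) \<in> B x" using ne by (simp add: some_in_eq)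
      then show ?case by (intro exI[of _ "\<lambda>x. SOME \<beta>. \<beta> \<in> B x"]) simp
    next
      case (Suc k)
      then obtain b where b: "\<forall>x \<in> V. b x \<in> B x" "\<forall>x \<in> V. rk x < k \<longrightarrow> loc x (b x) b" by blast
      have "\<exists>f. (\<forall>y \<in> ch x. f y \<in> B y) \<and> loc x (b x) f" if x: "x \<in> V" for x
        using B[OF x, of "b x"] b(1) ch[OF x] ne x by blast
      then have "\<forall>x. \<exists>f. x \<in> V \<longrightarrow> (\<forall>y \<in> ch x. f y \<in> B y) \<and> loc x (b x) f" by blast
      from choice[OF this] obtain F
        where F: "\<And>x. x \<in> V \<Longrightarrow> (\<forall>y \<in> ch x. F x y \<in> B y) \<and> loc x (b x) (F x)" by blast
      \<comment> \<open>Only children of rank-\<open>k\<close> vertices are changed. They have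
        larger rank and a unique parent, so they occur in no constraint settled before.\<close>
      define b' where "b' y = (if \<exists>x \<in> V. rk x = k \<and> y \<in> ch x
        then F (THE x. x \<in> V \<and> rk x = k \<and> y \<in> ch x) y else b y)" for y
      have b'F: "b' y = F x y" if "x \<in> V" "rk x = k" "y \<in> ch x" for x y
      proof -
        have "(THE x. x \<in> V \<and> rk x = k \<and> y \<in> ch x) = x" using that uniq by blast
        moreover have "\<exists>x \<in> V. rk x = k \<and> y \<in> ch x" using that by blast
        ultimately show ?thesis unfolding b'_def by simp
      qed
      have low: "b' x = b x" if "x \<in> V" "rk x \<le> k" for x
      proof -
        have "\<not> (\<exists>x' \<in> V. rk x' = k \<and> x \<in> ch x')" using ch[of _ x] that(2) by fastforce
        then show ?thesis unfolding b'_def by (rule if_not_P)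
      qed
      have "b' y \<in> B y" if "y \<in> V" for y
      proof (cases "\<exists>x \<in> V. rk x = k \<and> y \<in> ch x")
        case True
        then obtain x where x: "x \<in> V" "rk x = k" "y \<in> ch x" by blast
        show ?thesis using b'F[OF x] F[OF x(1)] x(3) by simp
      next
        case False
        then have "b' y = b y" unfolding b'_def by (rule if_not_P)
        then show ?thesis using b(1) that by simp
      qed
      moreover have "loc x (b' x) b'" if x: "x \<in> V" "rk x < Suc k" for x
      proof (cases "rk x = k")
        case True
        have "loc x (b x) b'"
          using cong[OF x(1), of "F x" b'] F[OF x(1)] b'F[OF x(1) True] by simp
        then show ?thesis using low x by simp
      next
        case False
        have "b' y = b y" if "y \<in> ch x" for y
        proof -
          have "\<not> (\<exists>x' \<in> V. rk x' = k \<and> y \<in> ch x')" using that uniq[OF that] False by blast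
          then show ?thesis unfolding b'_def by (rule if_not_P)
        qed
        then have "loc x (b x) b'" using cong[OF x(1), of b b'] b(2) False x by simp
        then show ?thesis using low x by simp
      qed
      ultimately show ?case by blast
    qed
    from this[of K] show "\<exists>b. \<forall>x \<in> V. loc x (b x) b" using K by blast
  }
qed

text \<open>Color by color the reachable cardinalities fill an interval, and the colors are chosen
  independently. Intervals contain values within \<open>l\<close> of each other as soon as no lower
  end exceeds an upper end by more than \<open>l\<close>. The offset \<open>p\<close> stands for
  partners that are already determined.\<close>

lemma balanced_choice:
  fixes p :: "nat \<Rightarrow> nat" and l :: nat
  assumes fin: "\<And>c. c \<in> C \<Longrightarrow> finite (Hi c)" and sub: "\<And>c. c \<in> C \<Longrightarrow> Lo c \<subseteq> Hi c"
    and C: "finite C"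
  shows "(\<exists>S. (\<forall>c \<in> C. Lo c \<subseteq> S c \<and> S c \<subseteq> Hi c) \<and>
      (\<forall>c \<in> C. \<forall>c' \<in> C. p c + card (S c) \<le> l + (p c' + card (S c')))) \<longleftrightarrow>
    (\<forall>c \<in> C. \<forall>c' \<in> C. p c + card (Lo c) \<le> l + (p c' + card (Hi c')))" (is "?L \<longleftrightarrow> ?R")
proof
  assume ?L
  then obtain S where S: "\<forall>c \<in> C. Lo c \<subseteq> S c \<and> S c \<subseteq> Hi c"
    "\<forall>c \<in> C. \<forall>c' \<in> C. p c + card (S c) \<le> l + (p c' + card (S c'))" by blast
  show ?R
  proof (intro ballI)
    fix c c' assume c: "c \<in> C" "c' \<in> C"
    have "card (Lo c) \<le> card (S c)" "card (S c') \<le> card (Hi c')"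
      using S(1) c fin by (meson card_mono finite_subset)+
    then show "p c + card (Lo c) \<le> l + (p c' + card (Hi c'))" using S(2) c
      by (meson add_le_mono le_refl order_trans)
  qed
next
  assume R: ?R
  show ?L
  proof (cases "C = {}")
    case False
    text \<open>Every count is raised to the smaller of the largest lower bound and the smallest upper
      bound.\<close>
    define a where "a = Max ((\<lambda>c. p c + card (Lo c)) ` C)"
    define h where "h = Min ((\<lambda>c. p c + card (Hi c)) ` C)"
    have a: "p c + card (Lo c) \<le> a" if "c \<in> C" for c using that C by (simp add: a_def)
    have h: "h \<le> p c + card (Hi c)" if "c \<in> C" for c using that C by (simp add: h_def)
    have "a \<in> (\<lambda>c. p c + card (Lo c)) ` C" "h \<in> (\<lambda>c. p c + card (Hi c)) ` C"
      unfolding a_def h_def using C False by (intro Max_in Min_in; simp)+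
    then have ah: "a \<le> l + h" using R by auto
    have "\<exists>S. Lo c \<subseteq> S \<and> S \<subseteq> Hi c \<and> p c + card S = max (p c + card (Lo c)) (min a h)" if c: "c \<in> C" for c
    proof -
      have lh: "card (Lo c) \<le> card (Hi c)" by (rule card_mono[OF fin[OF c] sub[OF c]])
      \<comment> \<open>If \<open>min a h < p c\<close>, the subtraction is cut off at 0 and the
        maximum with \<open>card (Lo c)\<close> still gives the right size.\<close>
      have "\<exists>S. Lo c \<subseteq> S \<and> S \<subseteq> Hi c \<and> card S = max (card (Lo c)) (min a h - p c)"
        using h[OF c] lh by (intro exists_subset_between[OF _ _ sub[OF c] fin[OF c]]) auto
      then obtain S where S: "Lo c \<subseteq> S" "S \<subseteq> Hi c" "card S = max (card (Lo c)) (min a h - p c)" by blast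
      have "p c + card S = max (p c + card (Lo c)) (min a h)" unfolding S(3) max_def by auto
      then show ?thesis using S by blast
    qed
    then obtain S where S: "\<And>c. c \<in> C \<Longrightarrow> Lo c \<subseteq> S c \<and> S c \<subseteq> Hi c \<and>
      p c + card (S c) = max (p c + card (Lo c)) (min a h)" by metis
    have "p c + card (S c) \<le> l + (p c' + card (S c'))" if "c \<in> C" "c' \<in> C" for c c'
    proof -
      have "p c + card (S c) \<le> a" "min a h \<le> p c' + card (S c')" using S that a by auto
      then show ?thesis using ah by linarith
    qed
    then show ?thesis using S by blast
  qed auto
qed

section \<open>Matchings for a fixed choice of non-tree edges\<close>

definition kids :: "(nat \<Rightarrow> nat) \<Rightarrow> nat \<Rightarrow> nat \<Rightarrow> nat set" where
  "kids pa n x = {y. y < n \<and> pa y = Suc x}"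

text \<open>The parent of \<open>x\<close> is \<open>pa x - 1\<close>, and \<open>pa x = 0\<close> marks a root. The left vertices
  \<open>u\<close> with \<open>q u\<close> are already matched, namely to \<open>tg u\<close>.\<close>

locale rooted_guess =
  fixes nu n nc :: nat and col th pa rk tg :: "nat \<Rightarrow> nat" and q :: "nat \<Rightarrow> bool"
  assumes nu_le: "nu \<le> n"
    and parent: "\<And>x. x < n \<Longrightarrow> pa x \<noteq> 0 \<Longrightarrow>
      pa x - 1 < n \<and> rk (pa x - 1) < rk x \<and> (x < nu \<longleftrightarrow> \<not> pa x - 1 < nu)"
begin

abbreviation ch :: "nat \<Rightarrow> nat set" where
  "ch \<equiv> kids pa n"

definition cnt :: "(nat \<Rightarrow> nat) \<Rightarrow> nat \<Rightarrow> nat \<Rightarrow> nat" where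
  "cnt \<sigma> v c = card {u. u < nu \<and> \<sigma> u = v \<and> col u = c}"

definition pre :: "nat \<Rightarrow> nat \<Rightarrow> nat" where
  "pre v c = card {u. u < nu \<and> q u \<and> tg u = v \<and> col u = c}"

definition own :: "nat \<Rightarrow> nat \<Rightarrow> nat" where
  "own v c = (if pa v \<noteq> 0 \<and> col (pa v - 1) = c then 1 else 0)"

definition follows :: "(nat \<Rightarrow> nat) \<Rightarrow> bool" where
  "follows \<sigma> \<longleftrightarrow> (\<forall>u<nu. if q u then \<sigma> u = tg u
     else nu \<le> \<sigma> u \<and> \<sigma> u < n \<and> (pa u = Suc (\<sigma> u) \<or> pa (\<sigma> u) = Suc u))"

definition fair :: "(nat \<Rightarrow> nat) \<Rightarrow> bool" where
  "fair \<sigma> \<longleftrightarrow> (\<forall>v. nu \<le> v \<longrightarrow> v < n \<longrightarrow> (\<forall>c<nc. \<forall>c'<nc. cnt \<sigma> v c \<le> th v + cnt \<sigma> v c'))"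

definition total :: "nat \<Rightarrow> bool \<Rightarrow> (nat \<Rightarrow> bool) \<Rightarrow> nat \<Rightarrow> nat" where
  "total v \<beta> f c = pre v c + (if \<beta> then own v c else 0) + card {u \<in> ch v. col u = c \<and> f u}"

text \<open>The bit of a vertex tells whether the edge to its parent is in the matching.\<close>

definition loc :: "nat \<Rightarrow> bool \<Rightarrow> (nat \<Rightarrow> bool) \<Rightarrow> bool" where
  "loc x \<beta> f \<longleftrightarrow> (\<beta> \<longrightarrow> pa x \<noteq> 0) \<and>
     (if x < nu then if q x then \<not> \<beta> \<and> (\<forall>y \<in> ch x. \<not> f y)
        else if \<beta> then \<forall>y \<in> ch x. \<not> f y else \<exists>!y. y \<in> ch x \<and> f y
      else \<forall>c<nc. \<forall>c'<nc. total x \<beta> f c \<le> th x + total x \<beta> f c')"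

definition bit :: "(nat \<Rightarrow> nat) \<Rightarrow> nat \<Rightarrow> bool" where
  "bit \<sigma> x \<longleftrightarrow> pa x \<noteq> 0 \<and> (if x < nu then \<not> q x \<and> \<sigma> x = pa x - 1
     else \<not> q (pa x - 1) \<and> \<sigma> (pa x - 1) = x)"

lemma childD: "y \<in> ch x \<Longrightarrow> y < n \<and> pa y = Suc x \<and> x < n \<and> rk x < rk y \<and> (y < nu \<longleftrightarrow> \<not> x < nu)"
  using parent[of y] by (auto simp: kids_def)

lemma parent_child: "x < n \<Longrightarrow> pa x \<noteq> 0 \<Longrightarrow> x \<in> ch (pa x - 1)"
  by (simp add: kids_def)

lemma parent_not_child: "x < n \<Longrightarrow> pa x \<noteq> 0 \<Longrightarrow> pa x - 1 \<notin> ch x"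
  using parent[of x] childD[of "pa x - 1" x] by auto

text \<open>A right vertex gets its partners from three disjoint sources: guessed non-tree edges,
  the edge to its parent, and edges to its children. Ranks keep the parent apart from the
  children.\<close>

lemma cnt_total:
  assumes "follows \<sigma>" "nu \<le> v" "v < n" and b: "\<And>x. x < n \<Longrightarrow> b x \<longleftrightarrow> bit \<sigma> x"
  shows "cnt \<sigma> v c = total v (b v) b c"
proof -
  let ?A = "{u. u < nu \<and> q u \<and> tg u = v \<and> col u = c}"
  let ?B = "if b v \<and> pa v \<noteq> 0 \<and> col (pa v - 1) = c then {pa v - 1} else {}"
  let ?C = "{u \<in> ch v. col u = c \<and> b u}"
  have bv: "b v \<longleftrightarrow> pa v \<noteq> 0 \<and> \<not> q (pa v - 1) \<and> \<sigma> (pa v - 1) = v"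
    using b[OF assms(3)] assms(2) by (simp add: bit_def)
  have C: "?C = {u. u < nu \<and> \<not> q u \<and> pa u = Suc v \<and> \<sigma> u = v \<and> col u = c}"
  proof (intro set_eqI)
    fix u
    show "u \<in> ?C \<longleftrightarrow> u \<in> {u. u < nu \<and> \<not> q u \<and> pa u = Suc v \<and> \<sigma> u = v \<and> col u = c}"
    proof (cases "u < nu \<and> pa u = Suc v")
      case True
      then have u: "u < n" using nu_le by simp
      then have "b u \<longleftrightarrow> \<not> q u \<and> \<sigma> u = v" using True b[OF u] by (simp add: bit_def)
      then show ?thesis using True u by (simp add: kids_def conj_ac)
    next
      case False
      then show ?thesis using childD[of u v] assms(2) by auto
    qed
  qed
  have B: "?B = {u. u < nu \<and> \<not> q u \<and> pa v = Suc u \<and> \<sigma> u = v \<and> col u = c}"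
  proof (intro set_eqI)
    fix u
    show "u \<in> ?B \<longleftrightarrow> u \<in> {u. u < nu \<and> \<not> q u \<and> pa v = Suc u \<and> \<sigma> u = v \<and> col u = c}"
    proof (cases "pa v = Suc u")
      case True
      then have "u < nu" using parent[OF assms(3)] assms(2) by simp
      then show ?thesis using bv True by simp
    next
      case False
      then have "u \<notin> ?B" by (cases "pa v") simp_all
      then show ?thesis using False by simp
    qed
  qed
  have "{u. u < nu \<and> \<sigma> u = v \<and> col u = c} = ?A \<union> ?B \<union> ?C"
  proof (intro set_eqI)
    fix u
    show "u \<in> {u. u < nu \<and> \<sigma> u = v \<and> col u = c} \<longleftrightarrow> u \<in> ?A \<union> ?B \<union> ?C"
    proof (cases "u < nu")
      case True
      then have "if q u then \<sigma> u = tg u else pa u = Suc (\<sigma> u) \<or> pa (\<sigma> u) = Suc u"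
        using assms(1) unfolding follows_def by metis
      then show ?thesis unfolding B C using True by (cases "q u") auto
    next
      case False
      then show ?thesis unfolding B C by simp
    qed
  qed
  moreover have "?A \<inter> ?B = {}" "(?A \<union> ?B) \<inter> ?C = {}"
    unfolding B C using parent[OF assms(3)] parent assms(2) nu_le
    by (force, fastforce)
  moreover have "finite ?A" "finite ?B" "finite ?C" by (auto simp: kids_def)
  ultimately have "cnt \<sigma> v c = card ?A + card ?B + card ?C"
    unfolding cnt_def by (simp only: card_Un_disjoint finite_UnI)
  moreover have "card ?B = (if b v then own v c else 0)" by (simp add: own_def)
  ultimately show ?thesis by (simp add: total_def pre_def)
qed

text \<open>Every tree edge is recorded once, at its lower end, so a bit vector is a set of tree
  edges. At an unguessed left vertex \<open>loc\<close> demands exactly one chosen edge, up or down,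
  and its other end is the value of \<open>\<sigma>\<close>.\<close>

lemma matching_iff_bits: "(\<exists>\<sigma>. follows \<sigma> \<and> fair \<sigma>) \<longleftrightarrow> (\<exists>b. \<forall>x \<in> {..<n}. loc x (b x) b)"
proof
  assume "\<exists>\<sigma>. follows \<sigma> \<and> fair \<sigma>"
  then obtain \<sigma> where \<sigma>: "follows \<sigma>" "fair \<sigma>" by blast
  have "loc x (bit \<sigma> x) (bit \<sigma>)" if x: "x < n" for x
  proof (cases "x < nu")
    case True
    have kid: "bit \<sigma> y \<longleftrightarrow> \<not> q x \<and> \<sigma> x = y" if "y \<in> ch x" for y
      using childD[OF that] True by (auto simp: bit_def)
    show ?thesis
    proof (cases "q x")
      case True
      then have "\<not> bit \<sigma> x" using \<open>x < nu\<close> by (simp add: bit_def)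
      then show ?thesis using True \<open>x < nu\<close> kid by (simp add: loc_def)
    next
      case False
      have nb: "nu \<le> \<sigma> x \<and> \<sigma> x < n \<and> (pa x = Suc (\<sigma> x) \<or> pa (\<sigma> x) = Suc x)"
        using \<sigma>(1) True False unfolding follows_def by simp
      show ?thesis
      proof (cases "bit \<sigma> x")
        case b: True
        then have px: "pa x \<noteq> 0" "\<sigma> x = pa x - 1" using True by (auto simp: bit_def)
        have "\<forall>y \<in> ch x. \<not> bit \<sigma> y" using kid parent_not_child[OF x px(1)] px(2) by auto
        then show ?thesis using True False b px by (simp add: loc_def)
      next
        case nbx: False
        then have "pa x \<noteq> Suc (\<sigma> x)" using True False by (auto simp: bit_def)
        then have "\<sigma> x \<in> ch x" using nb by (simp add: kids_def)
        then have "\<exists>!y. y \<in> ch x \<and> bit \<sigma> y" using kid False by blast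
        then show ?thesis using True False nbx by (simp add: loc_def)
      qed
    qed
  next
    case False
    then have "cnt \<sigma> x c = total x (bit \<sigma> x) (bit \<sigma>) c" for c
      using cnt_total[OF \<sigma>(1), of x "bit \<sigma>"] x by simp
    moreover have "\<forall>c<nc. \<forall>c'<nc. cnt \<sigma> x c \<le> th x + cnt \<sigma> x c'"
      using \<sigma>(2) x False unfolding fair_def by simp
    moreover have "bit \<sigma> x \<longrightarrow> pa x \<noteq> 0" by (simp add: bit_def)
    ultimately show ?thesis using False by (simp add: loc_def)
  qed
  then show "\<exists>b. \<forall>x \<in> {..<n}. loc x (b x) b" by blast
next
  assume "\<exists>b. \<forall>x \<in> {..<n}. loc x (b x) b"
  then obtain b where b: "\<And>x. x < n \<Longrightarrow> loc x (b x) b" by blast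
  \<comment> \<open>The last branch is well defined because \<open>loc\<close> grants an unguessed
    left vertex with false bit exactly one chosen child.\<close>
  define \<sigma> where "\<sigma> u = (if q u then tg u else if b u then pa u - 1 else THE y. y \<in> ch u \<and> b y)" for u
  have up: "pa u \<noteq> 0 \<and> \<sigma> u = pa u - 1 \<and> (\<forall>y \<in> ch u. \<not> b y)" if "u < nu" "\<not> q u" "b u" for u
    using b[of u] that nu_le by (auto simp: loc_def \<sigma>_def)
  have down: "\<sigma> u \<in> ch u \<and> b (\<sigma> u) \<and> (\<forall>y \<in> ch u. b y \<longrightarrow> y = \<sigma> u)" if "u < nu" "\<not> q u" "\<not> b u" for u
  proof -
    have "\<exists>!y. y \<in> ch u \<and> b y" using b[of u] that nu_le by (auto simp: loc_def)
    moreover from theI'[OF this] have "\<sigma> u \<in> ch u \<and> b (\<sigma> u)" using that by (simp add: \<sigma>_def)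
    ultimately show ?thesis by blast
  qed
  have fixed: "\<not> b u \<and> (\<forall>y \<in> ch u. \<not> b y)" if "u < nu" "q u" for u
    using b[of u] that nu_le by (auto simp: loc_def)
  have fol: "follows \<sigma>" unfolding follows_def
  proof (intro allI impI)
    fix u assume u: "u < nu"
    then have un: "u < n" using nu_le by simp
    show "if q u then \<sigma> u = tg u
     else nu \<le> \<sigma> u \<and> \<sigma> u < n \<and> (pa u = Suc (\<sigma> u) \<or> pa (\<sigma> u) = Suc u)"
    proof (cases "q u")
      case True
      then show ?thesis by (simp add: \<sigma>_def)
    next
      case nq: False
      show ?thesis
      proof (cases "b u")
        case True
        then show ?thesis using up[OF u nq] parent[OF un] nq u by auto
      next
        case False
        then show ?thesis using childD[of "\<sigma> u" u] down[OF u nq] nq u by auto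
      qed
    qed
  qed
  \<comment> \<open>\<open>cnt_total\<close> speaks of the bits read off from
    \<open>\<sigma>\<close>; fairness of \<open>b\<close> transfers to \<open>\<sigma>\<close> only
    once these are the given ones.\<close>
  have bit: "b x \<longleftrightarrow> bit \<sigma> x" if x: "x < n" for x
  proof (cases "x < nu")
    case True
    show ?thesis
    proof (cases "b x")
      case b: True
      then have "\<not> q x" using fixed True by blast
      then show ?thesis using up[OF True] b True by (simp add: bit_def)
    next
      case nb: False
      have "\<not> bit \<sigma> x"
      proof
        assume a: "bit \<sigma> x"
        then have "pa x \<noteq> 0" "\<not> q x" "\<sigma> x = pa x - 1" using True by (auto simp: bit_def)
        then show False using down[OF True _ nb] parent_not_child[OF x] by auto
      qed
      then show ?thesis using nb by simp
    qed
  next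
    case False
    show ?thesis
    proof (cases "pa x = 0")
      case True
      then show ?thesis using b[OF x] by (auto simp: loc_def bit_def)
    next
      case px: False
      let ?u = "pa x - 1"
      have u: "?u < nu" "x \<in> ch ?u" using parent[OF x px] False parent_child[OF x px] by auto
      show ?thesis
      proof (cases "q ?u")
        case True
        then show ?thesis using fixed[OF u(1)] u(2) False by (auto simp: bit_def)
      next
        case nq: False
        show ?thesis
        proof (cases "b ?u")
          case True
          have "?u < n" "pa ?u \<noteq> 0" using up[OF u(1) nq True] u nu_le by auto
          then have "\<sigma> ?u \<noteq> x" using up[OF u(1) nq True] parent_not_child[of ?u] u(2) by auto
          then show ?thesis using up[OF u(1) nq True] u(2) False nq px by (simp add: bit_def)
        next
          case nb: False
          show ?thesis using down[OF u(1) nq nb] u(2) False nq px by (auto simp: bit_def)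
        qed
      qed
    qed
  qed
  have "fair \<sigma>" unfolding fair_def
  proof (intro allI impI)
    fix v c c' assume v: "nu \<le> v" "v < n" "c < nc" "c' < nc"
    have "cnt \<sigma> v c = total v (b v) b c" for c using cnt_total[OF fol v(1,2) bit] by simp
    then show "cnt \<sigma> v c \<le> th v + cnt \<sigma> v c'" using b[OF v(2)] v by (simp add: loc_def)
  qed
  then show "\<exists>\<sigma>. follows \<sigma> \<and> fair \<sigma>" using fol by blast
qed

section \<open>The table of possible bits\<close>

definition low :: "(nat \<Rightarrow> bool) \<Rightarrow> (nat \<Rightarrow> bool) \<Rightarrow> nat \<Rightarrow> nat \<Rightarrow> nat" where
  "low G0 G1 v c = pre v c + card {u \<in> ch v. col u = c \<and> G1 u \<and> \<not> G0 u}"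

definition high :: "(nat \<Rightarrow> bool) \<Rightarrow> nat \<Rightarrow> nat \<Rightarrow> nat" where
  "high G1 v c = pre v c + card {u \<in> ch v. col u = c \<and> G1 u}"

text \<open>\<open>G0 x\<close> and \<open>G1 x\<close> tell whether the bit of \<open>x\<close> can be false or true as far as the subtree of
  \<open>x\<close> is concerned. The values are only meaningful if every child has a possible bit.\<close>

definition table :: "(nat \<Rightarrow> bool) \<Rightarrow> (nat \<Rightarrow> bool) \<Rightarrow> nat \<Rightarrow> bool" where
  "table G0 G1 x \<longleftrightarrow> (if x < nu
     then let nb = card {y \<in> ch x. \<not> G0 y}; na = card {y \<in> ch x. G1 y} in
       (G1 x \<longleftrightarrow> pa x \<noteq> 0 \<and> \<not> q x \<and> nb = 0) \<and>
       (G0 x \<longleftrightarrow> (if q x then nb = 0 else nb = 0 \<and> na \<noteq> 0 \<or> nb = 1))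
     else (G0 x \<longleftrightarrow> (\<forall>c<nc. \<forall>c'<nc. low G0 G1 x c \<le> th x + high G1 x c')) \<and>
       (G1 x \<longleftrightarrow> pa x \<noteq> 0 \<and>
         (\<forall>c<nc. \<forall>c'<nc. low G0 G1 x c + own x c \<le> th x + (high G1 x c' + own x c'))))"

text \<open>At a left vertex, a child with \<open>\<not> G0\<close> forces its edge. Exactly one
  child edge can be chosen if there is a single forced child, or none and some child that allows its
  edge. At a right vertex, the possible sets of chosen children of one color are those between the
  forced and the allowed ones, which is the situation of \<open>balanced_choice\<close>.\<close>

lemma table_loc:
  assumes t: "table G0 G1 x" and ne: "\<And>y. y \<in> ch x \<Longrightarrow> G0 y \<or> G1 y"
  shows "(if \<beta> then G1 x else G0 x) \<longleftrightarrow>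
    (\<exists>f. (\<forall>y \<in> ch x. if f y then G1 y else G0 y) \<and> loc x \<beta> f)" (is "?L \<longleftrightarrow> ?R")
proof (cases "x < nu")
  case True
  have fin: "finite (ch x)" by (simp add: kids_def)
  define N where "N = {y \<in> ch x. \<not> G0 y}"
  define A where "A = {y \<in> ch x. G1 y}"
  have finN: "finite N" "finite A" using fin by (auto simp: N_def A_def)
  have G1: "G1 x \<longleftrightarrow> pa x \<noteq> 0 \<and> \<not> q x \<and> N = {}"
    and G0: "G0 x \<longleftrightarrow> (if q x then N = {} else N = {} \<and> A \<noteq> {} \<or> card N = 1)"
    using t True finN unfolding table_def Let_def N_def[symmetric] A_def[symmetric] by auto
  \<comment> \<open>A forced child has some possible bit, hence \<open>G1\<close>; so a single
    forced child can serve as the chosen one.\<close>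
  have NA: "N \<subseteq> A" using ne by (auto simp: N_def A_def)
  have zero: "(\<exists>f. (\<forall>y \<in> ch x. if f y then G1 y else G0 y) \<and> (\<forall>y \<in> ch x. \<not> f y)) \<longleftrightarrow> N = {}"
    (is "?Z \<longleftrightarrow> _")
  proof
    assume "N = {}"
    then show ?Z by (intro exI[of _ "\<lambda>_. False"]) (auto simp: N_def)
  qed (auto simp: N_def)
  have one: "(\<exists>f. (\<forall>y \<in> ch x. if f y then G1 y else G0 y) \<and> (\<exists>!y. y \<in> ch x \<and> f y)) \<longleftrightarrow>
      N = {} \<and> A \<noteq> {} \<or> card N = 1" (is "?O \<longleftrightarrow> ?C")
  proof
    assume ?O
    then obtain f y where f: "\<forall>y \<in> ch x. if f y then G1 y else G0 y" "y \<in> ch x" "f y"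
      and u: "\<And>z. z \<in> ch x \<Longrightarrow> f z \<Longrightarrow> z = y" by blast
    have "y \<in> A" using f by (auto simp: A_def)
    moreover have "f z" if "z \<in> N" for z using f(1) that unfolding N_def by (cases "f z") auto
    then have "N \<subseteq> {y}" using u by (auto simp: N_def)
    then have "N = {} \<or> N = {y}" by blast
    ultimately show ?C by auto
  next
    assume ?C
    then have "\<exists>y \<in> A. N \<subseteq> {y}"
    proof
      assume "card N = 1"
      then obtain y where "N = {y}" by (auto simp: card_1_singleton_iff)
      then show ?thesis using NA by blast
    qed blast
    then obtain y where y: "y \<in> A" "N \<subseteq> {y}" by blast
    have "\<forall>z \<in> ch x. if z = y then G1 z else G0 z" using y by (auto simp: N_def A_def)
    moreover have "\<exists>!z. z \<in> ch x \<and> z = y" using y by (auto simp: A_def)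
    ultimately show ?O by (intro exI[of _ "\<lambda>z. z = y"]) blast
  qed
  show ?thesis
  proof (cases \<beta>)
    case b: True
    have "?R \<longleftrightarrow> pa x \<noteq> 0 \<and> \<not> q x \<and> N = {}" unfolding zero[symmetric] loc_def using True b by auto
    then show ?thesis using G1 b by simp
  next
    case b: False
    show ?thesis
    proof (cases "q x")
      case q: True
      have "?R \<longleftrightarrow> N = {}" unfolding zero[symmetric] loc_def using True b q by simp
      then show ?thesis using G0 b q by simp
    next
      case q: False
      have "?R \<longleftrightarrow> N = {} \<and> A \<noteq> {} \<or> card N = 1" unfolding one[symmetric] loc_def using True b q by simp
      then show ?thesis using G0 b q by simp
    qed
  qed
next
  case False
  let ?p = "\<lambda>c. pre x c + (if \<beta> then own x c else 0)"
  let ?Lo = "\<lambda>c. {u \<in> ch x. col u = c \<and> G1 u \<and> \<not> G0 u}" and ?Hi = "\<lambda>c. {u \<in> ch x. col u = c \<and> G1 u}"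
  have bal: "(\<exists>S. (\<forall>c \<in> {..<nc}. ?Lo c \<subseteq> S c \<and> S c \<subseteq> ?Hi c) \<and>
      (\<forall>c \<in> {..<nc}. \<forall>c' \<in> {..<nc}. ?p c + card (S c) \<le> th x + (?p c' + card (S c')))) \<longleftrightarrow>
    (\<forall>c \<in> {..<nc}. \<forall>c' \<in> {..<nc}. ?p c + card (?Lo c) \<le> th x + (?p c' + card (?Hi c')))"
    (is "?S \<longleftrightarrow> ?B")
    by (rule balanced_choice) (auto simp: kids_def)
  have L: "?L \<longleftrightarrow> (\<beta> \<longrightarrow> pa x \<noteq> 0) \<and> ?B"
    using t False by (cases \<beta>) (simp_all add: table_def low_def high_def Ball_def algebra_simps)
  have R: "?R \<longleftrightarrow> (\<beta> \<longrightarrow> pa x \<noteq> 0) \<and> ?S"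
  proof
    assume ?R
    then obtain f where f: "\<forall>y \<in> ch x. if f y then G1 y else G0 y" "loc x \<beta> f" by blast
    have f': "(f y \<longrightarrow> G1 y) \<and> (\<not> f y \<longrightarrow> G0 y)" if "y \<in> ch x" for y
      using f(1) that by (cases "f y") auto
    have "?Lo c \<subseteq> {u \<in> ch x. col u = c \<and> f u} \<and> {u \<in> ch x. col u = c \<and> f u} \<subseteq> ?Hi c" for c
      using f' by auto
    moreover have "\<forall>c \<in> {..<nc}. \<forall>c' \<in> {..<nc}. ?p c + card {u \<in> ch x. col u = c \<and> f u} \<le>
        th x + (?p c' + card {u \<in> ch x. col u = c' \<and> f u})"
      using f(2) False unfolding loc_def total_def by simp
    ultimately have ?S by (intro exI[of _ "\<lambda>c. {u \<in> ch x. col u = c \<and> f u}"]) blast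
    then show "(\<beta> \<longrightarrow> pa x \<noteq> 0) \<and> ?S" using f(2) by (simp add: loc_def)
  next
    assume a: "(\<beta> \<longrightarrow> pa x \<noteq> 0) \<and> ?S"
    then obtain S where S: "\<forall>c \<in> {..<nc}. ?Lo c \<subseteq> S c \<and> S c \<subseteq> ?Hi c"
      "\<forall>c \<in> {..<nc}. \<forall>c' \<in> {..<nc}. ?p c + card (S c) \<le> th x + (?p c' + card (S c'))" by blast
    \<comment> \<open>A color outside the range is counted nowhere, so any possible bit will do
      there; \<open>\<not> G0 u\<close> is one.\<close>
    define f where "f u = (if col u < nc then u \<in> S (col u) else \<not> G0 u)" for u
    have eq: "{u \<in> ch x. col u = c \<and> f u} = S c" if "c < nc" for c
      using S(1) that by (auto simp: f_def)
    have "if f y then G1 y else G0 y" if y: "y \<in> ch x" for y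
    proof (cases "col y < nc")
      case True
      then have "?Lo (col y) \<subseteq> S (col y)" "S (col y) \<subseteq> ?Hi (col y)" using S(1) by auto
      then show ?thesis using y ne[OF y] True by (auto simp: f_def)
    next
      case False
      then show ?thesis using ne[OF y] by (auto simp: f_def)
    qed
    moreover have "loc x \<beta> f" unfolding loc_def total_def using a False eq S(2) by simp
    ultimately show ?R by blast
  qed
  show ?thesis unfolding L R bal by simp
qed

theorem matching_iff_table:
  assumes "\<And>x. x < n \<Longrightarrow> table G0 G1 x"
  shows "(\<exists>\<sigma>. follows \<sigma> \<and> fair \<sigma>) \<longleftrightarrow> (\<forall>x<n. G0 x \<or> G1 x)"
proof -
  define B where "B x = {\<beta>. if \<beta> then G1 x else G0 x}" for x
  have B: "B x \<noteq> {} \<longleftrightarrow> G0 x \<or> G1 x" for x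
  proof
    assume "G0 x \<or> G1 x"
    then have "False \<in> B x \<or> True \<in> B x" by (simp add: B_def)
    then show "B x \<noteq> {}" by blast
  qed (auto simp: B_def split: if_splits)
  have "(\<exists>b. \<forall>x \<in> {..<n}. loc x (b x) b) \<longleftrightarrow> (\<forall>x \<in> {..<n}. B x \<noteq> {})"
  proof (rule forest_dp[where ch=ch and rk=rk and loc=loc and B=B])
    fix x y assume "x \<in> {..<n}" "y \<in> ch x"
    then show "y \<in> {..<n} \<and> rk x < rk y" using childD by simp
  next
    fix x x' y assume "y \<in> ch x" "y \<in> ch x'"
    then show "x = x'" by (simp add: kids_def)
  next
    fix x \<beta> and f f' :: "nat \<Rightarrow> bool" assume eq: "\<And>y. y \<in> ch x \<Longrightarrow> f y = f' y" and l: "loc x \<beta> f"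
    have "{u \<in> ch x. col u = c \<and> f u} = {u \<in> ch x. col u = c \<and> f' u}" for c using eq by auto
    then have "total x \<beta> f = total x \<beta> f'" by (intro ext) (simp add: total_def)
    moreover have "(\<lambda>y. y \<in> ch x \<and> f y) = (\<lambda>y. y \<in> ch x \<and> f' y)" using eq by auto
    moreover have "(\<forall>y \<in> ch x. \<not> f y) = (\<forall>y \<in> ch x. \<not> f' y)" using eq by auto
    ultimately show "loc x \<beta> f'" using l unfolding loc_def by (simp only:)
  next
    fix x \<beta> assume x: "x \<in> {..<n}" and ne: "\<And>y. y \<in> ch x \<Longrightarrow> B y \<noteq> {}"
    have mem: "\<beta>' \<in> B y \<longleftrightarrow> (if \<beta>' then G1 y else G0 y)" for \<beta>' y
      by (simp only: B_def mem_Collect_eq)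
    have "G0 y \<or> G1 y" if "y \<in> ch x" for y using ne[OF that] B by blast
    from table_loc[OF assms this] x
    show "\<beta> \<in> B x \<longleftrightarrow> (\<exists>f. (\<forall>y \<in> ch x. f y \<in> B y) \<and> loc x \<beta> f)"
      unfolding mem by simp
  qed simp
  then show ?thesis unfolding matching_iff_bits by (simp add: B Ball_def)
qed

end

section \<open>Breadth-first search\<close>

lemma inj_on_extend:
  fixes k :: nat
  assumes "inj_on f {..<k}" "y \<notin> f ` {..<k}"
  shows "inj_on (f(k := y)) {..<Suc k}"
proof -
  have "(f(k := y)) ` {..<k} = f ` {..<k}" by (intro image_cong) auto
  moreover have "inj_on (f(k := y)) {..<k}" using assms(1) by (simp add: inj_on_def)
  ultimately show ?thesis using assms(2) by (simp add: lessThan_Suc)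
qed

text \<open>A potential whose units pay for single steps of the search: inspecting an arc, taking a
  vertex from the queue (the \<open>+ 1\<close>), or trying a root.\<close>

definition search_work :: "nat \<Rightarrow> (nat \<Rightarrow> nat list) \<Rightarrow> nat \<Rightarrow> nat \<Rightarrow> nat \<Rightarrow> (nat \<Rightarrow> nat) \<Rightarrow> nat" where
  "search_work n A h rt ce Q =
     ce + (\<Sum>y \<in> {..<n} - Q ` {..<h}. length (A y) + 1) + (n - rt)"

lemma search_work_upd [simp]:
  "h \<le> k \<Longrightarrow> search_work n A h rt ce (Q(k := y)) = search_work n A h rt ce Q"
proof -
  assume "h \<le> k"
  then have "(Q(k := y)) ` {..<h} = Q ` {..<h}" by (intro image_cong) auto
  then show ?thesis by (simp only: search_work_def)
qed

text \<open>Search queue \<open>Q\<close> with head \<open>h\<close> and tail \<open>tl\<close>; \<open>V y\<close> is the number of the component in which \<open>y\<close>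
  was reached (\<open>0\<close> if not yet), \<open>P y\<close> is one more than its parent (\<open>0\<close> for roots); the first \<open>ce\<close>
  neighbours of \<open>cur\<close> still have to be inspected, and the vertices below \<open>rt\<close> have been tried as roots.\<close>

locale search =
  fixes n :: nat and A :: "nat \<Rightarrow> nat list" and h tl rt cur ce K :: nat and V P Q :: "nat \<Rightarrow> nat"
  assumes adj_less: "\<And>x y. x < n \<Longrightarrow> y \<in> set (A x) \<Longrightarrow> y < n"
    and adj_sym: "\<And>x y. x < n \<Longrightarrow> y \<in> set (A x) \<Longrightarrow> x \<in> set (A y)"
    and head: "h \<le> tl" and root_le: "rt \<le> n" and count_le: "K \<le> tl"
    and queue_inj: "inj_on Q {..<tl}" and queue_less: "\<And>p. p < tl \<Longrightarrow> Q p < n"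
    and reached: "\<And>y. y < n \<Longrightarrow> V y \<noteq> 0 \<longleftrightarrow> y \<in> Q ` {..<tl}"
    and comp_le: "\<And>y. y < n \<Longrightarrow> V y \<le> K"
    and unreached: "\<And>y. y < n \<Longrightarrow> V y = 0 \<Longrightarrow> P y = 0"
    and parents: "\<And>p. p < tl \<Longrightarrow> P (Q p) \<noteq> 0 \<Longrightarrow>
      \<exists>q<p. P (Q p) = Suc (Q q) \<and> Q p \<in> set (A (Q q))"
    and roots: "inj_on V {y. y < n \<and> V y \<noteq> 0 \<and> P y = 0}"
    and pending: "\<And>p. p < tl \<Longrightarrow> h \<le> p \<Longrightarrow> V (Q p) = K"
    and current: "0 < ce \<Longrightarrow> cur \<in> Q ` {..<h} \<and> V cur = K \<and> ce \<le> length (A cur)"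
    and closed: "\<And>p y. p < h \<Longrightarrow> y \<in> set (A (Q p)) \<Longrightarrow>
      V y = V (Q p) \<or> (Q p = cur \<and> y \<in> set (take ce (A cur)))"
    and tried: "\<And>y. y < rt \<Longrightarrow> V y \<noteq> 0"
begin

lemma tail_le: "tl \<le> n"
  using card_inj_on_le[OF queue_inj, of "{..<n}"] queue_less by auto

lemma tail_less:
  assumes "y < n" "V y = 0"
  shows "tl < n"
proof -
  have "y \<notin> Q ` {..<tl}" using reached assms by blast
  then have "Q ` {..<tl} \<subseteq> {..<n} - {y}" using queue_less by auto
  from card_inj_on_le[OF queue_inj this] show ?thesis using assms by simp
qed

lemma queue_reached: "p < tl \<Longrightarrow> V (Q p) \<noteq> 0"
  using reached[OF queue_less, of p] by blast

lemma current_arc: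
  assumes "0 < ce"
  shows "cur < n" "A cur ! (ce - 1) \<in> set (A cur)" "A cur ! (ce - 1) < n"
    "set (take ce (A cur)) = insert (A cur ! (ce - 1)) (set (take (ce - 1) (A cur)))"
proof -
  obtain p where p: "p < h" "cur = Q p" using current[OF assms] by blast
  then show 1: "cur < n" using queue_less[of p] head by simp
  have le: "ce \<le> length (A cur)" using current[OF assms] by simp
  then show 2: "A cur ! (ce - 1) \<in> set (A cur)" using assms by (intro nth_mem) simp
  then show "A cur ! (ce - 1) < n" using adj_less[OF 1] by simp
  have "take (Suc (ce - 1)) (A cur) = take (ce - 1) (A cur) @ [A cur ! (ce - 1)]"
    using le assms by (intro take_Suc_conv_app_nth) simp
  then show "set (take ce (A cur)) = insert (A cur ! (ce - 1)) (set (take (ce - 1) (A cur)))"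
    using assms by simp
qed

text \<open>The seen vertex must be known to carry the current component number. If it has already
  left the queue, symmetry makes \<open>cur\<close> one of its neighbours, and \<open>closed\<close>
  yields the equality.\<close>

lemma step_seen:
  assumes ce: "0 < ce" and y: "V (A cur ! (ce - 1)) \<noteq> 0"
  shows "search n A h tl rt cur (ce - 1) K V P Q"
proof -
  let ?y = "A cur ! (ce - 1)"
  note arc = current_arc[OF ce]
  have "?y \<in> Q ` {..<tl}" using reached[OF arc(3)] y by blast
  then obtain p where p: "p < tl" "?y = Q p" by blast
  have Vy: "V ?y = K"
  proof (cases "h \<le> p")
    case True
    then show ?thesis using pending[of p] p by simp
  next
    case False
    have "cur \<in> set (A (Q p))" using adj_sym[OF arc(1,2)] p by simp
    with closed[of p cur] False have "V cur = V (Q p) \<or> Q p = cur" by auto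
    then show ?thesis using current[OF ce] p by auto
  qed
  show ?thesis
  \<comment> \<open>The case numbers follow the order of the assumptions of \<open>search\<close>;
    the other assumptions carry over as they are.\<close>
  proof (unfold_locales, goal_cases)
    case 14
    then show ?case using current[OF ce] by auto
  next
    case (15 p y)
    from closed[OF 15] show ?case
    proof
      assume "Q p = cur \<and> y \<in> set (take ce (A cur))"
      then show ?thesis using arc(4) Vy current[OF ce] by auto
    qed simp
  qed (fact adj_less adj_sym head root_le count_le queue_inj queue_less reached comp_le unreached
      parents roots pending tried)+
qed

lemma step_new:
  assumes ce: "0 < ce" and y: "V (A cur ! (ce - 1)) = 0"
  defines "y \<equiv> A cur ! (ce - 1)"
  shows "search n A h (Suc tl) rt cur (ce - 1) K (V(y := K)) (P(y := Suc cur)) (Q(tl := y))"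
proof -
  note arc = current_arc[OF ce, folded y_def]
  have Vy: "V y = 0" using y by (simp add: y_def)
  have lt: "tl < n" using tail_less[OF arc(3) Vy] .
  obtain k where k: "k < h" "cur = Q k" using current[OF ce] by blast
  have K: "V cur = K" "K \<noteq> 0" using current[OF ce] queue_reached[of k] k head by auto
  have ny: "Q p \<noteq> y" if "p < tl" for p using queue_reached[OF that] Vy by auto
  have img: "(Q(tl := y)) ` {..<Suc tl} = insert y (Q ` {..<tl})" by (auto simp: lessThan_Suc)
  show ?thesis
  proof (unfold_locales, goal_cases)
    case (6)
    show ?case by (intro inj_on_extend queue_inj) (use ny in blast)
  next
    case (7 p)
    then show ?case using queue_less arc(3) by (cases "p = tl") auto
  next
    case (8 z)
    then show ?case unfolding img using reached[of z] K(2) by auto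
  next
    case (9 z)
    then show ?case using comp_le by simp
  next
    case (10 z)
    then show ?case using unreached[of z] K(2) by (auto split: if_splits)
  next
    case (11 p)
    show ?case
    proof (cases "p = tl")
      case True
      have "k < p" using True k head by simp
      moreover have "Q k \<noteq> y" "k \<noteq> tl" using ny k head by auto
      ultimately show ?thesis using True arc(2) k by (intro exI[of _ k]) simp
    next
      case False
      then have p: "p < tl" using 11 by simp
      then have "P (Q p) \<noteq> 0" using 11 ny[OF p] by simp
      from parents[OF p this] obtain q where q: "q < p" "P (Q p) = Suc (Q q)" "Q p \<in> set (A (Q q))" by blast
      then show ?thesis using p ny by (intro exI[of _ q]) simp
    qed
  next
    case (12)
    have "{z. z < n \<and> (V(y := K)) z \<noteq> 0 \<and> (P(y := Suc cur)) z = 0} = {z. z < n \<and> V z \<noteq> 0 \<and> P z = 0}"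
      using Vy by auto
    moreover have "inj_on (V(y := K)) {z. z < n \<and> V z \<noteq> 0 \<and> P z = 0}"
    proof (rule iffD2[OF inj_on_cong roots])
      fix z assume "z \<in> {z. z < n \<and> V z \<noteq> 0 \<and> P z = 0}"
      then have "z \<noteq> y" using Vy by blast
      then show "(V(y := K)) z = V z" by simp
    qed
    ultimately show ?case by simp
  next
    case (13 p)
    then show ?case using pending[of p] ny[of p] by (cases "p = tl") auto
  next
    case (14)
    have "(Q(tl := y)) ` {..<h} = Q ` {..<h}" using head by (intro image_cong) auto
    then show ?case using current[OF ce] by auto
  next
    case (15 p z)
    have p: "p < tl" "p \<noteq> tl" using 15 head by auto
    from closed[of p z] 15 p have "V z = V (Q p) \<or> Q p = cur \<and> z \<in> set (take ce (A cur))" by simp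
    then show ?case
    proof
      assume e: "V z = V (Q p)"
      then have "z \<noteq> y" using Vy queue_reached[OF p(1)] by auto
      then show ?thesis using e ny[OF p(1)] p by simp
    next
      assume "Q p = cur \<and> z \<in> set (take ce (A cur))"
      then show ?thesis using arc(4) K ny[OF p(1)] p by auto
    qed
  next
    case (16 z)
    from tried[OF 16] show ?case using K(2) by simp
  qed (fact adj_less adj_sym root_le | use head count_le in simp)+
qed

text \<open>\<open>closed\<close> holds for the new current vertex because its whole adjacency list
  is still pending.\<close>

lemma step_pop:
  assumes ce: "ce = 0" and h: "h < tl"
  shows "search n A (Suc h) tl rt (Q h) (length (A (Q h))) K V P Q"
proof (unfold_locales, goal_cases)
  case (3)
  then show ?case using h by simp
next
  case (13 p)
  then show ?case using pending by simp
next
  case 14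
  then show ?case using pending[OF h] by auto
next
  case (15 p y)
  show ?case
  proof (cases "p = h")
    case False
    then show ?thesis using closed[of p y] 15 ce by simp
  qed (use 15 in simp)
qed (fact adj_less adj_sym root_le count_le queue_inj queue_less reached comp_le unreached
      parents roots tried)+

lemma step_root_seen:
  assumes "rt < n" "V rt \<noteq> 0"
  shows "search n A h tl (Suc rt) cur ce K V P Q"
proof (unfold_locales, goal_cases)
  case (4)
  then show ?case using assms by simp
next
  case (16 y)
  then show ?case using tried assms by (cases "y = rt") auto
qed (fact adj_less adj_sym head count_le queue_inj queue_less reached comp_le unreached
      parents roots pending current closed)+

text \<open>With an empty queue and no pending arcs, reached vertices have only reached neighbours,
  so no arc leads from them to \<open>rt\<close>. By \<open>comp_le\<close> the number
  \<open>Suc K\<close> is fresh, which keeps the roots distinguishable.\<close>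

lemma step_root_new:
  assumes ce: "ce = 0" and h: "h = tl" and rt: "rt < n" "V rt = 0"
  shows "search n A h (Suc tl) (Suc rt) cur ce (Suc K) (V(rt := Suc K)) P (Q(tl := rt))"
proof -
  have ny: "Q p \<noteq> rt" if "p < tl" for p using queue_reached[OF that] rt by auto
  have img: "(Q(tl := rt)) ` {..<Suc tl} = insert rt (Q ` {..<tl})" by (auto simp: lessThan_Suc)
  have P: "P rt = 0" using unreached rt by simp
  show ?thesis
  proof (unfold_locales, goal_cases)
    case (6)
    show ?case by (intro inj_on_extend queue_inj) (use ny in blast)
  next
    case (7 p)
    then show ?case using queue_less rt by (cases "p = tl") auto
  next
    case (8 z)
    then show ?case unfolding img using reached[of z] by auto
  next
    case (9 z)
    then show ?case using comp_le[of z] by auto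
  next
    case (10 z)
    then show ?case using unreached[of z] by (auto split: if_splits)
  next
    case (11 p)
    show ?case
    proof (cases "p = tl")
      case True
      then show ?thesis using 11 P by simp
    next
      case False
      then have p: "p < tl" using 11 by simp
      then have "P (Q p) \<noteq> 0" using 11 by simp
      from parents[OF p this] obtain q where q: "q < p" "P (Q p) = Suc (Q q)" "Q p \<in> set (A (Q q))" by blast
      then show ?thesis using p by (intro exI[of _ q]) simp
    qed
  next
    case (12)
    have "{z. z < n \<and> (V(rt := Suc K)) z \<noteq> 0 \<and> P z = 0} = insert rt {z. z < n \<and> V z \<noteq> 0 \<and> P z = 0}"
      using rt P by auto
    moreover have "inj_on (V(rt := Suc K)) (insert rt {z. z < n \<and> V z \<noteq> 0 \<and> P z = 0})"
    proof -
      have lt: "V z \<noteq> Suc K" if "z < n" for z using comp_le[OF that] by simp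
      have "inj_on (V(rt := Suc K)) {z. z < n \<and> V z \<noteq> 0 \<and> P z = 0}"
      proof (rule iffD2[OF inj_on_cong roots])
        fix z assume "z \<in> {z. z < n \<and> V z \<noteq> 0 \<and> P z = 0}"
        then have "z \<noteq> rt" using rt by blast
        then show "(V(rt := Suc K)) z = V z" by simp
      qed
      moreover have "(V(rt := Suc K)) rt \<notin> (V(rt := Suc K)) ` ({z. z < n \<and> V z \<noteq> 0 \<and> P z = 0} - {rt})"
      proof
        assume "(V(rt := Suc K)) rt \<in> (V(rt := Suc K)) ` ({z. z < n \<and> V z \<noteq> 0 \<and> P z = 0} - {rt})"
        then obtain z where "z < n" "z \<noteq> rt" "(V(rt := Suc K)) rt = (V(rt := Suc K)) z" by blast
        then show False using lt[of z] by simp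
      qed
      ultimately show ?thesis by (simp only: inj_on_insert simp_thms)
    qed
    ultimately show ?case by simp
  next
    case (13 p)
    then show ?case using h by (cases "p = tl") auto
  next
    case (14)
    then show ?case using ce by simp
  next
    case (15 p z)
    have p: "p < tl" "p \<noteq> tl" using 15 h by auto
    from closed[of p z] 15 p ce have e: "V z = V (Q p)" by simp
    then have "z \<noteq> rt" using rt queue_reached[OF p(1)] by auto
    then show ?case using e ny[OF p(1)] p by simp
  next
    case (16 z)
    then show ?case using tried by (cases "z = rt") auto
  qed (fact adj_less adj_sym | use head rt count_le in simp)+
qed

text \<open>The popped vertex takes its degree plus one out of the sum and returns only its degree,
  as pending arcs.\<close>

lemma work_pop:
  assumes "ce = 0" "h < tl"
  shows "search_work n A (Suc h) rt (length (A (Q h))) Q < search_work n A h rt ce Q"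
proof -
  have nh: "Q h \<notin> Q ` {..<h}"
  proof
    assume "Q h \<in> Q ` {..<h}"
    then obtain p where "p < h" "Q h = Q p" by blast
    then show False using inj_onD[OF queue_inj, of h p] assms(2) by simp
  qed
  have "{..<n} - Q ` {..<h} = insert (Q h) ({..<n} - Q ` {..<Suc h})"
    using queue_less[OF assms(2)] nh by (auto simp: lessThan_Suc)
  moreover have "Q h \<notin> {..<n} - Q ` {..<Suc h}" "finite ({..<n} - Q ` {..<Suc h})" by auto
  ultimately have "(\<Sum>y \<in> {..<n} - Q ` {..<h}. length (A y) + 1) =
      length (A (Q h)) + 1 + (\<Sum>y \<in> {..<n} - Q ` {..<Suc h}. length (A y) + 1)"
    using sum.insert[of "{..<n} - Q ` {..<Suc h}" "Q h" "\<lambda>y. length (A y) + 1"] by presburger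
  then show ?thesis using assms(1) unfolding search_work_def by linarith
qed

end

text \<open>What remains of the search: the queue enumerates all vertices, which fixes the order of
  evaluation, and the component numbers are constant along edges with at most one root each, which
  feeds the edge count.\<close>

lemma (in search) finished:
  assumes "ce = 0" "h = tl" "rt = n"
  shows "bij_betw Q {..<n} {..<n}" "\<And>x y. x < n \<Longrightarrow> y \<in> set (A x) \<Longrightarrow> V y = V x"
    "inj_on V {y. y < n \<and> P y = 0}" "tl = n"
proof -
  have all: "V y \<noteq> 0" if "y < n" for y using tried that assms by simp
  then have surj: "Q ` {..<tl} = {..<n}" using reached queue_less by (auto 4 3)
  then have "card (Q ` {..<tl}) = n" by simp
  then show tl: "tl = n" using card_image[OF queue_inj] by simp
  show "bij_betw Q {..<n} {..<n}" using queue_inj surj tl by (simp add: bij_betw_def)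
  show "V y = V x" if xy: "x < n" "y \<in> set (A x)" for x y
  proof -
    have "x \<in> Q ` {..<tl}" using surj xy by simp
    then obtain p where "p < tl" "x = Q p" by blast
    then show ?thesis using closed[of p y] xy assms by simp
  qed
  have "{y. y < n \<and> P y = 0} = {y. y < n \<and> V y \<noteq> 0 \<and> P y = 0}" using all by auto
  then show "inj_on V {y. y < n \<and> P y = 0}" using roots by simp
qed

section \<open>Bottom-up evaluation\<close>

context rooted_guess begin

text \<open>\<open>D\<close> is the set of evaluated vertices. The accumulators of an evaluated vertex are no longer
  needed, so nothing is said about them.\<close>

definition dp :: "nat set \<Rightarrow> (nat \<Rightarrow> nat \<Rightarrow> nat) \<Rightarrow> (nat \<Rightarrow> nat \<Rightarrow> nat) \<Rightarrow> (nat \<Rightarrow> nat) \<Rightarrow> (nat \<Rightarrow> nat) \<Rightarrow>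
    (nat \<Rightarrow> bool) \<Rightarrow> (nat \<Rightarrow> bool) \<Rightarrow> bool" where
  "dp D LO HI NA NB G0 G1 \<longleftrightarrow>
     (\<forall>v<n. nu \<le> v \<longrightarrow> v \<notin> D \<longrightarrow> (\<forall>c<nc.
       LO v c = pre v c + card {u \<in> ch v. u \<in> D \<and> col u = c \<and> G1 u \<and> \<not> G0 u} \<and>
       HI v c = pre v c + card {u \<in> ch v. u \<in> D \<and> col u = c \<and> G1 u})) \<and>
     (\<forall>u<nu. u \<notin> D \<longrightarrow>
       NB u = card {y \<in> ch u. y \<in> D \<and> \<not> G0 y} \<and> NA u = card {y \<in> ch u. y \<in> D \<and> G1 y}) \<and>
     (\<forall>x \<in> D. ch x \<subseteq> D \<and> table G0 G1 x)"

text \<open>\<open>G0\<close> and \<open>G1\<close> are arbitrary: the tables keep the entries of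
  the previous choice until a vertex is evaluated anew.\<close>

lemma dp_start:
  assumes "\<And>v c. v < n \<Longrightarrow> nu \<le> v \<Longrightarrow> c < nc \<Longrightarrow> LO v c = pre v c \<and> HI v c = pre v c"
    and "\<And>u. u < nu \<Longrightarrow> NA u = 0 \<and> NB u = 0"
  shows "dp {} LO HI NA NB G0 G1"
  using assms by (simp add: dp_def)

lemma dp_ready_right:
  assumes "dp D LO HI NA NB G0 G1" "x < n" "nu \<le> x" "x \<notin> D" "ch x \<subseteq> D" "c < nc"
  shows "LO x c = low G0 G1 x c" "HI x c = high G1 x c"
proof -
  have "{u \<in> ch x. u \<in> D \<and> col u = c \<and> G1 u \<and> \<not> G0 u} = {u \<in> ch x. col u = c \<and> G1 u \<and> \<not> G0 u}"
    "{u \<in> ch x. u \<in> D \<and> col u = c \<and> G1 u} = {u \<in> ch x. col u = c \<and> G1 u}"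
    using assms(5) by blast+
  then show "LO x c = low G0 G1 x c" "HI x c = high G1 x c"
    using assms unfolding dp_def low_def high_def by auto
qed

lemma dp_ready_left:
  assumes "dp D LO HI NA NB G0 G1" "x < nu" "x \<notin> D" "ch x \<subseteq> D"
  shows "NB x = card {y \<in> ch x. \<not> G0 y}" "NA x = card {y \<in> ch x. G1 y}"
proof -
  have "{y \<in> ch x. y \<in> D \<and> \<not> G0 y} = {y \<in> ch x. \<not> G0 y}" "{y \<in> ch x. y \<in> D \<and> G1 y} = {y \<in> ch x. G1 y}"
    using assms(4) by blast+
  then show "NB x = card {y \<in> ch x. \<not> G0 y}" "NA x = card {y \<in> ch x. G1 y}"
    using assms unfolding dp_def by auto
qed

lemma table_cong:
  assumes "table G0 G1 x" and eq: "\<And>y. y = x \<or> y \<in> ch x \<Longrightarrow> G0' y = G0 y \<and> G1' y = G1 y"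
  shows "table G0' G1' x"
proof -
  have "{y \<in> ch x. \<not> G0' y} = {y \<in> ch x. \<not> G0 y}" "{y \<in> ch x. G1' y} = {y \<in> ch x. G1 y}"
    using eq by blast+
  moreover have "low G0' G1' x = low G0 G1 x" "high G1' x = high G1 x"
  proof -
    have "{u \<in> ch x. col u = c \<and> G1' u \<and> \<not> G0' u} = {u \<in> ch x. col u = c \<and> G1 u \<and> \<not> G0 u}"
      "{u \<in> ch x. col u = c \<and> G1' u} = {u \<in> ch x. col u = c \<and> G1 u}" for c
      using eq by blast+
    then show "low G0' G1' x = low G0 G1 x" "high G1' x = high G1 x"
      by (simp_all add: fun_eq_iff low_def high_def)
  qed
  moreover have "G0' x = G0 x" "G1' x = G1 x" using eq by blast+
  ultimately show ?thesis using assms(1) unfolding table_def by (simp only:)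
qed

lemma not_own_child: "x \<notin> ch x"
  using childD by blast

lemma table_extend:
  assumes "\<forall>y \<in> D. ch y \<subseteq> D \<and> table G0 G1 y" "x \<notin> D" "ch x \<subseteq> D"
    and x: "table (G0(x := g0)) (G1(x := g1)) x"
  shows "\<forall>y \<in> insert x D. ch y \<subseteq> insert x D \<and> table (G0(x := g0)) (G1(x := g1)) y"
proof
  fix y assume y: "y \<in> insert x D"
  show "ch y \<subseteq> insert x D \<and> table (G0(x := g0)) (G1(x := g1)) y"
  proof (cases "y = x")
    case True
    then show ?thesis using assms by blast
  next
    case False
    then have y: "y \<in> D" using y by blast
    then have "ch y \<subseteq> D" "table G0 G1 y" using assms(1) by blast+
    moreover have "table (G0(x := g0)) (G1(x := g1)) y"
    proof (rule table_cong[OF \<open>table G0 G1 y\<close>])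
      fix z assume "z = y \<or> z \<in> ch y"
      then have "z \<noteq> x" using y \<open>ch y \<subseteq> D\<close> assms(2) by blast
      then show "(G0(x := g0)) z = G0 z \<and> (G1(x := g1)) z = G1 z" by simp
    qed
    ultimately show ?thesis by blast
  qed
qed

lemma child_iff: "x < n \<Longrightarrow> x \<in> ch v \<longleftrightarrow> pa x \<noteq> 0 \<and> v = pa x - 1"
  by (cases "pa x") (auto simp: kids_def)

text \<open>A newly evaluated vertex changes the counts of its parent only, and by at most one. This
  is why one update per vertex suffices.\<close>

lemma card_insert_done:
  assumes "x < n" "x \<notin> D" and R: "\<And>u. u \<in> D \<Longrightarrow> R' u \<longleftrightarrow> R u"
  shows "card {u \<in> ch v. u \<in> insert x D \<and> R' u} =
    card {u \<in> ch v. u \<in> D \<and> R u} + (if R' x \<and> pa x \<noteq> 0 \<and> v = pa x - 1 then 1 else 0)"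
proof -
  have fin: "finite {u \<in> ch v. u \<in> D \<and> R u}" by (simp add: kids_def)
  show ?thesis
  proof (cases "R' x \<and> x \<in> ch v")
    case True
    then have "{u \<in> ch v. u \<in> insert x D \<and> R' u} = insert x {u \<in> ch v. u \<in> D \<and> R u}" using R by blast
    moreover have "R' x \<and> pa x \<noteq> 0 \<and> v = pa x - 1" using True child_iff[OF assms(1)] by blast
    ultimately show ?thesis using fin assms(2) by simp
  next
    case False
    then have "{u \<in> ch v. u \<in> insert x D \<and> R' u} = {u \<in> ch v. u \<in> D \<and> R u}" using R assms(2) by blast
    moreover have "\<not> (R' x \<and> pa x \<noteq> 0 \<and> v = pa x - 1)" using False child_iff[OF assms(1)] by blast
    ultimately show ?thesis by simp
  qed
qed

text \<open>The outcome at a left vertex reaches its parent as one unit of \<open>HI\<close> if the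
  edge is possible, and as one unit of \<open>LO\<close> too if it is forced.\<close>

lemma dp_left:
  assumes dp: "dp D LO HI NA NB G0 G1" and x: "x < nu" "x \<notin> D" "ch x \<subseteq> D"
    and g1: "g1 \<longleftrightarrow> pa x \<noteq> 0 \<and> \<not> q x \<and> NB x = 0"
    and g0: "g0 \<longleftrightarrow> (if q x then NB x = 0 else NB x = 0 \<and> NA x \<noteq> 0 \<or> NB x = 1)"
    and HI: "\<And>v c. HI' v c = HI v c + (if g1 \<and> v = pa x - 1 \<and> c = col x then 1 else 0)"
    and LO: "\<And>v c. LO' v c = LO v c + (if g1 \<and> \<not> g0 \<and> v = pa x - 1 \<and> c = col x then 1 else 0)"
  shows "dp (insert x D) LO' HI' NA NB (G0(x := g0)) (G1(x := g1))"
proof -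
  let ?G0 = "G0(x := g0)" and ?G1 = "G1(x := g1)"
  have xn: "x < n" using x nu_le by simp
  have ne: "u \<noteq> x" if "u \<in> D" for u using that x by blast
  have "table ?G0 ?G1 x"
  proof -
    have eq: "{y \<in> ch x. \<not> ?G0 y} = {y \<in> ch x. \<not> G0 y}" "{y \<in> ch x. ?G1 y} = {y \<in> ch x. G1 y}"
      using not_own_child by auto
    show ?thesis
      unfolding table_def Let_def eq dp_ready_left[OF dp x, symmetric] fun_upd_same
      using x(1) g0 g1 by simp
  qed
  then have "\<forall>y \<in> insert x D. ch y \<subseteq> insert x D \<and> table ?G0 ?G1 y"
    using dp x by (intro table_extend) (auto simp: dp_def)
  moreover have "LO' v c = pre v c + card {u \<in> ch v. u \<in> insert x D \<and> col u = c \<and> ?G1 u \<and> \<not> ?G0 u} \<and>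
      HI' v c = pre v c + card {u \<in> ch v. u \<in> insert x D \<and> col u = c \<and> ?G1 u}"
    if v: "v < n" "nu \<le> v" "v \<notin> insert x D" "c < nc" for v c
  proof -
    have "LO v c = pre v c + card {u \<in> ch v. u \<in> D \<and> col u = c \<and> G1 u \<and> \<not> G0 u}"
      "HI v c = pre v c + card {u \<in> ch v. u \<in> D \<and> col u = c \<and> G1 u}"
      using dp v unfolding dp_def by auto
    moreover have "card {u \<in> ch v. u \<in> insert x D \<and> col u = c \<and> ?G1 u \<and> \<not> ?G0 u} =
        card {u \<in> ch v. u \<in> D \<and> col u = c \<and> G1 u \<and> \<not> G0 u} +
        (if (col x = c \<and> ?G1 x \<and> \<not> ?G0 x) \<and> pa x \<noteq> 0 \<and> v = pa x - 1 then 1 else 0)"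
      using ne by (intro card_insert_done[OF xn x(2)]) simp
    moreover have "card {u \<in> ch v. u \<in> insert x D \<and> col u = c \<and> ?G1 u} =
        card {u \<in> ch v. u \<in> D \<and> col u = c \<and> G1 u} +
        (if (col x = c \<and> ?G1 x) \<and> pa x \<noteq> 0 \<and> v = pa x - 1 then 1 else 0)"
      using ne by (intro card_insert_done[OF xn x(2)]) simp
    ultimately show ?thesis unfolding LO HI using g1 by auto
  qed
  moreover have "NB u = card {y \<in> ch u. y \<in> insert x D \<and> \<not> ?G0 y} \<and>
      NA u = card {y \<in> ch u. y \<in> insert x D \<and> ?G1 y}"
    if u: "u < nu" "u \<notin> insert x D" for u
  proof -
    have "x \<notin> ch u" using childD[of x u] u(1) x(1) by blast
    then have "{y \<in> ch u. y \<in> insert x D \<and> \<not> ?G0 y} = {y \<in> ch u. y \<in> D \<and> \<not> G0 y}"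
      "{y \<in> ch u. y \<in> insert x D \<and> ?G1 y} = {y \<in> ch u. y \<in> D \<and> G1 y}" by auto
    then show ?thesis using dp u unfolding dp_def by simp
  qed
  ultimately show ?thesis unfolding dp_def by blast
qed

text \<open>Row \<open>x\<close> of \<open>LO\<close> and \<open>HI\<close> is exempt from the
  update rules: the bit true is tested by adding the parent's color to that very row.\<close>

lemma dp_right:
  assumes dp: "dp D LO HI NA NB G0 G1" and x: "x < n" "nu \<le> x" "x \<notin> D" "ch x \<subseteq> D"
    and g0: "g0 \<longleftrightarrow> (\<forall>c<nc. \<forall>c'<nc. LO x c \<le> th x + HI x c')"
    and g1: "g1 \<longleftrightarrow> pa x \<noteq> 0 \<and> (\<forall>c<nc. \<forall>c'<nc. LO x c + own x c \<le> th x + (HI x c' + own x c'))"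
    and LO: "\<And>v c. v \<noteq> x \<Longrightarrow> LO' v c = LO v c" and HI: "\<And>v c. v \<noteq> x \<Longrightarrow> HI' v c = HI v c"
    and NA: "\<And>u. NA' u = NA u + (if g1 \<and> pa x \<noteq> 0 \<and> u = pa x - 1 then 1 else 0)"
    and NB: "\<And>u. NB' u = NB u + (if \<not> g0 \<and> pa x \<noteq> 0 \<and> u = pa x - 1 then 1 else 0)"
  shows "dp (insert x D) LO' HI' NA' NB' (G0(x := g0)) (G1(x := g1))"
proof -
  let ?G0 = "G0(x := g0)" and ?G1 = "G1(x := g1)"
  have ne: "u \<noteq> x" if "u \<in> D" for u using that x by blast
  have "table ?G0 ?G1 x"
  proof -
    have "{u \<in> ch x. col u = c \<and> ?G1 u \<and> \<not> ?G0 u} = {u \<in> ch x. col u = c \<and> G1 u \<and> \<not> G0 u}"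
      "{u \<in> ch x. col u = c \<and> ?G1 u} = {u \<in> ch x. col u = c \<and> G1 u}" for c
      using not_own_child by auto
    then have "low ?G0 ?G1 x c = LO x c" "high ?G1 x c = HI x c" if "c < nc" for c
      using dp_ready_right[OF dp x that] by (simp_all add: low_def high_def)
    then show ?thesis using x(2) g0 g1 unfolding table_def fun_upd_same by simp
  qed
  then have "\<forall>y \<in> insert x D. ch y \<subseteq> insert x D \<and> table ?G0 ?G1 y"
    using dp x by (intro table_extend) (auto simp: dp_def)
  moreover have "LO' v c = pre v c + card {u \<in> ch v. u \<in> insert x D \<and> col u = c \<and> ?G1 u \<and> \<not> ?G0 u} \<and>
      HI' v c = pre v c + card {u \<in> ch v. u \<in> insert x D \<and> col u = c \<and> ?G1 u}"
    if v: "v < n" "nu \<le> v" "v \<notin> insert x D" "c < nc" for v c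
  proof -
    have "x \<notin> ch v" using childD[of x v] v(2) x(2) by auto
    then have "{u \<in> ch v. u \<in> insert x D \<and> col u = c \<and> ?G1 u \<and> \<not> ?G0 u} =
        {u \<in> ch v. u \<in> D \<and> col u = c \<and> G1 u \<and> \<not> G0 u}"
      "{u \<in> ch v. u \<in> insert x D \<and> col u = c \<and> ?G1 u} = {u \<in> ch v. u \<in> D \<and> col u = c \<and> G1 u}"
      by auto
    moreover have "LO' v c = LO v c" "HI' v c = HI v c" using LO HI v by auto
    ultimately show ?thesis using dp v unfolding dp_def by simp
  qed
  moreover have "NB' u = card {y \<in> ch u. y \<in> insert x D \<and> \<not> ?G0 y} \<and>
      NA' u = card {y \<in> ch u. y \<in> insert x D \<and> ?G1 y}"
    if u: "u < nu" "u \<notin> insert x D" for u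
  proof -
    have "NB u = card {y \<in> ch u. y \<in> D \<and> \<not> G0 y}" "NA u = card {y \<in> ch u. y \<in> D \<and> G1 y}"
      using dp u unfolding dp_def by auto
    moreover have "card {y \<in> ch u. y \<in> insert x D \<and> \<not> ?G0 y} = card {y \<in> ch u. y \<in> D \<and> \<not> G0 y} +
        (if \<not> ?G0 x \<and> pa x \<noteq> 0 \<and> u = pa x - 1 then 1 else 0)"
      using ne by (intro card_insert_done[OF x(1,3)]) simp
    moreover have "card {y \<in> ch u. y \<in> insert x D \<and> ?G1 y} = card {y \<in> ch u. y \<in> D \<and> G1 y} +
        (if ?G1 x \<and> pa x \<noteq> 0 \<and> u = pa x - 1 then 1 else 0)"
      using ne by (intro card_insert_done[OF x(1,3)]) simp
    ultimately show ?thesis unfolding NA NB by simp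
  qed
  ultimately show ?thesis unfolding dp_def by blast
qed

text \<open>Keeps the increments of arrays 13 and 14 below \<open>M\<close>, whatever the table
  entries are.\<close>

lemma dp_bound:
  assumes "dp D LO HI NA NB G0 G1" "u < nu" "u \<notin> D"
  shows "NA u \<le> n" "NB u \<le> n"
proof -
  have "card {y \<in> ch u. y \<in> D \<and> R y} \<le> n" for R
    using card_mono[of "{..<n}" "{y \<in> ch u. y \<in> D \<and> R y}"] by (auto simp: kids_def)
  from this[of G1] this[of "\<lambda>y. \<not> G0 y"] show "NA u \<le> n" "NB u \<le> n" using assms unfolding dp_def by simp_all
qed

lemma dp_all:
  assumes "dp {..<n} LO HI NA NB G0 G1"
  shows "(\<exists>\<sigma>. follows \<sigma> \<and> fair \<sigma>) \<longleftrightarrow> (\<forall>x<n. G0 x \<or> G1 x)"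
  using assms by (intro matching_iff_table) (simp add: dp_def)

end

section \<open>Lists in memory\<close>

definition row :: "ast \<Rightarrow> nat \<Rightarrow> nat \<Rightarrow> nat \<Rightarrow> nat list" where
  "row s jl ja x = map (ar s ja x) [0..<ar s jl x 0]"

definition App :: "nat \<Rightarrow> nat \<Rightarrow> nat \<Rightarrow> nat \<Rightarrow> ac" where
  "App jl ja a b = Put ja (Var a) (Arr jl (Var a) (Num 0)) (Var b) ;;
     Put jl (Var a) (Num 0) (Op Add (Arr jl (Var a) (Num 0)) (Num 1))"

definition app :: "ast \<Rightarrow> nat \<Rightarrow> nat \<Rightarrow> nat \<Rightarrow> nat \<Rightarrow> ast" where
  "app s jl ja x v = upd_arr (upd_arr s ja x (ar s jl x 0) v) jl x 0 (ar s jl x 0 + 1)"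

lemma mreg_App [simp]: "mreg (App jl ja a b) = {}"
  by (simp add: App_def)

lemma marr_App [simp]: "marr (App jl ja a b) = {ja, jl}"
  by (auto simp: App_def)

lemma length_row [simp]: "length (row s jl ja x) = ar s jl x 0"
  by (simp add: row_def)

lemma row_nth: "k < ar s jl x 0 \<Longrightarrow> row s jl ja x ! k = ar s ja x k"
  by (simp add: row_def)

lemma row_upd_reg [simp]: "row (s\<lparr>rg := R\<rparr>) = row s"
  by (simp add: row_def fun_eq_iff)

lemma row_upd_arr [simp]: "j \<noteq> jl \<Longrightarrow> j \<noteq> ja \<Longrightarrow> row (upd_arr s j a b v) jl ja = row s jl ja"
  by (simp add: row_def fun_eq_iff)

lemma row_frame: "ar s' jl = ar s jl \<Longrightarrow> ar s' ja = ar s ja \<Longrightarrow> row s' jl ja = row s jl ja"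
  by (simp add: row_def fun_eq_iff)

lemma rg_app [simp]: "rg (app s jl ja x v) = rg s"
  by (simp add: app_def)

lemma ar_app [simp]: "j \<noteq> jl \<Longrightarrow> j \<noteq> ja \<Longrightarrow> ar (app s jl ja x v) j = ar s j"
  by (simp add: app_def)

lemma row_app:
  "jl \<noteq> ja \<Longrightarrow> row (app s jl ja x v) jl ja y = (if y = x then row s jl ja x @ [v] else row s jl ja y)"
  by (auto simp: app_def row_def)

lemma wp_App [simp]:
  assumes "jl \<noteq> ja"
  shows "wp M (App jl ja a b) Q s \<longleftrightarrow> jl < 32 \<and> ja < 32 \<and> a \<noteq> 1 \<and> b \<noteq> 1 \<and> rg s a < M \<and>
    1 < M \<and> ar s jl (rg s a) 0 + 1 < M \<and> Q (app s jl ja (rg s a) (rg s b))"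
  using assms by (auto simp: App_def app_def)

lemma sum_add_at:
  fixes f :: "nat \<Rightarrow> nat"
  assumes "u < k" "\<And>x. x < k \<Longrightarrow> g x = f x + (if x = u then d else 0)"
  shows "(\<Sum>x<k. g x) = (\<Sum>x<k. f x) + d"
proof -
  have "(\<Sum>x<k. g x) = (\<Sum>x<k. f x + (if x = u then d else 0))" using assms(2) by (intro sum.cong) auto
  also have "\<dots> = (\<Sum>x<k. f x) + (\<Sum>x<k. if x = u then d else 0)" by (rule sum.distrib)
  also have "(\<Sum>x<k. if x = u then d else 0) = d" using assms(1) by simp
  finally show ?thesis .
qed

section \<open>Input and adjacency lists\<close>

text \<open>Registers 2 to 6 hold \<open>nu\<close>, \<open>n\<close>, \<open>nc\<close>, \<open>m\<close> and the address \<open>4 + n\<close> of the edge list, register 7 the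
  loop counter. Vertices below \<open>nu\<close> are left vertices. Row 0 of array 0 is the input. Arrays 20 and 2
  are the lengths and entries of the adjacency lists; 3, 4 and 5 component, parent and queue of the
  search; 6 and 7 the lists of non-tree edges; 8 the current choice; 9 to 12 and 15 to 17 the
  accumulators \<open>LO\<close>, \<open>HI\<close>, \<open>NUM\<close>, \<open>MX\<close> and their log; 13 and 14 the numbers of children that can
  be matched to their parent and of those that must be; 18 and 19 the table. One-dimensional arrays
  use column 0 only.\<close>

abbreviation Arr1 :: "nat \<Rightarrow> ax \<Rightarrow> ax" where
  "Arr1 j a \<equiv> Arr j a (Num 0)"

definition edge_words :: ac where
  "edge_words = SetR 8 (Arr 0 (Num 0) (Op Add (Var 6) (Op Add (Var 7) (Var 7)))) ;;
     SetR 9 (Op Add (Var 2) (Arr 0 (Num 0) (Op Add (Op Add (Var 6) (Op Add (Var 7) (Var 7))) (Num 1))))"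

definition adj_body :: ac where
  "adj_body = edge_words ;; App 20 2 8 9 ;; App 20 2 9 8"

definition adj_prog :: ac where
  "adj_prog = For 7 5 adj_body"

text \<open>The input as the program sees it, with right vertices numbered after the left ones.
  \<open>M\<close> exceeds every input address, degree, vertex and color number; its factor 2 makes
  room for a log of up to \<open>2 * n\<close> entries.\<close>

locale words =
  fixes nu n nc m M :: nat and inp :: "nat \<Rightarrow> nat"
  assumes nu_le: "nu \<le> n"
    and M: "M = 2 * (n + nc + 2 * m + 5)"
    and cols: "\<And>u. u < nu \<Longrightarrow> inp (4 + u) < nc"
    and edge_left: "\<And>e. e < m \<Longrightarrow> inp (4 + n + (e + e)) < nu"
    and edge_right: "\<And>e. e < m \<Longrightarrow> nu + inp (4 + n + (e + e) + 1) < n"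
    and edge_inj: "inj_on (\<lambda>e. (inp (4 + n + (e + e)), inp (4 + n + (e + e) + 1))) {..<m}"
begin

lemma M_ge: "2 * n + 2 * nc + 4 * m + 10 \<le> M"
  by (simp add: M)

text \<open>Colors follow the four header words and thresholds follow the colors. With right
  vertices numbered from \<open>nu\<close>, the entry of vertex \<open>k\<close> is at
  \<open>4 + k\<close> on either side.\<close>

definition col :: "nat \<Rightarrow> nat" where "col u = inp (4 + u)"
definition th :: "nat \<Rightarrow> nat" where "th v = inp (4 + v)"
definition eu :: "nat \<Rightarrow> nat" where "eu e = inp (4 + n + (e + e))"
definition ev :: "nat \<Rightarrow> nat" where "ev e = nu + inp (4 + n + (e + e) + 1)"

lemma eu_less: "e < m \<Longrightarrow> eu e < nu" "e < m \<Longrightarrow> eu e < n"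
  using edge_left[of e] nu_le by (simp_all add: eu_def)

lemma ev_less: "e < m \<Longrightarrow> ev e < n" "nu \<le> ev e"
  using edge_right[of e] by (simp_all add: ev_def)

lemma edge_eqD: "e < m \<Longrightarrow> e' < m \<Longrightarrow> eu e = eu e' \<Longrightarrow> ev e = ev e' \<Longrightarrow> e = e'"
  using inj_onD[OF edge_inj, of e e'] by (simp add: eu_def ev_def)

definition base :: "ast \<Rightarrow> bool" where
  "base s \<longleftrightarrow> rg s 2 = nu \<and> rg s 3 = n \<and> rg s 4 = nc \<and> rg s 5 = m \<and> rg s 6 = 4 + n \<and> ar s 0 0 = inp"

lemma base_frame:
  assumes "base s" "frame P s s'" "{2, 3, 4, 5, 6} \<inter> mreg P = {}" "0 \<notin> marr P"
  shows "base s'"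
  using assms unfolding base_def frame_def by auto

lemma base_upd_reg: "base (upd_reg s r v) \<longleftrightarrow> base s" if "r \<notin> {2, 3, 4, 5, 6}"
  using that by (simp add: base_def)

definition nbrs :: "nat \<Rightarrow> nat \<Rightarrow> nat set" where
  "nbrs i x = {y. \<exists>e<i. (x = eu e \<and> y = ev e) \<or> (x = ev e \<and> y = eu e)}"

lemma nbrs_Suc: "nbrs (Suc i) x =
    (if x = eu i then {ev i} else {}) \<union> (if x = ev i then {eu i} else {}) \<union> nbrs i x"
  by (auto simp: nbrs_def less_Suc_eq)

lemma wp_edge_words:
  assumes "base s" "rg s 7 = e" "e < m"
    and "Q (upd_reg (upd_reg s 8 (eu e)) 9 (ev e))"
  shows "wp M edge_words Q s"
  using assms eu_less(2)[of e] ev_less(1)[of e] M by (simp add: edge_words_def base_def eu_def ev_def)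

text \<open>The sum of the lengths bounds each list by \<open>2 * m\<close>, which keeps indices
  below \<open>M\<close>; it is also the degree sum in the running time of the search.\<close>

definition adj_inv :: "nat \<Rightarrow> ast \<Rightarrow> bool" where
  "adj_inv i s \<longleftrightarrow> (\<forall>x<n. set (row s 20 2 x) = nbrs i x) \<and> (\<Sum>x<n. ar s 20 x 0) = 2 * i"

lemma adj_step:
  assumes s: "base s" "rg s 7 = i" "i < m" "adj_inv i s"
  shows "wp M adj_body (\<lambda>s'. adj_inv (Suc i) (upd_reg s' 7 (Suc i))) s"
proof -
  have ne: "eu i \<noteq> ev i" using eu_less[OF s(3)] ev_less[of i] by simp
  have lt: "ar s 20 x 0 < 2 * m" if "x < n" for x
    using member_le_sum[of x "{..<n}" "\<lambda>x. ar s 20 x 0"] that s(3,4) by (simp add: adj_inv_def)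
  let ?s = "upd_reg (upd_reg s 8 (eu i)) 9 (ev i)"
  let ?s' = "app (app ?s 20 2 (eu i) (ev i)) 20 2 (ev i) (eu i)"
  have len: "ar ?s' 20 x 0 = ar s 20 x 0 + (if x = eu i then 1 else 0) + (if x = ev i then 1 else 0)" for x
    using ne by (simp add: app_def)
  have "(\<Sum>x<n. ar s 20 x 0 + (if x = eu i then 1 else 0)) = (\<Sum>x<n. ar s 20 x 0) + 1"
    by (rule sum_add_at[OF eu_less(2)[OF s(3)]]) simp
  moreover have "(\<Sum>x<n. ar ?s' 20 x 0) = (\<Sum>x<n. ar s 20 x 0 + (if x = eu i then 1 else 0)) + 1"
    by (rule sum_add_at[OF ev_less(1)[OF s(3)]]) (simp only: len)
  moreover have "set (row ?s' 20 2 x) = nbrs (Suc i) x" if "x < n" for x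
    using ne s(4) that by (simp add: row_app nbrs_Suc adj_inv_def)
  ultimately have inv: "adj_inv (Suc i) (upd_reg ?s' 7 (Suc i))"
    using s(4) by (simp add: adj_inv_def)
  have a: "ar (app ?s 20 2 (eu i) (ev i)) 20 (ev i) 0 = ar s 20 (ev i) 0" using ne by (simp add: app_def)
  show ?thesis unfolding adj_body_def wp.simps
    using eu_less[OF s(3)] ev_less(1)[OF s(3)] lt[OF eu_less(2)[OF s(3)]] lt[OF ev_less(1)[OF s(3)]] M inv a
    by (intro wp_edge_words[OF s(1,2,3)]) auto
qed

lemma adj_tri:
  assumes "base s" "ar s 20 = (\<lambda>_ _. 0)"
  shows "tri M adj_prog s ((cost adj_body + 8) * m + 6) (adj_inv m)"
  unfolding adj_prog_def
proof (rule tri_for)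
  show "adj_inv 0 (upd_reg s 7 0)" using assms by (simp add: adj_inv_def nbrs_def row_def)
next
  fix i s' assume i: "i < m" "adj_inv i s'" "rg s' 7 = i" and f: "frame (For 7 5 adj_body) s s'"
  have "base s'" by (rule base_frame[OF assms(1) f]) (auto simp: adj_body_def edge_words_def)
  from adj_step[OF this i(3,1,2)]
  show "tri M adj_body s' (cost adj_body) (\<lambda>s''. adj_inv (Suc i) (upd_reg s'' 7 (Suc i)))"
    by (rule tri_wp)
qed (use assms M in \<open>auto simp: base_def adj_body_def edge_words_def\<close>)

end

section \<open>The search program\<close>

definition inc :: "nat \<Rightarrow> ac" where
  "inc r = SetR r (Op Add (Var r) (Num 1))"

text \<open>Adjacency lists are read from the back, so register 14 is the number of pending arcs
  and, once decremented, the index of the next one.\<close>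

definition bfs_arc :: ac where
  "bfs_arc = SetR 14 (Op Sub (Var 14) (Num 1)) ;; SetR 8 (Arr 2 (Var 13) (Var 14)) ;;
     Cond (Arr1 3 (Var 8)) Nop
       (Put 3 (Var 8) (Num 0) (Var 15) ;; Put 4 (Var 8) (Num 0) (Op Add (Var 13) (Num 1)) ;;
        Put 5 (Var 11) (Num 0) (Var 8) ;; inc 11)"

definition bfs_pop :: ac where
  "bfs_pop = SetR 13 (Arr1 5 (Var 10)) ;; inc 10 ;; SetR 14 (Arr1 20 (Var 13))"

definition bfs_root :: ac where
  "bfs_root = Cond (Arr1 3 (Var 12)) (inc 12)
     (inc 15 ;; Put 3 (Var 12) (Num 0) (Var 15) ;; Put 5 (Var 11) (Num 0) (Var 12) ;; inc 11 ;; inc 12)"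

definition bfs_body :: ac where
  "bfs_body = Cond (Var 14) bfs_arc (Cond (Op Less (Var 10) (Var 11)) bfs_pop bfs_root)"

text \<open>Addition serves as disjunction. The sum can reach \<open>2 * m + 2\<close>, which has to
  stay below \<open>M\<close>.\<close>

definition bfs_guard :: ax where
  "bfs_guard = Op Add (Var 14) (Op Add (Op Less (Var 10) (Var 11)) (Op Less (Var 12) (Var 3)))"

definition bfs_init :: ac where
  "bfs_init = SetR 10 (Num 0) ;; SetR 11 (Num 0) ;; SetR 12 (Num 0) ;; SetR 13 (Num 0) ;;
     SetR 14 (Num 0) ;; SetR 15 (Num 0)"

definition bfs_prog :: ac where
  "bfs_prog = bfs_init ;; Loop bfs_guard bfs_body"

definition bfs_cost :: nat where
  "bfs_cost = 1 + exp_time (cx bfs_guard) + cost bfs_body"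

lemma bfs_writes:
  "mreg bfs_body = {8, 10, 11, 12, 13, 14, 15}" "marr bfs_body = {3, 4, 5}"
  "mreg bfs_init = {10, 11, 12, 13, 14, 15}" "marr bfs_init = {}"
  by (auto simp: bfs_body_def bfs_arc_def bfs_pop_def bfs_root_def bfs_init_def inc_def)

context words begin

definition bfs_ok :: "ast \<Rightarrow> bool" where
  "bfs_ok s \<longleftrightarrow> search n (row s 20 2) (rg s 10) (rg s 11) (rg s 12) (rg s 13) (rg s 14) (rg s 15)
     (\<lambda>x. ar s 3 x 0) (\<lambda>x. ar s 4 x 0) (\<lambda>x. ar s 5 x 0)"

definition bfs_work :: "ast \<Rightarrow> nat" where
  "bfs_work s = search_work n (row s 20 2) (rg s 10) (rg s 12) (rg s 14) (\<lambda>x. ar s 5 x 0)"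

text \<open>Each branch of the body realizes one step lemma of \<open>search\<close>, and each of
  these steps lowers the potential.\<close>

lemma bfs_body_step:
  assumes ok: "bfs_ok s" and base: "base s" and len: "\<And>x. x < n \<Longrightarrow> ar s 20 x 0 \<le> 2 * m"
    and guard: "aval s bfs_guard \<noteq> 0"
  shows "wp M bfs_body (\<lambda>s'. bfs_ok s' \<and> bfs_work s' < bfs_work s) s"
proof -
  define R where "R s' \<longleftrightarrow> bfs_ok s' \<and> bfs_work s' < bfs_work s" for s'
  define A where "A = row s 20 2"
  define h where "h = rg s 10"
  define tl where "tl = rg s 11"
  define rt where "rt = rg s 12"
  define cur where "cur = rg s 13"
  define ce where "ce = rg s 14"
  define K where "K = rg s 15"
  define V where "V = (\<lambda>x. ar s 3 x 0)"
  define P where "P = (\<lambda>x. ar s 4 x 0)"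
  define Q where "Q = (\<lambda>x. ar s 5 x 0)"
  note defs = A_def h_def tl_def rt_def cur_def ce_def K_def V_def P_def Q_def
  interpret search n A h tl rt cur ce K V P Q
    using ok unfolding bfs_ok_def defs .
  have n: "rg s 3 = n" using base by (simp add: base_def)
  have Mb: "n + 2 < M" "2 * m + 2 < M" using M by auto
  have tln: "tl \<le> n" by (rule tail_le)
  have R: "R s'" if "search n A h' tl' rt' cur' ce' K' V' P' Q'"
    "search_work n A h' rt' ce' Q' < search_work n A h rt ce Q"
    "row s' 20 2 = A" "rg s' 10 = h'" "rg s' 11 = tl'" "rg s' 12 = rt'" "rg s' 13 = cur'" "rg s' 14 = ce'"
    "rg s' 15 = K'" "(\<lambda>x. ar s' 3 x 0) = V'" "(\<lambda>x. ar s' 4 x 0) = P'" "(\<lambda>x. ar s' 5 x 0) = Q'"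
    for s' h' tl' rt' cur' ce' K' V' P' Q'
    unfolding R_def bfs_ok_def bfs_work_def that(3-) using that(1,2) unfolding defs by blast
  have r: "rg s 10 = h" "rg s 11 = tl" "rg s 12 = rt" "rg s 13 = cur" "rg s 14 = ce" "rg s 15 = K"
    "\<And>x. ar s 3 x 0 = V x" "\<And>x. ar s 4 x 0 = P x" "\<And>x. ar s 5 x 0 = Q x"
    "\<And>x. ar s 20 x 0 = length (A x)"
    by (simp_all add: defs)
  have lenA: "length (A x) \<le> 2 * m" if "x < n" for x using len[OF that] r by simp
  have "wp M bfs_body R s"
  proof (cases "0 < ce")
    case ce: True
    note arc = current_arc[OF ce]
    define y where "y = A cur ! (ce - 1)"
    have ce_le: "ce \<le> length (A cur)" using current[OF ce] by simp
    have y: "ar s 2 cur (ce - 1) = y"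
    proof -
      have "ce - 1 < ar s 20 cur 0" unfolding r(10) using ce ce_le by linarith
      from row_nth[OF this, of 2] show ?thesis by (simp only: y_def A_def)
    qed
    have b: "cur + 1 < M" "ce < M" "y < M" using arc lenA[of cur] ce_le Mb by (auto simp: y_def)
    have body: "wp M bfs_body R s \<longleftrightarrow> wp M bfs_arc R s" using ce r by (simp add: bfs_body_def)
    show ?thesis
    proof (cases "V y = 0")
      case False
      let ?s = "upd_reg (upd_reg s 14 (ce - 1)) 8 y"
      have "R ?s"
      proof (rule R[OF step_seen])
        show "search_work n A h rt (ce - 1) Q < search_work n A h rt ce Q" using ce by (simp add: search_work_def)
        show "row ?s 20 2 = A" by (simp add: A_def)
      qed (use ce False r in \<open>simp_all add: y_def fun_eq_iff\<close>)
      then show ?thesis unfolding body bfs_arc_def using b y ce r False by simp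
    next
      case True
      let ?s = "upd_reg (upd_arr (upd_arr (upd_arr (upd_reg (upd_reg s 14 (ce - 1)) 8 y) 3 y 0 K) 4 y 0 (cur + 1))
        5 tl 0 y) 11 (tl + 1)"
      have "tl < n" using tail_less[OF arc(3)] True by (simp add: y_def)
      have "R ?s"
      proof (rule R[OF step_new])
        show "search_work n A h rt (ce - 1) (Q(tl := A cur ! (ce - 1))) < search_work n A h rt ce Q"
          using ce head by (simp add: search_work_def[of _ _ _ _ _ Q])
        show "row ?s 20 2 = A" by (simp add: A_def row_def fun_eq_iff)
      qed (use ce True r in \<open>simp_all add: y_def fun_eq_iff\<close>)
      then show ?thesis unfolding body bfs_arc_def inc_def using b y ce r True \<open>tl < n\<close> Mb by simp
    qed
  next
    case False
    then have ce: "ce = 0" by simp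
    show ?thesis
    proof (cases "h < tl")
      case h: True
      have Qn: "Q h < n" by (rule queue_less[OF h])
      let ?s = "upd_reg (upd_reg (upd_reg s 13 (Q h)) 10 (h + 1)) 14 (length (A (Q h)))"
      have "R ?s"
      proof (rule R[OF step_pop[OF ce h] work_pop[OF ce h]])
        show "row ?s 20 2 = A" by (simp add: A_def)
      qed (use r in \<open>simp_all add: fun_eq_iff\<close>)
      moreover have "wp M bfs_body R s \<longleftrightarrow> wp M bfs_pop R s" using ce h r Mb by (simp add: bfs_body_def)
      ultimately show ?thesis unfolding bfs_pop_def inc_def using ce h r Mb tln Qn by simp
    next
      case nh: False
      then have h: "h = tl" using head by simp
      have rt: "rt < n" using guard ce h r n by (simp add: bfs_guard_def split: if_splits)
      have body: "wp M bfs_body R s \<longleftrightarrow> wp M bfs_root R s" using ce h r Mb by (simp add: bfs_body_def)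
      show ?thesis
      proof (cases "V rt = 0")
        case nV: False
        let ?s = "upd_reg s 12 (rt + 1)"
        have "R ?s"
        proof (rule R[OF step_root_seen[OF rt nV]])
          show "search_work n A h (Suc rt) ce Q < search_work n A h rt ce Q" using rt by (simp add: search_work_def)
          show "row ?s 20 2 = A" by (simp add: A_def)
        qed (use r in \<open>simp_all add: fun_eq_iff\<close>)
        then show ?thesis unfolding body bfs_root_def inc_def using r Mb rt nV by simp
      next
        case V: True
        let ?s = "upd_reg (upd_reg (upd_arr (upd_arr (upd_reg s 15 (K + 1)) 3 rt 0 (K + 1)) 5 tl 0 rt) 11 (tl + 1)) 12 (rt + 1)"
        have "tl < n" using tail_less[OF rt V] .
        have "R ?s"
        proof (rule R[OF step_root_new[OF ce h rt V]])
          show "search_work n A h (Suc rt) ce (Q(tl := rt)) < search_work n A h rt ce Q"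
            using rt head by (simp add: search_work_def[of _ _ _ _ _ Q])
          show "row ?s 20 2 = A" by (simp add: A_def row_def fun_eq_iff)
        qed (use r in \<open>simp_all add: fun_eq_iff\<close>)
        then show ?thesis unfolding body bfs_root_def inc_def using r Mb rt V \<open>tl < n\<close> count_le by simp
      qed
    qed
  qed
  then show ?thesis unfolding R_def .
qed

lemma adj_search_start:
  assumes "adj_inv m s" "ar s 3 = (\<lambda>_ _. 0)" "ar s 4 = (\<lambda>_ _. 0)"
    "\<forall>r \<in> {10, 11, 12, 13, 14, 15}. rg s r = 0"
  shows "bfs_ok s"
  unfolding bfs_ok_def
proof (unfold_locales, goal_cases)
  case (1 x y)
  then show ?case using assms(1) eu_less ev_less by (auto simp: adj_inv_def nbrs_def)
next
  case (2 x y)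
  then have "y \<in> nbrs m x" using assms(1) by (simp add: adj_inv_def)
  then have "y < n \<and> x \<in> nbrs m y" using eu_less ev_less by (auto simp: nbrs_def)
  then show ?case using assms(1) by (simp add: adj_inv_def)
qed (use assms in auto)

lemma bfs_work_start:
  assumes "adj_inv m s" "rg s 10 = 0" "rg s 12 = 0" "rg s 14 = 0"
  shows "bfs_work s = 2 * m + 2 * n"
proof -
  have "(\<Sum>y<n. length (row s 20 2 y) + 1) = (\<Sum>y<n. ar s 20 y 0) + (\<Sum>y<n. 1)"
    unfolding length_row by (rule sum.distrib)
  then show ?thesis using assms by (simp add: bfs_work_def search_work_def adj_inv_def)
qed

lemma bfs_tri:
  assumes adj: "adj_inv m s" and base: "base s" and zero: "ar s 3 = (\<lambda>_ _. 0)" "ar s 4 = (\<lambda>_ _. 0)"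
  shows "tri M bfs_prog s (cost bfs_init + (bfs_cost * (2 * m + 2 * n) + bfs_cost))
    (\<lambda>s'. bfs_ok s' \<and> rg s' 14 = 0 \<and> rg s' 10 = rg s' 11 \<and> rg s' 12 = n)"
  unfolding bfs_prog_def
proof (rule tri_seq[OF tri_wp])
  show "wp M bfs_init (\<lambda>s'. \<forall>r \<in> {10, 11, 12, 13, 14, 15}. rg s' r = 0) s"
    using M by (simp add: bfs_init_def)
next
  fix s1 assume r: "\<forall>r \<in> {10, 11, 12, 13, 14, 15}. rg s1 r = 0" and f: "frame bfs_init s s1"
  have base1: "base s1" by (rule base_frame[OF base f]) (auto simp: bfs_writes)
  have ar1: "ar s1 j = ar s j" for j using f by (simp add: frame_def bfs_writes)
  have row1: "row s1 20 2 = row s 20 2" by (rule row_frame) (rule ar1)+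
  have adj1: "adj_inv m s1" using adj by (simp add: adj_inv_def row1 ar1)
  have ok1: "bfs_ok s1" using adj1 zero r by (intro adj_search_start) (simp_all add: ar1)
  have work1: "bfs_work s1 = 2 * m + 2 * n" using adj1 r by (intro bfs_work_start) auto
  have len: "ar s1 20 x 0 \<le> 2 * m" if "x < n" for x
    using member_le_sum[of x "{..<n}" "\<lambda>x. ar s1 20 x 0"] that adj1 by (simp add: adj_inv_def)
  have Mb: "n + 2 < M" "2 * m + 2 * n + 4 < M" using M by auto
  \<comment> \<open>Needed to evaluate the guard: the pending arcs all belong to one adjacency
    list.\<close>
  have bnd: "rg s' 14 \<le> 2 * m" if "bfs_ok s'" "frame bfs_body s1 s'" for s'
  proof -
    interpret search n "row s' 20 2" "rg s' 10" "rg s' 11" "rg s' 12" "rg s' 13" "rg s' 14" "rg s' 15"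
      "\<lambda>x. ar s' 3 x 0" "\<lambda>x. ar s' 4 x 0" "\<lambda>x. ar s' 5 x 0"
      using that(1) unfolding bfs_ok_def .
    show ?thesis
    proof (cases "0 < rg s' 14")
      case True
      have "rg s' 14 \<le> ar s' 20 (rg s' 13) 0" "rg s' 13 < n" using current[OF True] current_arc(1)[OF True] by auto
      moreover have "ar s' 20 = ar s1 20" using that(2) by (simp add: frame_def bfs_writes)
      ultimately show ?thesis using len[of "rg s' 13"] by simp
    qed simp
  qed
  have "tri M (Loop bfs_guard bfs_body) s1 (bfs_cost * (2 * m + 2 * n) + 1 + exp_time (cx bfs_guard))
    (\<lambda>s'. (\<exists>k'. bfs_ok s' \<and> k' = bfs_work s') \<and> aval s' bfs_guard = 0)"
    unfolding bfs_cost_def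
  proof (rule tri_loop[where Inv="\<lambda>k s'. bfs_ok s' \<and> k = bfs_work s'"])
    show "bfs_ok s1 \<and> 2 * m + 2 * n = bfs_work s1" using ok1 work1 by simp
  next
    fix k s' assume "bfs_ok s' \<and> k = bfs_work s'" "frame bfs_body s1 s'"
    then show "aok M s' bfs_guard" using bnd[of s'] Mb by (auto simp: bfs_guard_def)
  next
    fix k s' assume i: "bfs_ok s' \<and> k = bfs_work s'" and f': "frame bfs_body s1 s'"
      and g: "aval s' bfs_guard \<noteq> 0"
    have base': "base s'" by (rule base_frame[OF base1 f']) (auto simp: bfs_writes)
    have len': "ar s' 20 x 0 \<le> 2 * m" if "x < n" for x
      using len[OF that] f' by (simp add: frame_def bfs_writes)
    have w: "wp M bfs_body (\<lambda>s''. bfs_ok s'' \<and> bfs_work s'' < bfs_work s') s'"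
      by (rule bfs_body_step[OF _ base' len' g]) (use i in simp)
    show "tri M bfs_body s' (cost bfs_body) (\<lambda>s''. \<exists>k''<k. bfs_ok s'' \<and> k'' = bfs_work s'')"
      by (rule tri_wp, rule wp_mono[OF w]) (use i in auto)
  qed
  then show "tri M (Loop bfs_guard bfs_body) s1 (bfs_cost * (2 * m + 2 * n) + bfs_cost)
    (\<lambda>s'. bfs_ok s' \<and> rg s' 14 = 0 \<and> rg s' 10 = rg s' 11 \<and> rg s' 12 = n)"
  proof (rule tri_mono_frame)
    fix s' assume a: "(\<exists>k'. bfs_ok s' \<and> k' = bfs_work s') \<and> aval s' bfs_guard = 0"
      "frame (Loop bfs_guard bfs_body) s1 s'"
    then have ok: "bfs_ok s'" by simp
    interpret search n "row s' 20 2" "rg s' 10" "rg s' 11" "rg s' 12" "rg s' 13" "rg s' 14" "rg s' 15"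
      "\<lambda>x. ar s' 3 x 0" "\<lambda>x. ar s' 4 x 0" "\<lambda>x. ar s' 5 x 0"
      using ok unfolding bfs_ok_def .
    have "rg s' 3 = n" using a(2) base1 by (simp add: frame_def bfs_writes base_def)
    then have "rg s' 14 = 0" "\<not> rg s' 10 < rg s' 11" "\<not> rg s' 12 < n"
      using a(1) by (auto simp: bfs_guard_def split: if_splits)
    then show "bfs_ok s' \<and> rg s' 14 = 0 \<and> rg s' 10 = rg s' 11 \<and> rg s' 12 = n"
      using ok head root_le by simp
  qed (simp add: bfs_cost_def)
qed simp

end

section \<open>Non-tree edges\<close>

definition nt_body :: ac where
  "nt_body = edge_words ;;
     Cond (Op Equal (Arr1 4 (Var 8)) (Op Add (Var 9) (Num 1))) Nop
       (Cond (Op Equal (Arr1 4 (Var 9)) (Op Add (Var 8) (Num 1))) Nop (App 6 7 8 9))"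

definition nt_prog :: ac where
  "nt_prog = For 7 5 nt_body"

context words begin

definition tree :: "(nat \<Rightarrow> nat) \<Rightarrow> nat \<Rightarrow> bool" where
  "tree pa e \<longleftrightarrow> pa (eu e) = Suc (ev e) \<or> pa (ev e) = Suc (eu e)"

text \<open>The total length is kept as an equation because it becomes the exponent in the bound on
  the number of choices.\<close>

definition nt_inv :: "(nat \<Rightarrow> nat) \<Rightarrow> nat \<Rightarrow> ast \<Rightarrow> bool" where
  "nt_inv pa i s \<longleftrightarrow> (\<forall>u<nu. set (row s 6 7 u) = {ev e | e. e < i \<and> eu e = u \<and> \<not> tree pa e}) \<and>
     (\<Sum>u<nu. ar s 6 u 0) = card {e. e < i \<and> \<not> tree pa e}"

lemma nt_step:
  assumes s: "base s" "rg s 7 = i" "i < m" "nt_inv pa i s" and pa: "\<And>x. ar s 4 x 0 = pa x"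
  shows "wp M nt_body (\<lambda>s'. nt_inv pa (Suc i) (upd_reg s' 7 (Suc i))) s"
proof -
  define Q where "Q s' \<longleftrightarrow> nt_inv pa (Suc i) (upd_reg s' 7 (Suc i))" for s'
  let ?s = "upd_reg (upd_reg s 8 (eu i)) 9 (ev i)"
  have b: "eu i < nu" "eu i < n" "ev i < n" using eu_less ev_less s by auto
  have "ar s 6 (eu i) 0 \<le> (\<Sum>u<nu. ar s 6 u 0)"
    using member_le_sum[of "eu i" "{..<nu}" "\<lambda>u. ar s 6 u 0"] b by simp
  also have "\<dots> = card {e. e < i \<and> \<not> tree pa e}" using s by (simp add: nt_inv_def)
  also have "\<dots> \<le> card {..<i}" by (intro card_mono) auto
  finally have len: "ar s 6 (eu i) 0 < m" using s by simp
  have wp: "wp M nt_body Q s"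
    if "tree pa i \<Longrightarrow> Q ?s" "\<not> tree pa i \<Longrightarrow> Q (app ?s 6 7 (eu i) (ev i))"
    unfolding nt_body_def wp.simps(4)
    by (rule wp_edge_words[OF s(1-3)]) (use b len pa M that in \<open>auto simp: tree_def\<close>)
  have "wp M nt_body Q s"
  proof (rule wp)
    assume t: "tree pa i"
    have "{ev e | e. e < Suc i \<and> eu e = u \<and> \<not> tree pa e} = {ev e | e. e < i \<and> eu e = u \<and> \<not> tree pa e}" for u
      using t by (auto simp: less_Suc_eq)
    moreover have "{e. e < Suc i \<and> \<not> tree pa e} = {e. e < i \<and> \<not> tree pa e}"
      using t by (auto simp: less_Suc_eq)
    ultimately show "Q ?s" using s(4) unfolding Q_def nt_inv_def by simp
  next
    assume t: "\<not> tree pa i"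
    have 1: "{ev e | e. e < Suc i \<and> eu e = u \<and> \<not> tree pa e} =
        (if u = eu i then {ev i} else {}) \<union> {ev e | e. e < i \<and> eu e = u \<and> \<not> tree pa e}" for u
      using t by (auto simp: less_Suc_eq)
    have 2: "{e. e < Suc i \<and> \<not> tree pa e} = insert i {e. e < i \<and> \<not> tree pa e}"
      using t by (auto simp: less_Suc_eq)
    have 3: "card {e. e < Suc i \<and> \<not> tree pa e} = card {e. e < i \<and> \<not> tree pa e} + 1"
      unfolding 2 by simp
    have 4: "(\<Sum>u<nu. ar (app ?s 6 7 (eu i) (ev i)) 6 u 0) = (\<Sum>u<nu. ar s 6 u 0) + 1"
      by (rule sum_add_at[OF b(1)]) (simp add: app_def)
    have "set (row (app ?s 6 7 (eu i) (ev i)) 6 7 u) =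
        (if u = eu i then {ev i} else {}) \<union> set (row s 6 7 u)" for u
      by (simp add: row_app)
    then show "Q (app ?s 6 7 (eu i) (ev i))"
      using s(4) 4 unfolding Q_def nt_inv_def 1 3 by simp
  qed
  then show ?thesis by (simp only: Q_def[abs_def])
qed

lemma nt_tri:
  assumes "base s" "ar s 6 = (\<lambda>_ _. 0)"
  shows "tri M nt_prog s ((cost nt_body + 8) * m + 6) (nt_inv (\<lambda>x. ar s 4 x 0) m)"
  unfolding nt_prog_def
proof (rule tri_for)
  show "nt_inv (\<lambda>x. ar s 4 x 0) 0 (upd_reg s 7 0)" using assms by (simp add: nt_inv_def row_def)
next
  fix i s' assume i: "i < m" "nt_inv (\<lambda>x. ar s 4 x 0) i s'" "rg s' 7 = i" and f: "frame (For 7 5 nt_body) s s'"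
  have "base s'" by (rule base_frame[OF assms(1) f]) (auto simp: nt_body_def edge_words_def)
  from nt_step[OF this i(3,1,2)]
  show "tri M nt_body s' (cost nt_body) (\<lambda>s''. nt_inv (\<lambda>x. ar s 4 x 0) (Suc i) (upd_reg s'' 7 (Suc i)))"
    by (rule tri_wp) (use f in \<open>simp add: frame_def nt_body_def edge_words_def\<close>)
qed (use assms M in \<open>auto simp: base_def nt_body_def edge_words_def\<close>)

end

section \<open>Enumeration of the choices\<close>

text \<open>The outcome of the search without the memory: an order in which parents come first,
  labels constant along edges that separate the roots, and the non-tree edges at every left
  vertex.\<close>

locale forest = words +
  fixes pa ord comp :: "nat \<Rightarrow> nat" and nt :: "nat \<Rightarrow> nat list"
  assumes ord: "bij_betw ord {..<n} {..<n}"
    and parents: "\<And>p. p < n \<Longrightarrow> pa (ord p) \<noteq> 0 \<Longrightarrow>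
      \<exists>q<p. pa (ord p) = Suc (ord q) \<and> ord p \<in> nbrs m (ord q)"
    and comp_edge: "\<And>e. e < m \<Longrightarrow> comp (eu e) = comp (ev e)"
    and comp_roots: "inj_on comp {y. y < n \<and> pa y = 0}"
    and nt_set: "\<And>u. u < nu \<Longrightarrow> set (nt u) = {ev e | e. e < m \<and> eu e = u \<and> \<not> tree pa e}"
    and nt_sum: "(\<Sum>u<nu. length (nt u)) = card {e. e < m \<and> \<not> tree pa e}"
begin

lemma length_nt_le:
  assumes "u < nu"
  shows "length (nt u) \<le> m"
proof -
  have "length (nt u) \<le> (\<Sum>u<nu. length (nt u))" using assms by (intro member_le_sum) auto
  also have "\<dots> \<le> card {..<m}" unfolding nt_sum by (intro card_mono) auto
  finally show ?thesis by simp
qed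

definition rk :: "nat \<Rightarrow> nat" where
  "rk = inv_into {..<n} ord"

lemma ord_less: "p < n \<Longrightarrow> ord p < n"
  using ord by (auto simp: bij_betw_def)

lemma rk_less: "x < n \<Longrightarrow> rk x < n"
  using ord bij_betw_inv_into[OF ord] by (auto simp: rk_def bij_betw_def)

lemma ord_rk: "x < n \<Longrightarrow> ord (rk x) = x"
  unfolding rk_def by (rule bij_betw_inv_into_right[OF ord]) simp

lemma rk_ord: "p < n \<Longrightarrow> rk (ord p) = p"
  unfolding rk_def by (rule bij_betw_inv_into_left[OF ord]) simp

lemma parentE:
  assumes "x < n" "pa x \<noteq> 0"
  obtains y where "y < n" "pa x = Suc y" "rk y < rk x" "x \<in> nbrs m y"
proof -
  have "pa (ord (rk x)) \<noteq> 0" using assms ord_rk by simp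
  from parents[OF rk_less[OF assms(1)] this]
  obtain q where q: "q < rk x" "pa x = Suc (ord q)" "x \<in> nbrs m (ord q)"
    using ord_rk[OF assms(1)] by auto
  have "q < n" using q(1) rk_less[OF assms(1)] by simp
  then show ?thesis using q that[of "ord q"] ord_less rk_ord by simp
qed

lemma rooted: "rooted_guess nu n pa rk"
proof
  fix x assume "x < n" "pa x \<noteq> 0"
  from parentE[OF this] obtain y where y: "y < n" "pa x = Suc y" "rk y < rk x" "x \<in> nbrs m y" .
  obtain e where e: "e < m" "y = eu e \<and> x = ev e \<or> y = ev e \<and> x = eu e" using y(4) by (auto simp: nbrs_def)
  then have "x < nu \<longleftrightarrow> \<not> y < nu" using eu_less(1)[of e] ev_less(2)[of e] by auto
  then show "pa x - 1 < n \<and> rk (pa x - 1) < rk x \<and> (x < nu \<longleftrightarrow> \<not> pa x - 1 < nu)" using y by simp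
qed (rule nu_le)

text \<open>Each non-root is sent to the edge to its parent. So there are at least as many tree
  edges as non-roots, while the roots number at most the labels.\<close>

lemma nontree_bound:
  "card {e. e < m \<and> \<not> tree pa e} + n \<le> m + card (comp ` {..<n})"
proof -
  let ?C = "{x. x < n \<and> pa x \<noteq> 0}" and ?R = "{y. y < n \<and> pa y = 0}" and ?T = "{e. e < m \<and> tree pa e}"
  have "\<exists>e. e < m \<and> (x = eu e \<and> pa x = Suc (ev e) \<or> x = ev e \<and> pa x = Suc (eu e))"
    if "x \<in> ?C" for x
  proof -
    from that obtain y where "pa x = Suc y" "x \<in> nbrs m y" using parentE[of x] by auto
    then show ?thesis by (auto simp: nbrs_def)
  qed
  then obtain f where f: "\<And>x. x \<in> ?C \<Longrightarrow>
    f x < m \<and> (x = eu (f x) \<and> pa x = Suc (ev (f x)) \<or> x = ev (f x) \<and> pa x = Suc (eu (f x)))"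
    by metis
  have "inj_on f ?C"
  proof (rule inj_onI)
    fix x x' assume x: "x \<in> ?C" "x' \<in> ?C" "f x = f x'"
    show "x = x'"
    proof (rule ccontr)
      assume "x \<noteq> x'"
      \<comment> \<open>A shared edge makes the two vertices parents of each other, which the ranks
        forbid.\<close>
      then have "pa x = Suc x'" "pa x' = Suc x" using f[OF x(1)] f[OF x(2)] x(3) by auto
      moreover have "rk (pa x - 1) < rk x" "rk (pa x' - 1) < rk x'"
        using rooted_guess.parent[OF rooted] x(1,2) by auto
      ultimately show False by simp
    qed
  qed
  moreover have "f ` ?C \<subseteq> ?T"
  proof
    fix e assume "e \<in> f ` ?C"
    then obtain x where "x \<in> ?C" "e = f x" by blast
    then show "e \<in> ?T" using f[of x] by (auto simp: tree_def)
  qed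
  ultimately have "card ?C \<le> card ?T" by (rule card_inj_on_le) simp
  moreover have "card ?R = card (comp ` ?R)" using card_image[OF comp_roots] by simp
  moreover have "card (comp ` ?R) \<le> card (comp ` {..<n})" by (intro card_mono image_mono) auto
  moreover have "card ?R + card ?C = n"
  proof -
    have "card (?R \<union> ?C) = card ?R + card ?C" by (rule card_Un_disjoint) auto
    moreover have "?R \<union> ?C = {..<n}" by auto
    ultimately show ?thesis by simp
  qed
  moreover have "card {e. e < m \<and> \<not> tree pa e} + card ?T = m"
  proof -
    have "card ({e. e < m \<and> \<not> tree pa e} \<union> ?T) = card {e. e < m \<and> \<not> tree pa e} + card ?T"
      by (rule card_Un_disjoint) auto
    moreover have "{e. e < m \<and> \<not> tree pa e} \<union> ?T = {..<m}" by auto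
    ultimately show ?thesis by simp
  qed
  ultimately show ?thesis by linarith
qed

definition follows :: "(nat \<Rightarrow> nat) \<Rightarrow> (nat \<Rightarrow> nat) \<Rightarrow> bool" where
  "follows d = rooted_guess.follows nu n pa (\<lambda>u. nt u ! (d u - 1)) (\<lambda>u. d u \<noteq> 0)"

definition fair :: "(nat \<Rightarrow> nat) \<Rightarrow> bool" where
  "fair = rooted_guess.fair nu n nc col th"

definition good :: "(nat \<Rightarrow> nat) \<Rightarrow> bool" where
  "good d \<longleftrightarrow> (\<exists>\<sigma>. follows d \<sigma> \<and> fair \<sigma>)"

definition solution :: "(nat \<Rightarrow> nat) \<Rightarrow> bool" where
  "solution \<sigma> \<longleftrightarrow> (\<forall>u<nu. \<exists>e<m. eu e = u \<and> ev e = \<sigma> u) \<and> fair \<sigma>"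

text \<open>Digit 0 leaves \<open>u\<close> to the tree; a digit \<open>k > 0\<close> selects the
  non-tree edge at position \<open>k - 1\<close>.\<close>

definition rad :: "nat \<Rightarrow> nat" where
  "rad u = Suc (length (nt u))"

lemma follows_iff: "follows d \<sigma> \<longleftrightarrow> (\<forall>u<nu. if d u \<noteq> 0 then \<sigma> u = nt u ! (d u - 1)
    else nu \<le> \<sigma> u \<and> \<sigma> u < n \<and> (pa u = Suc (\<sigma> u) \<or> pa (\<sigma> u) = Suc u))"
  unfolding follows_def rooted_guess.follows_def[OF rooted] ..

lemma good_cong:
  assumes "\<And>u. u < nu \<Longrightarrow> d u = d' u"
  shows "good d = good d'"
  unfolding good_def follows_iff using assms by simp

lemma tree_edge:
  assumes "u < nu" "nu \<le> v" "v < n" "pa u = Suc v \<or> pa v = Suc u"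
  shows "\<exists>e<m. eu e = u \<and> ev e = v"
  using assms(4)
proof
  assume "pa u = Suc v"
  moreover have "u < n" using assms nu_le by simp
  ultimately have "u \<in> nbrs m v" using parentE[of u] by auto
  then obtain e where "e < m" "v = eu e \<and> u = ev e \<or> v = ev e \<and> u = eu e" by (auto simp: nbrs_def)
  then show ?thesis using eu_less(1)[of e] assms by auto
next
  assume "pa v = Suc u"
  then have "v \<in> nbrs m u" using parentE[of v] assms by auto
  then obtain e where "e < m" "u = eu e \<and> v = ev e \<or> u = ev e \<and> v = eu e" by (auto simp: nbrs_def)
  then show ?thesis using ev_less(2)[of e] assms by auto
qed

text \<open>The edge used at a left vertex is a tree edge, giving digit 0, or occurs in the list of
  non-tree edges. Conversely, whatever a choice allows is an edge of the graph.\<close>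

lemma solution_iff_choice:
  "(\<exists>\<sigma>. solution \<sigma>) \<longleftrightarrow> (\<exists>d. (\<forall>u<nu. d u < rad u) \<and> good d)"
proof
  assume "\<exists>\<sigma>. solution \<sigma>"
  then obtain \<sigma> where \<sigma>: "\<forall>u<nu. \<exists>e<m. eu e = u \<and> ev e = \<sigma> u" "fair \<sigma>" by (auto simp: solution_def)
  have "\<exists>k. k < rad u \<and> (if k \<noteq> 0 then \<sigma> u = nt u ! (k - 1)
      else nu \<le> \<sigma> u \<and> \<sigma> u < n \<and> (pa u = Suc (\<sigma> u) \<or> pa (\<sigma> u) = Suc u))" if u: "u < nu" for u
  proof -
    obtain e where e: "e < m" "eu e = u" "ev e = \<sigma> u" using \<sigma>(1) u by blast
    show ?thesis
    proof (cases "tree pa e")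
      case True
      then show ?thesis using e ev_less[of e] by (intro exI[of _ 0]) (simp add: tree_def rad_def)
    next
      case False
      then have "\<sigma> u \<in> set (nt u)" unfolding nt_set[OF u]
        using e by (intro CollectI exI[of _ e]) simp
      then obtain k where "k < length (nt u)" "nt u ! k = \<sigma> u" by (auto simp: in_set_conv_nth)
      then show ?thesis by (intro exI[of _ "Suc k"]) (simp add: rad_def)
    qed
  qed
  then have "\<forall>u. \<exists>k. u < nu \<longrightarrow> k < rad u \<and> (if k \<noteq> 0 then \<sigma> u = nt u ! (k - 1)
      else nu \<le> \<sigma> u \<and> \<sigma> u < n \<and> (pa u = Suc (\<sigma> u) \<or> pa (\<sigma> u) = Suc u))" by blast
  from choice[OF this] obtain d where d: "\<And>u. u < nu \<Longrightarrow> d u < rad u \<and> (if d u \<noteq> 0 then \<sigma> u = nt u ! (d u - 1)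
      else nu \<le> \<sigma> u \<and> \<sigma> u < n \<and> (pa u = Suc (\<sigma> u) \<or> pa (\<sigma> u) = Suc u))" by blast
  have "follows d \<sigma>" unfolding follows_iff using d by blast
  then show "\<exists>d. (\<forall>u<nu. d u < rad u) \<and> good d" using d \<sigma>(2) unfolding good_def by blast
next
  assume "\<exists>d. (\<forall>u<nu. d u < rad u) \<and> good d"
  then obtain d \<sigma> where d: "\<forall>u<nu. d u < rad u" and \<sigma>: "follows d \<sigma>" "fair \<sigma>" by (auto simp: good_def)
  have "\<exists>e<m. eu e = u \<and> ev e = \<sigma> u" if u: "u < nu" for u
  proof (cases "d u = 0")
    case True
    then have "nu \<le> \<sigma> u \<and> \<sigma> u < n \<and> (pa u = Suc (\<sigma> u) \<or> pa (\<sigma> u) = Suc u)"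
      using \<sigma>(1) u unfolding follows_iff by auto
    then show ?thesis using tree_edge[OF u] by blast
  next
    case False
    then have s: "\<sigma> u = nt u ! (d u - 1)" using \<sigma>(1) u unfolding follows_iff by auto
    have "d u - 1 < length (nt u)" using d u False unfolding rad_def by force
    then have "\<sigma> u \<in> set (nt u)" unfolding s by (rule nth_mem)
    then show ?thesis unfolding nt_set[OF u] by auto
  qed
  then show "\<exists>\<sigma>. solution \<sigma>" using \<sigma>(2) unfolding solution_def by blast
qed

lemma rad_pos: "0 < rad u"
  by (simp add: rad_def)

lemma solution_iff_counter:
  "(\<exists>\<sigma>. solution \<sigma>) \<longleftrightarrow> (\<exists>t < radix rad nu. good (dig rad t))"
  unfolding solution_iff_choice
proof
  assume "\<exists>d. (\<forall>u<nu. d u < rad u) \<and> good d"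
  then obtain d where d: "\<forall>u<nu. d u < rad u" "good d" by blast
  obtain t where t: "t < radix rad nu" "\<forall>u<nu. dig rad t u = d u" using dig_surj[of nu d rad] d(1) by blast
  then have "good (dig rad t)" using d(2) good_cong[of "dig rad t" d] by simp
  then show "\<exists>t < radix rad nu. good (dig rad t)" using t(1) by blast
next
  assume "\<exists>t < radix rad nu. good (dig rad t)"
  then show "\<exists>d. (\<forall>u<nu. d u < rad u) \<and> good d" using dig_less rad_pos by blast
qed

lemma radix_le: "radix rad nu \<le> 2 ^ card {e. e < m \<and> \<not> tree pa e}"
proof -
  have "radix rad k \<le> 2 ^ (\<Sum>u<k. length (nt u))" for k
  proof (induction k)
    case (Suc k)
    have "rad k \<le> 2 ^ length (nt k)" unfolding rad_def by (rule Suc_leI) (rule less_exp)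
    then have "radix rad k * rad k \<le> 2 ^ (\<Sum>u<k. length (nt u)) * 2 ^ length (nt k)"
      using Suc by (intro mult_le_mono)
    then show ?case by (simp add: power_add)
  qed simp
  then show ?thesis unfolding nt_sum[symmetric] .
qed

end

section \<open>Accumulators\<close>

text \<open>\<open>LO v c\<close> and \<open>HI v c\<close> are the least and the largest possible number of vertices of color \<open>c\<close>
  matched to \<open>v\<close>. \<open>NUM v k\<close> counts the colors \<open>c\<close> with \<open>k \<le> HI v c\<close>, which makes the minimum of \<open>HI v\<close> over all
  colors testable in constant time; \<open>MX v\<close> is the maximum of \<open>LO v\<close>. The log \<open>LV, LC, LH\<close> lists
  the cells in use, so that they can be cleared without touching the whole arrays.\<close>

definition acc :: "nat \<Rightarrow> nat \<Rightarrow> nat \<Rightarrow> (nat \<Rightarrow> nat \<Rightarrow> nat) \<Rightarrow> (nat \<Rightarrow> nat \<Rightarrow> nat) \<Rightarrow> (nat \<Rightarrow> nat \<Rightarrow> nat) \<Rightarrow> (nat \<Rightarrow> nat) \<Rightarrow>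
    (nat \<Rightarrow> nat) \<Rightarrow> (nat \<Rightarrow> nat) \<Rightarrow> (nat \<Rightarrow> nat) \<Rightarrow> nat \<Rightarrow> bool" where
  "acc n nc M LO HI NUM MX LV LC LH len \<longleftrightarrow>
     (\<forall>v c. LO v c \<le> HI v c \<and> HI v c \<le> len) \<and> (\<forall>v k. NUM v k \<le> len) \<and>
     (\<forall>v c. HI v c \<noteq> 0 \<longrightarrow> (\<exists>i<len. LV i = v \<and> LC i = c)) \<and>
     (\<forall>v k. NUM v k \<noteq> 0 \<longrightarrow> (\<exists>i<len. LV i = v \<and> LH i = k)) \<and>
     (\<forall>i<len. LV i < n \<and> LC i < nc \<and> LH i < M) \<and>
     (\<forall>v k. 0 < k \<longrightarrow> NUM v k = card {c. c < nc \<and> k \<le> HI v c}) \<and>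
     (\<forall>v<n. (\<forall>c<nc. LO v c \<le> MX v) \<and> (MX v \<noteq> 0 \<longrightarrow> (\<exists>c<nc. LO v c = MX v)))"

lemma accI:
  assumes "\<And>v c. LO v c \<le> HI v c \<and> HI v c \<le> len" "\<And>v k. NUM v k \<le> len"
    "\<And>v c. HI v c \<noteq> 0 \<Longrightarrow> \<exists>i<len. LV i = v \<and> LC i = c"
    "\<And>v k. NUM v k \<noteq> 0 \<Longrightarrow> \<exists>i<len. LV i = v \<and> LH i = k"
    "\<And>i. i < len \<Longrightarrow> LV i < n \<and> LC i < nc \<and> LH i < M"
    "\<And>v k. 0 < k \<Longrightarrow> NUM v k = card {c. c < nc \<and> k \<le> HI v c}"
    "\<And>v. v < n \<Longrightarrow> (\<forall>c<nc. LO v c \<le> MX v) \<and> (MX v \<noteq> 0 \<longrightarrow> (\<exists>c<nc. LO v c = MX v))"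
  shows "acc n nc M LO HI NUM MX LV LC LH len"
  unfolding acc_def
proof (intro conjI)
  show "\<forall>v c. LO v c \<le> HI v c \<and> HI v c \<le> len" using assms(1) by simp
  show "\<forall>v k. NUM v k \<le> len" using assms(2) by simp
  show "\<forall>v c. HI v c \<noteq> 0 \<longrightarrow> (\<exists>i<len. LV i = v \<and> LC i = c)" using assms(3) by simp
  show "\<forall>v k. NUM v k \<noteq> 0 \<longrightarrow> (\<exists>i<len. LV i = v \<and> LH i = k)" using assms(4) by simp
  show "\<forall>i<len. LV i < n \<and> LC i < nc \<and> LH i < M" using assms(5) by simp
  show "\<forall>v k. 0 < k \<longrightarrow> NUM v k = card {c. c < nc \<and> k \<le> HI v c}" using assms(6) by simp
  show "\<forall>v<n. (\<forall>c<nc. LO v c \<le> MX v) \<and> (MX v \<noteq> 0 \<longrightarrow> (\<exists>c<nc. LO v c = MX v))"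
    using assms(7) by blast
qed

lemma accD:
  assumes "acc n nc M LO HI NUM MX LV LC LH len"
  shows "LO v c \<le> HI v c" "HI v c \<le> len" "NUM v k \<le> len"
    "HI v c \<noteq> 0 \<Longrightarrow> \<exists>i<len. LV i = v \<and> LC i = c"
    "NUM v k \<noteq> 0 \<Longrightarrow> \<exists>i<len. LV i = v \<and> LH i = k"
    "i < len \<Longrightarrow> LV i < n \<and> LC i < nc \<and> LH i < M"
    "0 < k \<Longrightarrow> NUM v k = card {c. c < nc \<and> k \<le> HI v c}"
    "v < n \<Longrightarrow> (\<forall>c<nc. LO v c \<le> MX v) \<and> (MX v \<noteq> 0 \<longrightarrow> (\<exists>c<nc. LO v c = MX v))"
  using assms unfolding acc_def by simp_all

lemma acc_start:
  assumes "\<And>v c. LO v c = 0" "\<And>v c. HI v c = 0" "\<And>v k. NUM v k = 0" "\<And>v. v < n \<Longrightarrow> MX v = 0"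
  shows "acc n nc M LO HI NUM MX LV LC LH 0"
  using assms by (simp add: acc_def)

text \<open>Raising \<open>HI v c\<close> from \<open>h\<close> to \<open>h + 1\<close> changes a
  single count, the one for \<open>k = h + 1\<close>, so constant work suffices. One log entry
  covers both cells written.\<close>

lemma acc_push_high:
  assumes a: "acc n nc M LO HI NUM MX LV LC LH len" and v: "v < n" "c < nc" "Suc len < M"
  shows "acc n nc M LO (HI(v := (HI v)(c := Suc (HI v c))))
    (NUM(v := (NUM v)(Suc (HI v c) := Suc (NUM v (Suc (HI v c)))))) MX
    (LV(len := v)) (LC(len := c)) (LH(len := Suc (HI v c))) (Suc len)"
    (is "acc n nc M LO ?HI ?NUM MX ?LV ?LC ?LH (Suc len)")
proof -
  note le = accD(1-3)[OF a] and cov = accD(4,5)[OF a] and num = accD(7)[OF a] and log = accD(6)[OF a]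
  have 1: "LO v' c' \<le> ?HI v' c' \<and> ?HI v' c' \<le> Suc len" for v' c'
    using le(1,2)[of v' c'] by (cases "v' = v \<and> c' = c") auto
  have 2: "?NUM v' k \<le> Suc len" for v' k
    using le(3)[of v' k] by (cases "v' = v \<and> k = Suc (HI v c)") auto
  have 3: "\<exists>i<Suc len. ?LV i = v' \<and> ?LC i = c'" if "?HI v' c' \<noteq> 0" for v' c'
  proof (cases "v' = v \<and> c' = c")
    case True
    then show ?thesis by (intro exI[of _ len]) simp
  next
    case False
    then have "HI v' c' \<noteq> 0" using that by (auto split: if_splits)
    from cov(1)[OF this] obtain i where "i < len" "LV i = v'" "LC i = c'" by blast
    then show ?thesis by (intro exI[of _ i]) simp
  qed
  have 4: "\<exists>i<Suc len. ?LV i = v' \<and> ?LH i = k" if "?NUM v' k \<noteq> 0" for v' k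
  proof (cases "v' = v \<and> k = Suc (HI v c)")
    case True
    then show ?thesis by (intro exI[of _ len]) simp
  next
    case False
    then have "NUM v' k \<noteq> 0" using that by (auto split: if_splits)
    from cov(2)[OF this] obtain i where "i < len" "LV i = v'" "LH i = k" by blast
    then show ?thesis by (intro exI[of _ i]) simp
  qed
  have 5: "?LV i < n \<and> ?LC i < nc \<and> ?LH i < M" if "i < Suc len" for i
    using that log[of i] v le(2)[of v c] by (cases "i = len") auto
  have 6: "?NUM v' k = card {c. c < nc \<and> k \<le> ?HI v' c}" if k: "0 < k" for v' k
  proof (cases "v' = v \<and> k = Suc (HI v c)")
    case True
    then have "{c. c < nc \<and> k \<le> ?HI v' c} = insert c {c. c < nc \<and> k \<le> HI v c}" using v by auto
    then show ?thesis using True num[OF k, of v] by simp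
  next
    case False
    then have "{c. c < nc \<and> k \<le> ?HI v' c} = {c. c < nc \<and> k \<le> HI v' c}" by auto
    then show ?thesis using False num[OF k, of v'] by auto
  qed
  show ?thesis by (rule accI) (fact 1 2 3 4 5 6 accD(8)[OF a])+
qed

text \<open>The hypothesis \<open>LO v c < HI v c\<close> is the reason why a push raises
  \<open>HI\<close> first. Keeping \<open>LO \<le> HI\<close> lets the log of \<open>HI\<close>
  cells serve for \<open>LO\<close> as well.\<close>

lemma acc_push_low:
  assumes a: "acc n nc M LO HI NUM MX LV LC LH len" and v: "v < n" "c < nc" "LO v c < HI v c"
  shows "acc n nc M (LO(v := (LO v)(c := Suc (LO v c)))) HI NUM
    (MX(v := (if MX v < Suc (LO v c) then Suc (LO v c) else MX v))) LV LC LH len"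
    (is "acc n nc M ?LO HI NUM ?MX LV LC LH len")
proof -
  note mx = accD(8)[OF a]
  have le: "LO v' c' \<le> HI v' c' \<and> HI v' c' \<le> len" for v' c' using accD(1,2)[OF a] by blast
  have 1: "?LO v' c' \<le> HI v' c' \<and> HI v' c' \<le> len" for v' c'
    using le[of v' c'] v(3) by (cases "v' = v \<and> c' = c") auto
  have 2: "(\<forall>c<nc. ?LO v' c \<le> ?MX v') \<and> (?MX v' \<noteq> 0 \<longrightarrow> (\<exists>c<nc. ?LO v' c = ?MX v'))" if v': "v' < n" for v'
  proof (cases "v' = v")
    case False
    then show ?thesis using mx[OF v'] by simp
  next
    case True
    have m: "\<forall>c<nc. LO v c \<le> MX v" using mx[OF v(1)] by blast
    show ?thesis
    proof (cases "MX v < Suc (LO v c)")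
      case lt: True
      then have "\<forall>c'<nc. ?LO v' c' \<le> ?MX v'" using m True by fastforce
      moreover have "?LO v' c = ?MX v'" using lt True by simp
      ultimately show ?thesis using v(2) by blast
    next
      case nlt: False
      then have "MX v \<noteq> 0" by simp
      then obtain c' where c': "c' < nc" "LO v c' = MX v" using mx[OF v(1)] by blast
      then have "c' \<noteq> c" using nlt by auto
      then have "?LO v' c' = ?MX v'" using c' nlt True by simp
      moreover have "\<forall>c'<nc. ?LO v' c' \<le> ?MX v'" using m True nlt by simp
      ultimately show ?thesis using c'(1) by blast
    qed
  qed
  show ?thesis by (rule accI) (fact 1 2 accD(3-7)[OF a])+
qed

text \<open>The inequality says that every color reaches \<open>MX v - l\<close> in
  \<open>HI v\<close>, and \<open>NUM\<close> counts the colors that do. The case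
  \<open>MX v - l = 0\<close> is separate because \<open>acc\<close> ties \<open>NUM v k\<close> to
  a count only for positive \<open>k\<close>.\<close>

lemma acc_fair:
  assumes a: "acc n nc M LO HI NUM MX LV LC LH len" and v: "v < n"
  shows "(\<forall>c<nc. \<forall>c'<nc. LO v c \<le> l + HI v c') \<longleftrightarrow> MX v - l = 0 \<or> NUM v (MX v - l) = nc"
proof -
  have mx: "\<forall>c<nc. LO v c \<le> MX v" "MX v \<noteq> 0 \<longrightarrow> (\<exists>c<nc. LO v c = MX v)"
    using accD(8)[OF a v] by blast+
  show ?thesis
  proof (cases "MX v - l = 0")
    case True
    have "LO v c \<le> l + HI v c'" if "c < nc" for c c'
      using mx(1) that True by (metis diff_is_0_eq order_trans trans_le_add1)
    then show ?thesis using True by blast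
  next
    case False
    then obtain c0 where c0: "c0 < nc" "LO v c0 = MX v" using mx(2) by auto
    let ?C = "{c. c < nc \<and> MX v - l \<le> HI v c}"
    have "NUM v (MX v - l) = card ?C" using accD(7)[OF a, of "MX v - l" v] False by simp
    moreover have "card ?C = nc \<longleftrightarrow> ?C = {..<nc}"
    proof
      assume "card ?C = nc"
      then show "?C = {..<nc}" by (intro card_subset_eq) auto
    qed simp
    moreover have "(\<forall>c<nc. \<forall>c'<nc. LO v c \<le> l + HI v c') \<longleftrightarrow> (\<forall>c'<nc. MX v - l \<le> HI v c')"
    proof
      assume l: "\<forall>c<nc. \<forall>c'<nc. LO v c \<le> l + HI v c'"
      have "MX v \<le> l + HI v c'" if "c' < nc" for c'
        using l[rule_format, OF c0(1) that] c0(2) by simp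
      then show "\<forall>c'<nc. MX v - l \<le> HI v c'" by (simp add: le_diff_conv add.commute)
    next
      assume r: "\<forall>c'<nc. MX v - l \<le> HI v c'"
      show "\<forall>c<nc. \<forall>c'<nc. LO v c \<le> l + HI v c'"
      proof (intro allI impI)
        fix c c' assume "c < nc" "c' < nc"
        then have "LO v c \<le> MX v" "MX v - l \<le> HI v c'" using mx(1) r by auto
        then show "LO v c \<le> l + HI v c'" by linarith
      qed
    qed
    moreover have "?C = {..<nc} \<longleftrightarrow> (\<forall>c'<nc. MX v - l \<le> HI v c')" by auto
    ultimately show ?thesis using False by auto
  qed
qed

section \<open>Accumulator updates and the fairness test as programs\<close>

definition push_high :: ac where
  "push_high = SetR 23 (Op Add (Arr 10 (Var 20) (Var 21)) (Num 1)) ;;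
     Put 10 (Var 20) (Var 21) (Var 23) ;;
     Put 11 (Var 20) (Var 23) (Op Add (Arr 11 (Var 20) (Var 23)) (Num 1)) ;;
     Put 15 (Var 17) (Num 0) (Var 20) ;; Put 16 (Var 17) (Num 0) (Var 21) ;;
     Put 17 (Var 17) (Num 0) (Var 23) ;; inc 17"

definition push_low :: ac where
  "push_low = SetR 23 (Op Add (Arr 9 (Var 20) (Var 21)) (Num 1)) ;; Put 9 (Var 20) (Var 21) (Var 23) ;;
     Cond (Op Less (Arr1 12 (Var 20)) (Var 23)) (Put 12 (Var 20) (Num 0) (Var 23)) Nop"

text \<open>Register 22 tells whether the lower count rises too: a vertex certain to be matched to
  \<open>v\<close> raises both counts, one that merely may be raises only \<open>HI\<close>.\<close>

definition push :: ac where
  "push = push_high ;; Cond (Var 22) push_low Nop"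

text \<open>The threshold is subtracted from the maximum, with cut-off at 0, instead of being added
  to the minimum; a threshold of any size is thus harmless.\<close>

definition fair_test :: "nat \<Rightarrow> ac" where
  "fair_test r = SetR 23 (Op Sub (Arr1 12 (Var 20)) (Arr 0 (Num 0) (Op Add (Num 4) (Var 20)))) ;;
     Cond (Var 23) (SetR r (Op Equal (Arr 11 (Var 20) (Var 23)) (Var 4))) (SetR r (Num 1))"

lemma push_writes: "mreg push = {17, 23}" "marr push = {9, 10, 11, 12, 15, 16, 17}"
  by (auto simp: push_def push_high_def push_low_def inc_def)

context words begin

definition acc_ok :: "ast \<Rightarrow> bool" where
  "acc_ok s \<longleftrightarrow> acc n nc M (ar s 9) (ar s 10) (ar s 11) (\<lambda>v. ar s 12 v 0)
     (\<lambda>i. ar s 15 i 0) (\<lambda>i. ar s 16 i 0) (\<lambda>i. ar s 17 i 0) (rg s 17)"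

lemma acc_okI:
  assumes "acc n nc M LO HI NUM MX LV LC LH len"
    and "ar s 9 = LO" "ar s 10 = HI" "ar s 11 = NUM" "(\<lambda>v. ar s 12 v 0) = MX"
    "(\<lambda>i. ar s 15 i 0) = LV" "(\<lambda>i. ar s 16 i 0) = LC" "(\<lambda>i. ar s 17 i 0) = LH" "rg s 17 = len"
  shows "acc_ok s"
  using assms unfolding acc_ok_def by simp

lemma acc_ok_upd_reg: "r \<noteq> 17 \<Longrightarrow> acc_ok (upd_reg s r x) \<longleftrightarrow> acc_ok s"
  by (simp add: acc_ok_def)

lemma acc_ok_frame:
  assumes "acc_ok s" "frame P s s'" "17 \<notin> mreg P" "{9, 10, 11, 12, 15, 16, 17} \<inter> marr P = {}"
  shows "acc_ok s'"
  using assms unfolding acc_ok_def frame_def by simp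

lemma acc_ok_bounds:
  assumes "acc_ok s"
  shows "ar s 9 v c \<le> rg s 17" "ar s 10 v c \<le> rg s 17" "ar s 11 v k \<le> rg s 17"
    "v < n \<Longrightarrow> ar s 12 v 0 \<le> rg s 17" "ar s 9 v c \<le> ar s 10 v c"
proof -
  have le: "ar s 9 v c \<le> ar s 10 v c \<and> ar s 10 v c \<le> rg s 17" for v c
    using accD(1,2)[OF assms[unfolded acc_ok_def]] by blast
  then show 1: "ar s 9 v c \<le> rg s 17" for v c using order_trans by blast
  show "ar s 10 v c \<le> rg s 17" "ar s 11 v k \<le> rg s 17" "ar s 9 v c \<le> ar s 10 v c"
    using accD(1-3)[OF assms[unfolded acc_ok_def]] by blast+
  show "ar s 12 v 0 \<le> rg s 17" if v: "v < n"
  proof (cases "ar s 12 v 0 = 0")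
    case False
    then obtain c where "ar s 9 v c = ar s 12 v 0" using accD(8)[OF assms[unfolded acc_ok_def] v] by auto
    then show ?thesis using 1[of v c] by simp
  qed simp
qed

definition bump :: "(nat \<Rightarrow> nat \<Rightarrow> nat) \<Rightarrow> nat \<Rightarrow> nat \<Rightarrow> nat \<Rightarrow> nat \<Rightarrow> nat" where
  "bump F v c = F(v := (F v)(c := Suc (F v c)))"

lemma bump_apply: "bump F v c v' c' = F v' c' + (if v' = v \<and> c' = c then 1 else 0)"
  by (simp add: bump_def)

lemma wp_push_high:
  assumes acc: "acc_ok s" and r: "rg s 20 = v" "rg s 21 = c" "v < n" "c < nc" "Suc (rg s 17) < M"
    and Q: "\<And>s'. acc_ok s' \<Longrightarrow> rg s' 17 = Suc (rg s 17) \<Longrightarrow> ar s' 9 = ar s 9 \<Longrightarrow>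
      ar s' 10 = bump (ar s 10) v c \<Longrightarrow> frame push_high s s' \<Longrightarrow> Q s'"
  shows "wp M push_high Q s"
proof -
  define R where "R s' \<longleftrightarrow> acc_ok s' \<and> rg s' 17 = Suc (rg s 17) \<and> ar s' 9 = ar s 9 \<and>
      ar s' 10 = bump (ar s 10) v c" for s'
  define h where "h = Suc (ar s 10 v c)"
  define s' where "s' = upd_reg (upd_arr (upd_arr (upd_arr (upd_arr (upd_arr (upd_reg s 23 h) 10 v c h)
      11 v h (Suc (ar s 11 v h))) 15 (rg s 17) 0 v) 16 (rg s 17) 0 c) 17 (rg s 17) 0 h) 17 (Suc (rg s 17))"
  have "acc_ok s'"
    by (rule acc_okI[OF acc_push_high[OF acc[unfolded acc_ok_def] r(3-5)]])
      (simp_all add: s'_def h_def, simp_all add: fun_eq_iff)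
  then have "R s'" by (simp add: R_def s'_def bump_def h_def)
  moreover have "ar s 10 v c \<le> rg s 17" "ar s 11 v h \<le> rg s 17" using acc_ok_bounds[OF acc] by blast+
  moreover have "v < M" "c < M" using r M by auto
  ultimately have "wp M push_high R s"
    using r unfolding push_high_def inc_def s'_def h_def by simp
  from wp_frame[OF this] show ?thesis by (rule wp_mono) (use Q in \<open>auto simp: R_def\<close>)
qed

lemma wp_push_low:
  assumes acc: "acc_ok s" and r: "rg s 20 = v" "rg s 21 = c" "v < n" "c < nc" "rg s 17 < M"
    "ar s 9 v c < ar s 10 v c"
    and Q: "\<And>s'. acc_ok s' \<Longrightarrow> ar s' 9 = bump (ar s 9) v c \<Longrightarrow> frame push_low s s' \<Longrightarrow> Q s'"
  shows "wp M push_low Q s"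
proof -
  define R where "R s' \<longleftrightarrow> acc_ok s' \<and> ar s' 9 = bump (ar s 9) v c" for s'
  define h where "h = Suc (ar s 9 v c)"
  define s1 where "s1 = upd_arr (upd_reg s 23 h) 9 v c h"
  define s2 where "s2 = upd_arr s1 12 v 0 h"
  note push = acc_push_low[OF acc[unfolded acc_ok_def] r(3,4,6)]
  have "acc_ok s1" if "\<not> ar s 12 v 0 < h"
    by (rule acc_okI[OF push]) (use that in \<open>simp_all add: s1_def h_def fun_eq_iff\<close>)
  then have 1: "R s1" if "\<not> ar s 12 v 0 < h" using that by (simp add: R_def s1_def bump_def h_def)
  have "acc_ok s2" if "ar s 12 v 0 < h"
    by (rule acc_okI[OF push]) (use that in \<open>simp_all add: s2_def s1_def h_def fun_eq_iff\<close>)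
  then have 2: "R s2" if "ar s 12 v 0 < h" using that by (simp add: R_def s2_def s1_def bump_def h_def)
  have "ar s 10 v c \<le> rg s 17" using acc_ok_bounds[OF acc] by blast
  moreover have "v < M" "c < M" using r M by auto
  ultimately have "wp M push_low R s"
    using r 1 2 unfolding push_low_def s2_def s1_def h_def by simp
  from wp_frame[OF this] show ?thesis by (rule wp_mono) (use Q in \<open>auto simp: R_def\<close>)
qed

lemma wp_push:
  assumes acc: "acc_ok s" and r: "rg s 20 = v" "rg s 21 = c" "v < n" "c < nc" "Suc (rg s 17) < M"
    and Q: "\<And>s'. acc_ok s' \<Longrightarrow> rg s' 17 = Suc (rg s 17) \<Longrightarrow>
      ar s' 9 = (if rg s 22 \<noteq> 0 then bump (ar s 9) v c else ar s 9) \<Longrightarrow>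
      ar s' 10 = bump (ar s 10) v c \<Longrightarrow> frame push s s' \<Longrightarrow> Q s'"
  shows "wp M push Q s"
proof -
  define R where "R s' \<longleftrightarrow> acc_ok s' \<and> rg s' 17 = Suc (rg s 17) \<and>
      ar s' 9 = (if rg s 22 \<noteq> 0 then bump (ar s 9) v c else ar s 9) \<and> ar s' 10 = bump (ar s 10) v c" for s'
  have "wp M push R s"
    unfolding push_def wp.simps(4)
  proof (rule wp_push_high[OF acc r])
    fix s1 assume 1: "acc_ok s1" "rg s1 17 = Suc (rg s 17)" "ar s1 9 = ar s 9"
      "ar s1 10 = bump (ar s 10) v c" "frame push_high s s1"
    have r1: "rg s1 20 = v" "rg s1 21 = c" "rg s1 22 = rg s 22"
      using 1(5) r by (simp_all add: frame_def push_high_def inc_def)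
    show "wp M (Cond (Var 22) push_low Nop) R s1"
    proof (cases "rg s 22 = 0")
      case True
      then show ?thesis using 1 r1 by (simp add: R_def)
    next
      case False
      have "wp M push_low R s1"
      proof (rule wp_push_low[OF 1(1) r1(1,2) r(3,4)])
        show "ar s1 9 v c < ar s1 10 v c"
          using acc_ok_bounds(5)[OF acc, of v c] 1 by (simp add: bump_apply)
        show "rg s1 17 < M" using 1 r by simp
      next
        fix s2 assume 2: "acc_ok s2" "ar s2 9 = bump (ar s1 9) v c" "frame push_low s1 s2"
        then have "rg s2 17 = rg s1 17" "ar s2 10 = ar s1 10" by (simp_all add: frame_def push_low_def)
        then show "R s2" using 1 2 False by (simp add: R_def)
      qed
      then show ?thesis using False r1 by simp
    qed
  qed
  from wp_frame[OF this] show ?thesis by (rule wp_mono) (use Q in \<open>auto simp: R_def\<close>)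
qed

lemma wp_fair_test:
  assumes acc: "acc_ok s" and base: "base s" and r: "rg s 20 = v" "v < n" "rg s 17 < M" "r \<noteq> 1" "r \<noteq> 23"
    and Q: "\<And>s'. rg s' r = of_bool (\<forall>c<nc. \<forall>c'<nc. ar s 9 v c \<le> th v + ar s 10 v c') \<Longrightarrow>
      frame (fair_test r) s s' \<Longrightarrow> Q s'"
  shows "wp M (fair_test r) Q s"
proof -
  define R where "R s' \<longleftrightarrow> rg s' r = of_bool (\<forall>c<nc. \<forall>c'<nc. ar s 9 v c \<le> th v + ar s 10 v c')" for s' :: ast
  define k where "k = ar s 12 v 0 - th v"
  have "(\<forall>c<nc. \<forall>c'<nc. ar s 9 v c \<le> th v + ar s 10 v c') \<longleftrightarrow> k = 0 \<or> ar s 11 v k = nc"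
    using acc_fair[OF acc[unfolded acc_ok_def] r(2), of "th v"] by (simp add: k_def)
  then have R: "R s' \<longleftrightarrow> rg s' r = of_bool (k = 0 \<or> ar s 11 v k = nc)" for s' by (simp only: R_def)
  have "k \<le> rg s 17" using acc_ok_bounds(4)[OF acc r(2)] by (simp add: k_def)
  then have km: "k < M" "v + 4 < M" using r M by auto
  have th: "ar s 0 0 (4 + v) = th v" "rg s 4 = nc" using base by (simp_all add: base_def th_def)
  have "wp M (fair_test r) R s"
    using km r th unfolding fair_test_def R by (simp add: k_def[symmetric])
  from wp_frame[OF this] show ?thesis by (rule wp_mono) (use Q in \<open>auto simp: R_def\<close>)
qed

end

section \<open>Testing one choice of non-tree edges\<close>

definition clear_log_body :: ac where
  "clear_log_body = SetR 20 (Arr1 15 (Var 7)) ;; SetR 21 (Arr1 16 (Var 7)) ;; SetR 23 (Arr1 17 (Var 7)) ;;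
     Put 9 (Var 20) (Var 21) (Num 0) ;; Put 10 (Var 20) (Var 21) (Num 0) ;; Put 11 (Var 20) (Var 23) (Num 0)"

definition clear_vertex_body :: ac where
  "clear_vertex_body = Put 12 (Var 7) (Num 0) (Num 0) ;; Put 13 (Var 7) (Num 0) (Num 0) ;;
     Put 14 (Var 7) (Num 0) (Num 0)"

definition clear_prog :: ac where
  "clear_prog = For 7 17 clear_log_body ;; For 7 3 clear_vertex_body ;; SetR 17 (Num 0) ;; SetR 18 (Num 0)"

definition assign_body :: ac where
  "assign_body = Cond (Arr1 8 (Var 7))
     (SetR 20 (Arr 7 (Var 7) (Op Sub (Arr1 8 (Var 7)) (Num 1))) ;;
      SetR 21 (Arr 0 (Num 0) (Op Add (Num 4) (Var 7))) ;; SetR 22 (Num 1) ;; push) Nop"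

definition left_bits :: ac where
  "left_bits = Cond (Arr1 8 (Var 26))
     (SetR 25 (Num 0) ;; SetR 24 (Op Equal (Arr1 14 (Var 26)) (Num 0)))
     (SetR 25 (Op Mul (Op Equal (Arr1 14 (Var 26)) (Num 0)) (Op Less (Num 0) (Arr1 4 (Var 26)))) ;;
      SetR 24 (Op Less (Num 0) (Op Add
        (Op Mul (Op Equal (Arr1 14 (Var 26)) (Num 0)) (Op Less (Num 0) (Arr1 13 (Var 26))))
        (Op Equal (Arr1 14 (Var 26)) (Num 1)))))"

definition store_bits :: ac where
  "store_bits = Put 18 (Var 26) (Num 0) (Var 24) ;; Put 19 (Var 26) (Num 0) (Var 25)"

definition left_prog :: ac where
  "left_prog = left_bits ;; store_bits ;;
     Cond (Var 25)
       (SetR 20 (Op Sub (Arr1 4 (Var 26)) (Num 1)) ;; SetR 21 (Arr 0 (Num 0) (Op Add (Num 4) (Var 26))) ;;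
        SetR 22 (Op Sub (Num 1) (Var 24)) ;; push)
       (Cond (Var 24) Nop (SetR 18 (Num 1)))"

text \<open>Tries the edge to the parent: the parent's color is pushed into the row of the vertex
  itself, and the fairness test is repeated on the changed row.\<close>

definition right_up :: ac where
  "right_up = SetR 28 (Op Sub (Arr1 4 (Var 26)) (Num 1)) ;;
     SetR 21 (Arr 0 (Num 0) (Op Add (Num 4) (Var 28))) ;; SetR 22 (Num 1) ;; push ;; fair_test 25 ;;
     Put 13 (Var 28) (Num 0) (Op Add (Arr1 13 (Var 28)) (Var 25)) ;;
     Put 14 (Var 28) (Num 0) (Op Add (Arr1 14 (Var 28)) (Op Sub (Num 1) (Var 24)))"

definition right_prog :: ac where
  "right_prog = SetR 20 (Var 26) ;; fair_test 24 ;;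
     Cond (Arr1 4 (Var 26)) right_up (SetR 25 (Num 0)) ;;
     store_bits ;; Cond (Op Add (Var 24) (Var 25)) Nop (SetR 18 (Num 1))"

definition dp_body :: ac where
  "dp_body = SetR 26 (Arr1 5 (Op Sub (Op Sub (Var 3) (Num 1)) (Var 7))) ;;
     Cond (Op Less (Var 26) (Var 2)) left_prog right_prog"

definition test_prog :: ac where
  "test_prog = clear_prog ;; For 7 2 assign_body ;; For 7 3 dp_body"

text \<open>The factor 2 stems from the log, which holds at most \<open>2 * n\<close>
  entries.\<close>

definition test_cost :: nat where
  "test_cost = (cost clear_log_body + 8) * 2 + (cost clear_vertex_body + 8) + (cost assign_body + 8) + (cost dp_body + 8)"

lemma fair_test_writes [simp]: "mreg (fair_test r) = {23, r}" "marr (fair_test r) = {}"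
  by (auto simp: fair_test_def)

lemmas test_defs = clear_prog_def clear_log_body_def clear_vertex_body_def assign_body_def left_bits_def
  store_bits_def left_prog_def right_up_def right_prog_def dp_body_def test_prog_def

lemma test_writes:
  "mreg clear_log_body = {20, 21, 23}" "marr clear_log_body = {9, 10, 11}"
  "mreg clear_vertex_body = {}" "marr clear_vertex_body = {12, 13, 14}"
  "mreg assign_body = {17, 20, 21, 22, 23}" "marr assign_body = {9, 10, 11, 12, 15, 16, 17}"
  "mreg dp_body = {17, 18, 20, 21, 22, 23, 24, 25, 26, 28}"
  "marr dp_body = {9, 10, 11, 12, 13, 14, 15, 16, 17, 18, 19}"
  by (auto simp: test_defs push_writes)

section \<open>One test: correctness and linear time\<close>

locale choice = forest +
  fixes d :: "nat \<Rightarrow> nat"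
  assumes digit: "\<And>u. u < nu \<Longrightarrow> d u < rad u"
begin

definition tg :: "nat \<Rightarrow> nat" where
  "tg u = nt u ! (d u - 1)"

sublocale g: rooted_guess nu n nc col th pa rk tg "\<lambda>u. d u \<noteq> 0"
  by (rule rooted)

lemma good_iff: "good d \<longleftrightarrow> (\<exists>\<sigma>. g.follows \<sigma> \<and> g.fair \<sigma>)"
  by (simp add: good_def follows_def fair_def tg_def[abs_def])

definition static :: "ast \<Rightarrow> bool" where
  "static s \<longleftrightarrow> base s \<and> (\<forall>x. ar s 4 x 0 = pa x) \<and> (\<forall>p. ar s 5 p 0 = ord p) \<and>
     row s 6 7 = nt \<and> (\<forall>u<nu. ar s 8 u 0 = d u)"

lemma static_frame:
  assumes "static s" "frame P s s'" "{2, 3, 4, 5, 6} \<inter> mreg P = {}" "{0, 4, 5, 6, 7, 8} \<inter> marr P = {}"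
  shows "static s'"
proof -
  have "base s'" using assms by (intro base_frame[OF _ assms(2)]) (auto simp: static_def)
  moreover have "ar s' 4 = ar s 4" "ar s' 5 = ar s 5" "ar s' 8 = ar s 8" "row s' 6 7 = row s 6 7"
    using assms(2,4) by (auto simp: frame_def intro!: row_frame)
  ultimately show ?thesis using assms(1) by (simp add: static_def)
qed

lemma static_base: "static s \<Longrightarrow> base s"
  by (simp add: static_def)

lemma static_upd_reg: "static s \<Longrightarrow> r \<notin> {2, 3, 4, 5, 6} \<Longrightarrow> static (upd_reg s r v)"
  by (simp add: static_def base_def)

text \<open>Every nonzero \<open>HI\<close> or \<open>NUM\<close> cell is logged at position
  \<open>i\<close> or later, so after the last entry all are zero. A cell may be logged repeatedly;
  clearing it early does no harm.\<close>

definition log_inv :: "nat \<Rightarrow> ast \<Rightarrow> bool" where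
  "log_inv i s \<longleftrightarrow> (\<forall>v c. ar s 9 v c \<le> ar s 10 v c) \<and>
     (\<forall>v c. ar s 10 v c \<noteq> 0 \<longrightarrow> (\<exists>k<rg s 17. i \<le> k \<and> ar s 15 k 0 = v \<and> ar s 16 k 0 = c)) \<and>
     (\<forall>v h. ar s 11 v h \<noteq> 0 \<longrightarrow> (\<exists>k<rg s 17. i \<le> k \<and> ar s 15 k 0 = v \<and> ar s 17 k 0 = h)) \<and>
     (\<forall>k<rg s 17. ar s 15 k 0 < n \<and> ar s 16 k 0 < nc \<and> ar s 17 k 0 < M)"

lemma log_inv_start: "acc_ok s \<Longrightarrow> log_inv 0 s"
  unfolding log_inv_def acc_ok_def by (auto dest: accD)

lemma clear_log_step:
  assumes inv: "log_inv i s" and i: "rg s 7 = i" "i < rg s 17" "rg s 17 < M"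
  shows "wp M clear_log_body (\<lambda>s'. log_inv (Suc i) (upd_reg s' 7 (Suc i))) s"
proof -
  define v where "v = ar s 15 i 0"
  define c where "c = ar s 16 i 0"
  define h where "h = ar s 17 i 0"
  define s' where "s' = upd_arr (upd_arr (upd_arr (upd_reg (upd_reg (upd_reg s 20 v) 21 c) 23 h) 9 v c 0) 10 v c 0) 11 v h 0"
  have b: "v < n" "c < nc" "h < M" using inv i(2) by (auto simp: log_inv_def v_def c_def h_def)
  have f: "rg s' 17 = rg s 17" "ar s' 15 = ar s 15" "ar s' 16 = ar s 16" "ar s' 17 = ar s 17"
    "ar s' 9 v' c' = (if v' = v \<and> c' = c then 0 else ar s 9 v' c')"
    "ar s' 10 v' c' = (if v' = v \<and> c' = c then 0 else ar s 10 v' c')"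
    "ar s' 11 v' h' = (if v' = v \<and> h' = h then 0 else ar s 11 v' h')" for v' c' h'
    by (simp_all add: s'_def)
  have le: "ar s 9 v' c' \<le> ar s 10 v' c'" for v' c' using inv by (simp add: log_inv_def)
  have 1: "ar s' 9 v' c' \<le> ar s' 10 v' c'" for v' c' using le[of v' c'] by (simp add: f)
  have 2: "\<exists>k<rg s 17. Suc i \<le> k \<and> ar s 15 k 0 = v' \<and> ar s 16 k 0 = c'" if "ar s' 10 v' c' \<noteq> 0" for v' c'
  proof -
    have nz: "ar s 10 v' c' \<noteq> 0" "\<not> (v' = v \<and> c' = c)" using that by (auto simp: f split: if_splits)
    then obtain k where k: "k < rg s 17" "i \<le> k" "ar s 15 k 0 = v'" "ar s 16 k 0 = c'"
      using inv unfolding log_inv_def by blast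
    then have "k \<noteq> i" using nz(2) by (auto simp: v_def c_def)
    then show ?thesis using k by (intro exI[of _ k]) simp
  qed
  have 3: "\<exists>k<rg s 17. Suc i \<le> k \<and> ar s 15 k 0 = v' \<and> ar s 17 k 0 = h'" if "ar s' 11 v' h' \<noteq> 0" for v' h'
  proof -
    have nz: "ar s 11 v' h' \<noteq> 0" "\<not> (v' = v \<and> h' = h)" using that by (auto simp: f split: if_splits)
    then obtain k where k: "k < rg s 17" "i \<le> k" "ar s 15 k 0 = v'" "ar s 17 k 0 = h'"
      using inv unfolding log_inv_def by blast
    then have "k \<noteq> i" using nz(2) by (auto simp: v_def h_def)
    then show ?thesis using k by (intro exI[of _ k]) simp
  qed
  have 4: "\<forall>k<rg s 17. ar s 15 k 0 < n \<and> ar s 16 k 0 < nc \<and> ar s 17 k 0 < M"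
    using inv by (simp add: log_inv_def)
  have post: "log_inv (Suc i) (upd_reg s' 7 (Suc i))"
    unfolding log_inv_def using 1 2 3 4 by (simp add: f(1-4))
  define R where "R s1 \<longleftrightarrow> log_inv (Suc i) (upd_reg s1 7 (Suc i))" for s1
  have "R s'" using post by (simp add: R_def)
  moreover have "v < M" "c < M" using b M by auto
  ultimately have "wp M clear_log_body R s"
    using i b unfolding clear_log_body_def s'_def v_def c_def h_def by simp
  then show ?thesis by (simp only: R_def[abs_def])
qed

definition clean :: "ast \<Rightarrow> bool" where
  "clean s \<longleftrightarrow> acc_ok s \<and> (\<forall>v c. ar s 9 v c = 0) \<and> (\<forall>v c. ar s 10 v c = 0) \<and>
     (\<forall>x<n. ar s 13 x 0 = 0 \<and> ar s 14 x 0 = 0) \<and> rg s 17 = 0 \<and> rg s 18 = 0"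

lemma clear_tri:
  assumes st: "static s" and acc: "acc_ok s" and len: "rg s 17 \<le> 2 * n"
  shows "tri M clear_prog s ((cost clear_log_body + 8) * (2 * n) + (cost clear_vertex_body + 8) * n + 16) clean"
proof -
  have base: "base s" by (rule static_base[OF st])
  have 1: "tri M (For 7 17 clear_log_body) s ((cost clear_log_body + 8) * rg s 17 + 6) (log_inv (rg s 17))"
  proof (rule tri_for)
    show "log_inv 0 (upd_reg s 7 0)" using log_inv_start[OF acc] by (simp add: log_inv_def)
  next
    fix i s' assume i: "i < rg s 17" "log_inv i s'" "rg s' 7 = i" and f: "frame (For 7 17 clear_log_body) s s'"
    have "rg s' 17 = rg s 17" using f by (simp add: frame_def test_writes)
    with clear_log_step[OF i(2,3)] i(1) len M
    show "tri M clear_log_body s' (cost clear_log_body) (\<lambda>s''. log_inv (Suc i) (upd_reg s'' 7 (Suc i)))"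
      by (intro tri_wp) simp
  qed (use len M in \<open>auto simp: test_writes\<close>)
  define vinv where "vinv i s \<longleftrightarrow> (\<forall>x<i. ar s 12 x 0 = 0 \<and> ar s 13 x 0 = 0 \<and> ar s 14 x 0 = 0)" for i and s :: ast
  have 2: "tri M (For 7 3 clear_vertex_body) s1 ((cost clear_vertex_body + 8) * n + 6) (vinv n)"
    if "base s1" for s1
  proof (rule tri_for)
    show "vinv 0 (upd_reg s1 7 0)" by (simp add: vinv_def)
  next
    fix i s' assume i: "i < n" "vinv i s'" "rg s' 7 = i"
    have "wp M clear_vertex_body (\<lambda>s''. vinv (Suc i) (upd_reg s'' 7 (Suc i))) s'"
      using i M by (simp add: clear_vertex_body_def vinv_def less_Suc_eq)
    then show "tri M clear_vertex_body s' (cost clear_vertex_body) (\<lambda>s''. vinv (Suc i) (upd_reg s'' 7 (Suc i)))"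
      by (rule tri_wp)
  qed (use that M in \<open>auto simp: test_writes base_def\<close>)
  have "(cost clear_log_body + 8) * rg s 17 \<le> (cost clear_log_body + 8) * (2 * n)"
    using len by (rule mult_le_mono2)
  then have 1: "tri M (For 7 17 clear_log_body) s ((cost clear_log_body + 8) * (2 * n) + 6) (log_inv (rg s 17))"
    using 1 by (elim tri_mono) simp_all
  show ?thesis unfolding clear_prog_def
  proof (rule tri_seq[OF 1])
    fix s1 assume l: "log_inv (rg s 17) s1" and f1: "frame (For 7 17 clear_log_body) s s1"
    have base1: "base s1" by (rule base_frame[OF base f1]) (auto simp: test_writes)
    have len1: "rg s1 17 = rg s 17" using f1 by (simp add: frame_def test_writes)
    have h0: "ar s1 10 v c = 0" for v c
    proof (rule ccontr)
      assume "ar s1 10 v c \<noteq> 0"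
      then obtain k where "k < rg s1 17" "rg s 17 \<le> k" using l unfolding log_inv_def by blast
      then show False using len1 by simp
    qed
    have n0: "ar s1 11 v c = 0" for v c
    proof (rule ccontr)
      assume "ar s1 11 v c \<noteq> 0"
      then obtain k where "k < rg s1 17" "rg s 17 \<le> k" using l unfolding log_inv_def by blast
      then show False using len1 by simp
    qed
    have l0: "ar s1 9 v c = 0" for v c
    proof -
      have "ar s1 9 v c \<le> ar s1 10 v c" using l by (simp add: log_inv_def)
      then show ?thesis by (simp add: h0)
    qed
    show "tri M (For 7 3 clear_vertex_body ;; SetR 17 (Num 0) ;; SetR 18 (Num 0)) s1
        ((cost clear_vertex_body + 8) * n + 6 + 4) clean"
    proof (rule tri_seq[OF 2[OF base1]])
      fix s2 assume v: "vinv n s2" and f2: "frame (For 7 3 clear_vertex_body) s1 s2"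
      have a: "ar s2 9 = ar s1 9" "ar s2 10 = ar s1 10" "ar s2 11 = ar s1 11"
        using f2 by (simp_all add: frame_def test_writes)
      let ?s = "upd_reg (upd_reg s2 17 0) 18 0"
      have "acc n nc M (ar s2 9) (ar s2 10) (ar s2 11) (\<lambda>v. ar s2 12 v 0)
          (\<lambda>i. ar s2 15 i 0) (\<lambda>i. ar s2 16 i 0) (\<lambda>i. ar s2 17 i 0) 0"
        using v by (intro acc_start) (simp_all add: a l0 h0 n0 vinv_def)
      then have "acc_ok ?s" by (simp add: acc_ok_def)
      then have "clean ?s" using v by (simp add: clean_def a l0 h0 vinv_def)
      then have "wp M (SetR 17 (Num 0) ;; SetR 18 (Num 0)) clean s2" using M by simp
      then show "tri M (SetR 17 (Num 0) ;; SetR 18 (Num 0)) s2 4 clean"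
        by (intro tri_mono[OF tri_wp]) simp_all
    qed simp
  qed simp
qed

definition assigned :: "nat \<Rightarrow> nat \<Rightarrow> nat \<Rightarrow> nat" where
  "assigned i v c = card {u. u < i \<and> d u \<noteq> 0 \<and> tg u = v \<and> col u = c}"

lemma assigned_Suc: "assigned (Suc i) v c = assigned i v c + (if d i \<noteq> 0 \<and> tg i = v \<and> col i = c then 1 else 0)"
proof (cases "d i \<noteq> 0 \<and> tg i = v \<and> col i = c")
  case True
  then have "{u. u < Suc i \<and> d u \<noteq> 0 \<and> tg u = v \<and> col u = c} =
      insert i {u. u < i \<and> d u \<noteq> 0 \<and> tg u = v \<and> col u = c}" by auto
  then show ?thesis using True by (simp add: assigned_def)
next
  case False
  then have "{u. u < Suc i \<and> d u \<noteq> 0 \<and> tg u = v \<and> col u = c} =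
      {u. u < i \<and> d u \<noteq> 0 \<and> tg u = v \<and> col u = c}" by (auto simp: less_Suc_eq)
  then show ?thesis using False by (auto simp: assigned_def)
qed

definition assign_inv :: "nat \<Rightarrow> ast \<Rightarrow> bool" where
  "assign_inv i s \<longleftrightarrow> acc_ok s \<and> rg s 17 \<le> i \<and>
     (\<forall>v c. ar s 9 v c = assigned i v c \<and> ar s 10 v c = assigned i v c)"

lemma assign_inv_upd: "assign_inv i (upd_reg s 7 k) = assign_inv i s"
  by (simp add: assign_inv_def acc_ok_upd_reg)

lemma target:
  assumes "u < nu" "d u \<noteq> 0"
  shows "d u - 1 < length (nt u)" "nu \<le> tg u" "tg u < n"
proof -
  show 1: "d u - 1 < length (nt u)" using digit[OF assms(1)] assms(2) by (simp add: rad_def)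
  then have "tg u \<in> set (nt u)" unfolding tg_def by (rule nth_mem)
  then show "nu \<le> tg u" "tg u < n" unfolding nt_set[OF assms(1)] using ev_less by auto
qed

lemma assign_step:
  assumes st: "static s" and i: "rg s 7 = i" "i < nu" and inv: "assign_inv i s"
  shows "wp M assign_body (assign_inv (Suc i)) s"
proof -
  have d: "ar s 8 i 0 = d i" using st i by (simp add: static_def)
  have iM: "i + 4 < M" "i < M" using i nu_le M by auto
  show ?thesis
  proof (cases "d i = 0")
    case True
    then have "assign_inv (Suc i) s" using inv by (simp add: assign_inv_def assigned_Suc)
    then show ?thesis using d True iM i by (simp add: assign_body_def)
  next
    case False
    note t = target[OF i(2) False]
    have nt: "ar s 7 i (d i - 1) = tg i"
    proof -
      have r: "row s 6 7 i = nt i" using st by (simp add: static_def)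
      have "ar s 6 i 0 = length (nt i)" using r length_row by metis
      then show ?thesis using row_nth[of "d i - 1" s 6 i 7] t(1) r by (simp add: tg_def)
    qed
    have c: "ar s 0 0 (4 + i) = col i" using st by (simp add: static_def base_def col_def)
    have dM: "d i < M" using digit[OF i(2)] length_nt_le[OF i(2)] M by (simp add: rad_def)
    have colc: "col i < nc" using cols[OF i(2)] by (simp add: col_def)
    have len: "Suc (rg s 17) < M" using inv i nu_le M_ge by (simp add: assign_inv_def)
    have push: "wp M push (assign_inv (Suc i)) (upd_reg (upd_reg (upd_reg s 20 (tg i)) 21 (col i)) 22 1)"
    proof (rule wp_push)
      show "acc_ok (upd_reg (upd_reg (upd_reg s 20 (tg i)) 21 (col i)) 22 1)"
        using inv by (simp add: assign_inv_def acc_ok_def)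
    next
      fix s' assume s': "acc_ok s'" "rg s' 17 = Suc (rg (upd_reg (upd_reg (upd_reg s 20 (tg i)) 21 (col i)) 22 1) 17)"
        "ar s' 9 = (if rg (upd_reg (upd_reg (upd_reg s 20 (tg i)) 21 (col i)) 22 1) 22 \<noteq> 0
          then bump (ar (upd_reg (upd_reg (upd_reg s 20 (tg i)) 21 (col i)) 22 1) 9) (tg i) (col i)
          else ar (upd_reg (upd_reg (upd_reg s 20 (tg i)) 21 (col i)) 22 1) 9)"
        "ar s' 10 = bump (ar (upd_reg (upd_reg (upd_reg s 20 (tg i)) 21 (col i)) 22 1) 10) (tg i) (col i)"
      then show "assign_inv (Suc i) s'"
        using inv False by (auto simp: assign_inv_def bump_apply assigned_Suc)
    qed (use t colc len in simp_all)
    have "d i - Suc 0 < M" using dM by linarith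
    then show ?thesis using d False iM i push nt c dM by (simp add: assign_body_def)
  qed
qed

lemma assign_tri:
  assumes st: "static s" and "clean s"
  shows "tri M (For 7 2 assign_body) s ((cost assign_body + 8) * nu + 6) (assign_inv nu)"
proof (rule tri_for)
  show "assign_inv 0 (upd_reg s 7 0)"
    unfolding assign_inv_upd using assms(2) by (simp add: assign_inv_def clean_def assigned_def)
next
  fix i s' assume i: "i < nu" "assign_inv i s'" "rg s' 7 = i" and f: "frame (For 7 2 assign_body) s s'"
  have "static s'" by (rule static_frame[OF st f]) (auto simp: test_writes)
  from assign_step[OF this i(3,1,2)]
  show "tri M assign_body s' (cost assign_body) (\<lambda>s''. assign_inv (Suc i) (upd_reg s'' 7 (Suc i)))"
    unfolding assign_inv_upd by (rule tri_wp)
qed (use st nu_le M in \<open>auto simp: static_def base_def test_writes\<close>)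

text \<open>Ranks run from 0 to \<open>n - 1\<close>, so these are the last \<open>i\<close>
  vertices of the queue.\<close>

definition evaluated :: "nat \<Rightarrow> nat set" where
  "evaluated i = {x. x < n \<and> n \<le> i + rk x}"

text \<open>The guessed edges put at most \<open>nu\<close> entries into the log, and every
  evaluated vertex adds at most one. Register 18 is the failure flag.\<close>

definition dp_inv :: "nat \<Rightarrow> ast \<Rightarrow> bool" where
  "dp_inv i s \<longleftrightarrow> acc_ok s \<and> rg s 17 \<le> nu + i \<and>
     g.dp (evaluated i) (ar s 9) (ar s 10) (\<lambda>u. ar s 13 u 0) (\<lambda>u. ar s 14 u 0)
       (\<lambda>x. ar s 18 x 0 \<noteq> 0) (\<lambda>x. ar s 19 x 0 \<noteq> 0) \<and>
     (rg s 18 = 0 \<longleftrightarrow> (\<forall>x \<in> evaluated i. ar s 18 x 0 \<noteq> 0 \<or> ar s 19 x 0 \<noteq> 0))"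

lemma dp_inv_upd: "r \<notin> {17, 18} \<Longrightarrow> dp_inv i (upd_reg s r k) = dp_inv i s"
  by (simp add: dp_inv_def acc_ok_upd_reg)

text \<open>Children follow and parents precede a vertex in search order: when \<open>x\<close> is
  reached, its own accumulators are complete and those of its parent are still in use.\<close>

lemma next_vertex:
  assumes "i < n"
  defines "x \<equiv> ord (n - 1 - i)"
  shows "x < n" "x \<notin> evaluated i" "evaluated (Suc i) = insert x (evaluated i)" "g.ch x \<subseteq> evaluated i"
    "pa x \<noteq> 0 \<Longrightarrow> pa x - 1 \<notin> evaluated i"
proof -
  show xn: "x < n" unfolding x_def by (rule ord_less) (use assms in simp)
  have "rk x = n - 1 - i" unfolding x_def by (rule rk_ord) (use assms in simp)
  then have rk: "rk x + Suc i = n" using assms(1) by simp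
  show "x \<notin> evaluated i" using rk assms(1) by (simp add: evaluated_def)
  show "evaluated (Suc i) = insert x (evaluated i)"
  proof (intro set_eqI iffI)
    fix y assume "y \<in> evaluated (Suc i)"
    then have y: "y < n" "n \<le> Suc i + rk y" by (auto simp: evaluated_def)
    show "y \<in> insert x (evaluated i)"
    proof (cases "n \<le> i + rk y")
      case True
      then show ?thesis using y by (simp add: evaluated_def)
    next
      case False
      then have "rk y = rk x" using y rk by simp
      then have "ord (rk y) = ord (rk x)" by (rule arg_cong)
      then have "y = x" unfolding ord_rk[OF y(1)] ord_rk[OF xn] .
      then show ?thesis by simp
    qed
  next
    fix y assume "y \<in> insert x (evaluated i)"
    then show "y \<in> evaluated (Suc i)" using xn rk assms(1) by (auto simp: evaluated_def)
  qed
  show "g.ch x \<subseteq> evaluated i"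
  proof
    fix y assume "y \<in> g.ch x"
    from g.childD[OF this] show "y \<in> evaluated i" using rk assms(1) by (simp add: evaluated_def)
  qed
  show "pa x - 1 \<notin> evaluated i" if "pa x \<noteq> 0"
    using g.parent[OF xn that] rk assms(1) by (simp add: evaluated_def)
qed

lemma bits_upd:
  "(\<lambda>y. ((ar s j)(x := (ar s j x)(0 := of_bool b))) y 0 \<noteq> 0) = (\<lambda>y. ar s j y 0 \<noteq> 0)(x := b)"
  by (auto simp: fun_eq_iff)

lemma dp_inv_Suc:
  assumes inv: "dp_inv i s" and i: "i < n" and x: "x = ord (n - 1 - i)"
    and acc: "acc_ok s'" and len: "rg s' 17 \<le> Suc (rg s 17)"
    and G: "ar s' 18 = (ar s 18)(x := (ar s 18 x)(0 := of_bool g0))"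
      "ar s' 19 = (ar s 19)(x := (ar s 19 x)(0 := of_bool g1))"
    and fail: "rg s' 18 = 0 \<longleftrightarrow> rg s 18 = 0 \<and> (g0 \<or> g1)"
    and dp: "g.dp (insert x (evaluated i)) (ar s' 9) (ar s' 10) (\<lambda>u. ar s' 13 u 0) (\<lambda>u. ar s' 14 u 0)
      ((\<lambda>x. ar s 18 x 0 \<noteq> 0)(x := g0)) ((\<lambda>x. ar s 19 x 0 \<noteq> 0)(x := g1))"
  shows "dp_inv (Suc i) s'"
proof -
  note nx = next_vertex[OF i, folded x]
  have "(\<forall>y \<in> insert x (evaluated i). ar s' 18 y 0 \<noteq> 0 \<or> ar s' 19 y 0 \<noteq> 0) \<longleftrightarrow>
      (g0 \<or> g1) \<and> (\<forall>y \<in> evaluated i. ar s 18 y 0 \<noteq> 0 \<or> ar s 19 y 0 \<noteq> 0)"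
    unfolding G using nx(2) by auto
  moreover have "(\<lambda>y. ar s' 18 y 0 \<noteq> 0) = (\<lambda>y. ar s 18 y 0 \<noteq> 0)(x := g0)"
    "(\<lambda>y. ar s' 19 y 0 \<noteq> 0) = (\<lambda>y. ar s 19 y 0 \<noteq> 0)(x := g1)"
    unfolding G by (rule bits_upd)+
  ultimately show ?thesis
    using acc len fail dp inv unfolding dp_inv_def nx(3) by auto
qed

lemma static_read:
  assumes "static s" "x < n"
  shows "ar s 4 x 0 = pa x" "ar s 0 0 (4 + x) = col x" "rg s 2 = nu" "rg s 3 = n" "pa x \<le> n" "pa x < M" "x + 4 < M" "n + 2 < M"
proof -
  show "pa x \<le> n" using g.parent[OF assms(2)] by (cases "pa x = 0") auto
  then show "pa x < M" "x + 4 < M" "n + 2 < M" using M_ge assms(2) by auto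
qed (use assms in \<open>auto simp: static_def base_def col_def\<close>)

lemma wp_store_bits:
  assumes "rg s 26 = x" "x < M" "1 < M"
    and "Q (upd_arr (upd_arr s 18 x 0 (rg s 24)) 19 x 0 (rg s 25))"
  shows "wp M store_bits Q s"
  using assms by (simp add: store_bits_def)

lemma wp_left_bits:
  assumes st: "static s" and x: "rg s 26 = x" "x < nu"
    and g1: "g1 \<longleftrightarrow> pa x \<noteq> 0 \<and> \<not> d x \<noteq> 0 \<and> ar s 14 x 0 = 0"
    and g0: "g0 \<longleftrightarrow> (if d x \<noteq> 0 then ar s 14 x 0 = 0
      else ar s 14 x 0 = 0 \<and> ar s 13 x 0 \<noteq> 0 \<or> ar s 14 x 0 = 1)"
    and Q: "Q (upd_reg (upd_reg s 25 (of_bool g1)) 24 (of_bool g0))"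
  shows "wp M left_bits Q s"
proof -
  have xn: "x < n" using x nu_le by simp
  note sr = static_read[OF st xn]
  have d: "ar s 8 x 0 = d x" using st x by (simp add: static_def)
  have big: "4 < M" using sr(7) by simp
  show ?thesis
  proof (cases "d x = 0")
    case False
    then have "g1 = False" "g0 = (ar s 14 x 0 = 0)" using g0 g1 by auto
    then show ?thesis using Q False d x sr big by (cases "ar s 14 x 0 = 0") (simp_all add: left_bits_def)
  next
    case True
    then have g: "g1 \<longleftrightarrow> pa x \<noteq> 0 \<and> ar s 14 x 0 = 0"
      "g0 \<longleftrightarrow> ar s 14 x 0 = 0 \<and> ar s 13 x 0 \<noteq> 0 \<or> ar s 14 x 0 = 1"
      using g0 g1 by simp_all
    show ?thesis using Q[unfolded g] True d x sr big
      by (cases "ar s 14 x 0 = 0"; cases "ar s 14 x 0 = 1"; cases "ar s 13 x 0 = 0"; cases "pa x = 0")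
        (simp_all add: left_bits_def)
  qed
qed

lemma left_step:
  assumes st: "static s" and inv: "dp_inv i s" and i: "i < n" and x: "x = ord (n - 1 - i)" "x < nu"
    and r: "rg s 26 = x"
  shows "wp M left_prog (dp_inv (Suc i)) s"
proof -
  note nx = next_vertex[OF i, folded x(1)]
  note sr = static_read[OF st nx(1)]
  define g1 where "g1 \<longleftrightarrow> pa x \<noteq> 0 \<and> \<not> d x \<noteq> 0 \<and> ar s 14 x 0 = 0"
  define g0 where "g0 \<longleftrightarrow> (if d x \<noteq> 0 then ar s 14 x 0 = 0
      else ar s 14 x 0 = 0 \<and> ar s 13 x 0 \<noteq> 0 \<or> ar s 14 x 0 = 1)"
  define R where "R = dp_inv (Suc i)"
  have dp: "g.dp (evaluated i) (ar s 9) (ar s 10) (\<lambda>u. ar s 13 u 0) (\<lambda>u. ar s 14 u 0)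
       (\<lambda>x. ar s 18 x 0 \<noteq> 0) (\<lambda>x. ar s 19 x 0 \<noteq> 0)" and acc: "acc_ok s" and len: "rg s 17 \<le> nu + i"
    using inv by (auto simp: dp_inv_def)
  note step = g.dp_left[OF dp x(2) nx(2,4) g1_def g0_def]
  have post: "R s'" if "acc_ok s'" "rg s' 17 \<le> Suc (rg s 17)" "ar s' 13 = ar s 13" "ar s' 14 = ar s 14"
    "ar s' 18 = (ar s 18)(x := (ar s 18 x)(0 := of_bool g0))"
    "ar s' 19 = (ar s 19)(x := (ar s 19 x)(0 := of_bool g1))"
    "rg s' 18 = 0 \<longleftrightarrow> rg s 18 = 0 \<and> (g0 \<or> g1)"
    "\<And>v c. ar s' 10 v c = ar s 10 v c + (if g1 \<and> v = pa x - 1 \<and> c = col x then 1 else 0)"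
    "\<And>v c. ar s' 9 v c = ar s 9 v c + (if g1 \<and> \<not> g0 \<and> v = pa x - 1 \<and> c = col x then 1 else 0)" for s'
    unfolding R_def
    by (rule dp_inv_Suc[OF inv i x(1) that(1,2,5,6,7)], unfold that(3,4), rule step, rule that(8), rule that(9))
  let ?s1 = "upd_reg (upd_reg s 25 (of_bool g1)) 24 (of_bool g0)"
  let ?s2 = "upd_arr (upd_arr ?s1 18 x 0 (of_bool g0)) 19 x 0 (of_bool g1)"
  have acc2: "acc_ok ?s2" using acc by (simp add: acc_ok_def)
  have "wp M (Cond (Var 25)
       (SetR 20 (Op Sub (Arr1 4 (Var 26)) (Num 1)) ;; SetR 21 (Arr 0 (Num 0) (Op Add (Num 4) (Var 26))) ;;
        SetR 22 (Op Sub (Num 1) (Var 24)) ;; push)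
       (Cond (Var 24) Nop (SetR 18 (Num 1)))) R ?s2"
  proof (cases g1)
    case True
    then have pax: "pa x \<noteq> 0" by (simp add: g1_def)
    let ?v = "pa x - 1"
    have v: "?v < n" using g.parent[OF nx(1) pax] by simp
    have c: "col x < nc" using cols[OF x(2)] by (simp add: col_def)
    \<comment> \<open>A child that cannot do without its parent has \<open>g0\<close> false, and
      then register 22 makes the lower count rise as well.\<close>
    let ?s3 = "upd_reg (upd_reg (upd_reg ?s2 20 ?v) 21 (col x)) 22 (1 - of_bool g0)"
    have s3: "rg ?s3 17 = rg s 17" "rg ?s3 18 = rg s 18" "rg ?s3 22 = 1 - of_bool g0" "ar ?s3 9 = ar s 9"
      "ar ?s3 10 = ar s 10" "ar ?s3 13 = ar s 13" "ar ?s3 14 = ar s 14"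
      "ar ?s3 18 = (ar s 18)(x := (ar s 18 x)(0 := of_bool g0))"
      "ar ?s3 19 = (ar s 19)(x := (ar s 19 x)(0 := of_bool g1))" by simp_all
    have "wp M push R ?s3"
    proof (rule wp_push)
      show "acc_ok ?s3" using acc by (simp add: acc_ok_def)
      show "Suc (rg ?s3 17) < M" unfolding s3 using len i nu_le M_ge by simp
    next
      fix s' assume s': "acc_ok s'" "rg s' 17 = Suc (rg ?s3 17)"
        "ar s' 9 = (if rg ?s3 22 \<noteq> 0 then bump (ar ?s3 9) ?v (col x) else ar ?s3 9)"
        "ar s' 10 = bump (ar ?s3 10) ?v (col x)" "frame push ?s3 s'"
      have f: "ar s' 13 = ar ?s3 13" "ar s' 14 = ar ?s3 14" "ar s' 18 = ar ?s3 18" "ar s' 19 = ar ?s3 19"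
        "rg s' 18 = rg ?s3 18" using s'(5) by (simp_all add: frame_def push_writes)
      show "R s'"
      proof (rule post[OF s'(1)])
        show "ar s' 10 v c = ar s 10 v c + (if g1 \<and> v = ?v \<and> c = col x then 1 else 0)" for v c
          unfolding s'(4) s3 bump_apply using True by simp
        show "ar s' 9 v c = ar s 9 v c + (if g1 \<and> \<not> g0 \<and> v = ?v \<and> c = col x then 1 else 0)" for v c
          unfolding s'(3) s3 by (cases g0) (simp_all add: bump_apply True)
      qed (simp_all only: s'(2) f s3, simp_all add: True)
    qed (use v c in simp_all)
    then show ?thesis using True r sr v by (simp del: fun_upd_apply add: fun_upd_same fun_upd_other)
  next
    case False
    show ?thesis
    proof (cases g0)
      case True
      have "R ?s2" by (rule post[OF acc2]) (use True False in simp_all)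
      then show ?thesis using True False sr by simp
    next
      case ng0: False
      have "R (upd_reg ?s2 18 1)" by (rule post) (use acc ng0 False in \<open>simp_all add: acc_ok_def\<close>)
      then show ?thesis using ng0 False sr by simp
    qed
  qed
  then have "wp M store_bits (wp M (Cond (Var 25)
       (SetR 20 (Op Sub (Arr1 4 (Var 26)) (Num 1)) ;; SetR 21 (Arr 0 (Num 0) (Op Add (Num 4) (Var 26))) ;;
        SetR 22 (Op Sub (Num 1) (Var 24)) ;; push)
       (Cond (Var 24) Nop (SetR 18 (Num 1)))) R) ?s1"
    by (intro wp_store_bits[where x=x]) (use r sr in simp_all)
  then have "wp M left_prog R s"
    unfolding left_prog_def wp.simps(4) by (intro wp_left_bits[OF st r x(2) g1_def g0_def]) 
  then show ?thesis unfolding R_def .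
qed

lemma right_step:
  assumes st: "static s" and inv: "dp_inv i s" and i: "i < n" and x: "x = ord (n - 1 - i)" "nu \<le> x"
    and r: "rg s 26 = x"
  shows "wp M right_prog (dp_inv (Suc i)) s"
proof -
  note nx = next_vertex[OF i, folded x(1)]
  note sr = static_read[OF st nx(1)]
  define u where "u = pa x - 1"
  define g0 where "g0 \<longleftrightarrow> (\<forall>c<nc. \<forall>c'<nc. ar s 9 x c \<le> th x + ar s 10 x c')"
  define g1 where "g1 \<longleftrightarrow> pa x \<noteq> 0 \<and>
    (\<forall>c<nc. \<forall>c'<nc. ar s 9 x c + g.own x c \<le> th x + (ar s 10 x c' + g.own x c'))"
  define R where "R = dp_inv (Suc i)"
  have dp: "g.dp (evaluated i) (ar s 9) (ar s 10) (\<lambda>u. ar s 13 u 0) (\<lambda>u. ar s 14 u 0)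
       (\<lambda>x. ar s 18 x 0 \<noteq> 0) (\<lambda>x. ar s 19 x 0 \<noteq> 0)" and acc: "acc_ok s" and len: "rg s 17 \<le> nu + i"
    using inv by (simp_all add: dp_inv_def)
  have lenM: "Suc (rg s 17) < M" using len i nu_le M_ge by simp
  note step = g.dp_right[OF dp nx(1) x(2) nx(2,4) g0_def g1_def]
  \<comment> \<open>Common state of both branches before the bits are stored. At a root there is no
    parent edge to test and \<open>g1\<close> is false.\<close>
  define mid where "mid s' \<longleftrightarrow> acc_ok s' \<and> rg s' 17 \<le> Suc (rg s 17) \<and> rg s' 26 = x \<and>
    rg s' 24 = of_bool g0 \<and> rg s' 25 = of_bool g1 \<and> ar s' 18 = ar s 18 \<and> ar s' 19 = ar s 19 \<and>
    rg s' 18 = rg s 18 \<and> (\<forall>v c. v \<noteq> x \<longrightarrow> ar s' 9 v c = ar s 9 v c \<and> ar s' 10 v c = ar s 10 v c) \<and>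
    (\<forall>y. ar s' 13 y 0 = ar s 13 y 0 + (if g1 \<and> pa x \<noteq> 0 \<and> y = pa x - 1 then 1 else 0)) \<and>
    (\<forall>y. ar s' 14 y 0 = ar s 14 y 0 + (if \<not> g0 \<and> pa x \<noteq> 0 \<and> y = pa x - 1 then 1 else 0))" for s' :: ast
  have tail: "wp M (store_bits ;; Cond (Op Add (Var 24) (Var 25)) Nop (SetR 18 (Num 1))) R s'" if m: "mid s'" for s'
  proof -
    let ?s = "upd_arr (upd_arr s' 18 x 0 (rg s' 24)) 19 x 0 (rg s' 25)"
    have post: "R s''" if f: "acc_ok s''" "rg s'' 17 = rg s' 17" "ar s'' 9 = ar s' 9" "ar s'' 10 = ar s' 10"
      "ar s'' 13 = ar s' 13" "ar s'' 14 = ar s' 14"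
      "ar s'' 18 = (ar s' 18)(x := (ar s' 18 x)(0 := of_bool g0))"
      "ar s'' 19 = (ar s' 19)(x := (ar s' 19 x)(0 := of_bool g1))"
      "rg s'' 18 = 0 \<longleftrightarrow> rg s 18 = 0 \<and> (g0 \<or> g1)" for s''
      unfolding R_def
    proof (rule dp_inv_Suc[OF inv i x(1) f(1) _ _ _ f(9)])
      show "rg s'' 17 \<le> Suc (rg s 17)" "ar s'' 18 = (ar s 18)(x := (ar s 18 x)(0 := of_bool g0))"
        "ar s'' 19 = (ar s 19)(x := (ar s 19 x)(0 := of_bool g1))"
        using m f(2,7,8) by (simp_all add: mid_def)
      show "g.dp (insert x (evaluated i)) (ar s'' 9) (ar s'' 10) (\<lambda>u. ar s'' 13 u 0) (\<lambda>u. ar s'' 14 u 0)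
          ((\<lambda>x. ar s 18 x 0 \<noteq> 0)(x := g0)) ((\<lambda>x. ar s 19 x 0 \<noteq> 0)(x := g1))"
        unfolding f(3-6) by (rule step) (use m in \<open>simp_all only: mid_def simp_thms\<close>)
    qed
    have acc': "acc_ok ?s" using m by (simp add: mid_def acc_ok_def)
    have bits: "rg s' 24 = of_bool g0" "rg s' 25 = of_bool g1" "rg s' 26 = x" "rg s' 18 = rg s 18"
      using m by (simp_all add: mid_def)
    have "wp M (Cond (Op Add (Var 24) (Var 25)) Nop (SetR 18 (Num 1))) R ?s"
    proof (cases "g0 \<or> g1")
      case True
      have "R ?s" by (rule post[OF acc']) (use bits True in simp_all)
      then show ?thesis using bits True sr by auto
    next
      case False
      have "R (upd_reg ?s 18 1)"
        by (rule post) (use bits False acc' in \<open>simp_all add: acc_ok_def\<close>)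
      then show ?thesis using bits False sr by simp
    qed
    then show ?thesis unfolding wp.simps(4)
      by (intro wp_store_bits[where x=x]) (use bits sr in simp_all)
  qed
  have up: "wp M right_up mid s1" if s1: "rg s1 24 = of_bool g0" "frame (SetR 20 (Var 26) ;; fair_test 24) s s1"
    "rg s1 20 = x" and pax: "pa x \<noteq> 0" for s1
  proof -
    have f1: "\<And>j. ar s1 j = ar s j" "rg s1 17 = rg s 17" "rg s1 18 = rg s 18" "rg s1 26 = x"
      using s1(2) r by (auto simp: frame_def)
    have st1: "static s1" by (rule static_frame[OF st s1(2)]) auto
    have acc1: "acc_ok s1" using acc by (simp add: acc_ok_def f1)
    have u: "u < n" "u < nu" "pa x = Suc u" using g.parent[OF nx(1) pax] x(2) pax by (auto simp: u_def)
    have ue: "u \<notin> evaluated i" using nx(5)[OF pax] by (simp add: u_def)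
    note bnd = g.dp_bound[OF dp u(2) ue]
    have colu: "col u < nc" using cols[OF u(2)] by (simp add: col_def)
    note sru = static_read[OF st1 u(1)]
    let ?s2 = "upd_reg (upd_reg (upd_reg s1 28 u) 21 (col u)) 22 1"
    have own: "g.own x c = (if c = col u then 1 else 0)" for c using pax by (auto simp: g.own_def u_def)
    have "wp M (push ;; fair_test 25 ;;
       Put 13 (Var 28) (Num 0) (Op Add (Arr1 13 (Var 28)) (Var 25)) ;;
       Put 14 (Var 28) (Num 0) (Op Add (Arr1 14 (Var 28)) (Op Sub (Num 1) (Var 24)))) mid ?s2"
      unfolding wp.simps(4)
    proof (rule wp_push)
      show "acc_ok ?s2" using acc1 by (simp add: acc_ok_def)
      show "rg ?s2 20 = x" "rg ?s2 21 = col u" "x < n" "col u < nc" "Suc (rg ?s2 17) < M"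
        using s1(3) nx(1) colu lenM f1 by simp_all
    next
      fix s3 assume 3: "acc_ok s3" "rg s3 17 = Suc (rg ?s2 17)"
        "ar s3 9 = (if rg ?s2 22 \<noteq> 0 then bump (ar ?s2 9) x (col u) else ar ?s2 9)"
        "ar s3 10 = bump (ar ?s2 10) x (col u)" "frame push ?s2 s3"
      have f3: "ar s3 13 = ar s 13" "ar s3 14 = ar s 14" "ar s3 18 = ar s 18" "ar s3 19 = ar s 19"
        "rg s3 18 = rg s 18" "rg s3 20 = x" "rg s3 24 = of_bool g0" "rg s3 26 = x" "rg s3 28 = u"
        using 3(5) f1 s1(1,3) by (simp_all add: frame_def push_writes)
      have len3: "rg s3 17 = Suc (rg s 17)" using 3(2) f1 by simp
      have LH: "ar s3 9 = bump (ar s 9) x (col u)" "ar s3 10 = bump (ar s 10) x (col u)"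
        using 3(3,4) f1 by simp_all
      have base3: "base s3"
      proof (rule base_frame[OF _ 3(5)])
        show "base ?s2" using static_base[OF st1] by (simp add: base_def)
      qed (auto simp: push_writes)
      show "wp M (fair_test 25) (wp M (Put 13 (Var 28) (Num 0) (Op Add (Arr1 13 (Var 28)) (Var 25)))
         (wp M (Put 14 (Var 28) (Num 0) (Op Add (Arr1 14 (Var 28)) (Op Sub (Num 1) (Var 24)))) mid)) s3"
      proof (rule wp_fair_test[OF 3(1) base3 f3(6) nx(1)])
        show "rg s3 17 < M" using len3 lenM by simp
      next
        fix s4 assume 4: "rg s4 25 = of_bool (\<forall>c<nc. \<forall>c'<nc. ar s3 9 x c \<le> th x + ar s3 10 x c')"
          "frame (fair_test 25) s3 s4"
        \<comment> \<open>The second test ran on the row with the parent's color counted in both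
          \<open>LO\<close> and \<open>HI\<close>, which is what \<open>own\<close> adds in
          \<open>g1\<close>.\<close>
        have b1: "rg s4 25 = of_bool g1"
          unfolding 4(1) LH g1_def own bump_apply using pax by simp
        have f4: "\<And>j. ar s4 j = ar s3 j" "rg s4 17 = rg s3 17" "rg s4 18 = rg s3 18" "rg s4 24 = rg s3 24"
          "rg s4 26 = rg s3 26" "rg s4 28 = rg s3 28" using 4(2) by (auto simp: frame_def)
        let ?s5 = "upd_arr (upd_arr s4 13 u 0 (ar s 13 u 0 + of_bool g1)) 14 u 0 (ar s 14 u 0 + (1 - of_bool g0))"
        have "mid ?s5"
          unfolding mid_def
        proof (intro conjI allI impI)
          show "acc_ok ?s5" using 3(1) by (simp add: acc_ok_def f4)
          show "rg ?s5 17 \<le> Suc (rg s 17)" using len3 f4 by simp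
          show "ar ?s5 13 y 0 = ar s 13 y 0 + (if g1 \<and> pa x \<noteq> 0 \<and> y = pa x - 1 then 1 else 0)" for y
            using pax by (simp add: f4 f3 u_def)
          show "ar ?s5 14 y 0 = ar s 14 y 0 + (if \<not> g0 \<and> pa x \<noteq> 0 \<and> y = pa x - 1 then 1 else 0)" for y
            using pax by (simp add: f4 f3 u_def)
        qed (simp_all add: f4 f3 b1 LH bump_apply)
        moreover have "ar s 13 u 0 + of_bool g1 < M" "ar s 14 u 0 + (1 - of_bool g0) < M"
          using bnd M_ge by (auto simp: of_bool_def)
        ultimately show "wp M (Put 13 (Var 28) (Num 0) (Op Add (Arr1 13 (Var 28)) (Var 25)))
          (wp M (Put 14 (Var 28) (Num 0) (Op Add (Arr1 14 (Var 28)) (Op Sub (Num 1) (Var 24)))) mid) s4"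
          using sru by (simp add: f4 f3 b1)
      qed simp_all
    qed
    then show ?thesis using f1 u sru sr unfolding right_up_def by (simp add: f1)
  qed
  have "wp M (SetR 20 (Var 26) ;; fair_test 24) (wp M (Cond (Arr1 4 (Var 26)) right_up (SetR 25 (Num 0)))
     (wp M (store_bits ;; Cond (Op Add (Var 24) (Var 25)) Nop (SetR 18 (Num 1))) R)) s"
  proof -
    have "wp M (fair_test 24) (\<lambda>s1. rg s1 24 = of_bool g0 \<and> rg s1 20 = x) (upd_reg s 20 x)"
    proof (rule wp_fair_test)
      show "acc_ok (upd_reg s 20 x)" using acc by (simp add: acc_ok_def)
      show "base (upd_reg s 20 x)" using static_base[OF st] by (simp add: base_upd_reg)
    next
      fix s1 assume 1: "rg s1 24 = of_bool (\<forall>c<nc. \<forall>c'<nc. ar (upd_reg s 20 x) 9 x c \<le> th x + ar (upd_reg s 20 x) 10 x c')"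
        "frame (fair_test 24) (upd_reg s 20 x) s1"
      then show "rg s1 24 = of_bool g0 \<and> rg s1 20 = x" by (simp add: g0_def frame_def)
    qed (use nx lenM in simp_all)
    then have "wp M (SetR 20 (Var 26) ;; fair_test 24) (\<lambda>s1. rg s1 24 = of_bool g0 \<and> rg s1 20 = x) s"
      using r by simp
    from wp_frame[OF this] show ?thesis
    proof (rule wp_mono)
      fix s1 assume 1: "(rg s1 24 = of_bool g0 \<and> rg s1 20 = x) \<and> frame (SetR 20 (Var 26) ;; fair_test 24) s s1"
      have f1: "\<And>j. ar s1 j = ar s j" "rg s1 17 = rg s 17" "rg s1 18 = rg s 18" "rg s1 26 = x"
        using 1 r by (auto simp: frame_def)
      show "wp M (Cond (Arr1 4 (Var 26)) right_up (SetR 25 (Num 0)))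
        (wp M (store_bits ;; Cond (Op Add (Var 24) (Var 25)) Nop (SetR 18 (Num 1))) R) s1"
      proof (cases "pa x = 0")
        case True
        have "mid (upd_reg s1 25 0)"
          using True 1 f1 acc by (simp add: mid_def acc_ok_def g1_def)
        from tail[OF this] show ?thesis using True f1 sr by simp
      next
        case False
        have "wp M right_up mid s1" by (rule up) (use 1 False in auto)
        then have "wp M right_up (wp M (store_bits ;; Cond (Op Add (Var 24) (Var 25)) Nop (SetR 18 (Num 1))) R) s1"
          by (rule wp_mono) (rule tail)
        then show ?thesis using False f1 sr by simp
      qed
    qed
  qed
  then show ?thesis unfolding right_prog_def R_def by (simp only: wp_then)
qed

lemma dp_step:
  assumes st: "static s" and inv: "dp_inv i s" and i: "rg s 7 = i" "i < n"
  shows "wp M dp_body (dp_inv (Suc i)) s"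
proof -
  define x where "x = ord (n - 1 - i)"
  have xn: "x < n" unfolding x_def by (rule ord_less) (use i in simp)
  let ?s = "upd_reg s 26 x"
  have st': "static ?s" by (rule static_upd_reg[OF st]) simp
  have inv': "dp_inv i ?s" using inv by (simp add: dp_inv_upd)
  note sr = static_read[OF st xn]
  have o: "ar s 5 (n - 1 - i) 0 = x" using st by (simp add: static_def x_def)
  have "wp M (Cond (Op Less (Var 26) (Var 2)) left_prog right_prog) (dp_inv (Suc i)) ?s"
  proof (cases "x < nu")
    case True
    from left_step[OF st' inv' i(2) x_def True] show ?thesis using True sr by simp
  next
    case False
    then have "nu \<le> x" by simp
    from right_step[OF st' inv' i(2) x_def this] show ?thesis using False sr by simp
  qed
  moreover have "n - Suc 0 < M" "n - Suc i < M" "0 < M" using sr(8) by linarith+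
  ultimately show ?thesis using sr o i by (simp add: dp_body_def)
qed

lemma test_tri:
  assumes st: "static s" and acc: "acc_ok s" and len: "rg s 17 \<le> 2 * n"
  shows "tri M test_prog s (test_cost * n + 28)
    (\<lambda>s'. acc_ok s' \<and> rg s' 17 \<le> 2 * n \<and> (rg s' 18 = 0 \<longleftrightarrow> good d))"
  unfolding test_prog_def
proof (rule tri_seq[OF clear_tri[OF st acc len]])
  fix s1 assume cl: "clean s1" and f1: "frame clear_prog s s1"
  have st1: "static s1" by (rule static_frame[OF st f1]) (auto simp: clear_prog_def test_writes)
  show "tri M (For 7 2 assign_body ;; For 7 3 dp_body) s1
     ((cost assign_body + 8) * n + 6 + ((cost dp_body + 8) * n + 6))
     (\<lambda>s'. acc_ok s' \<and> rg s' 17 \<le> 2 * n \<and> (rg s' 18 = 0 \<longleftrightarrow> good d))"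
  proof (rule tri_seq[OF assign_tri[OF st1 cl]])
    fix s2 assume a: "assign_inv nu s2" and f2: "frame (For 7 2 assign_body) s1 s2"
    have st2: "static s2" by (rule static_frame[OF st1 f2]) (auto simp: test_writes)
    have z: "ar s2 13 = ar s1 13" "ar s2 14 = ar s1 14" "rg s2 18 = rg s1 18"
      using f2 by (simp_all add: frame_def test_writes)
    have "g.dp {} (ar s2 9) (ar s2 10) (\<lambda>u. ar s2 13 u 0) (\<lambda>u. ar s2 14 u 0)
       (\<lambda>x. ar s2 18 x 0 \<noteq> 0) (\<lambda>x. ar s2 19 x 0 \<noteq> 0)"
    proof (rule g.dp_start)
      show "ar s2 9 v c = g.pre v c \<and> ar s2 10 v c = g.pre v c" for v c
        using a unfolding g.pre_def assign_inv_def assigned_def by blast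
    qed (use cl nu_le in \<open>simp_all add: z clean_def\<close>)
    moreover have "evaluated 0 = {}" using rk_less by (force simp: evaluated_def)
    ultimately have start: "dp_inv 0 s2"
      using a cl z by (simp add: dp_inv_def assign_inv_def clean_def)
    have "tri M (For 7 3 dp_body) s2 ((cost dp_body + 8) * n + 6) (dp_inv n)"
    proof (rule tri_for[where Inv=dp_inv])
      show "dp_inv 0 (upd_reg s2 7 0)" using start by (simp add: dp_inv_upd)
    next
      fix i s' assume i: "i < n" "dp_inv i s'" "rg s' 7 = i" and f: "frame (For 7 3 dp_body) s2 s'"
      have "static s'" by (rule static_frame[OF st2 f]) (auto simp: test_writes)
      from dp_step[OF this i(2,3,1)]
      have "wp M dp_body (\<lambda>s''. dp_inv (Suc i) (upd_reg s'' 7 (Suc i))) s'"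
        by (rule wp_mono) (simp add: dp_inv_upd)
      then show "tri M dp_body s' (cost dp_body) (\<lambda>s''. dp_inv (Suc i) (upd_reg s'' 7 (Suc i)))"
        by (rule tri_wp)
    qed (use st2 M_ge in \<open>auto simp: static_def base_def test_writes\<close>)
    then show "tri M (For 7 3 dp_body) s2 ((cost dp_body + 8) * n + 6)
       (\<lambda>s'. acc_ok s' \<and> rg s' 17 \<le> 2 * n \<and> (rg s' 18 = 0 \<longleftrightarrow> good d))"
    proof (rule tri_mono)
      fix s' assume i: "dp_inv n s'"
      have e: "evaluated n = {..<n}" by (auto simp: evaluated_def)
      have "g.dp {..<n} (ar s' 9) (ar s' 10) (\<lambda>u. ar s' 13 u 0) (\<lambda>u. ar s' 14 u 0)
         (\<lambda>x. ar s' 18 x 0 \<noteq> 0) (\<lambda>x. ar s' 19 x 0 \<noteq> 0)" using i unfolding dp_inv_def e by blast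
      from g.dp_all[OF this] have "good d \<longleftrightarrow> (\<forall>x<n. ar s' 18 x 0 \<noteq> 0 \<or> ar s' 19 x 0 \<noteq> 0)"
        by (simp only: good_iff)
      then show "acc_ok s' \<and> rg s' 17 \<le> 2 * n \<and> (rg s' 18 = 0 \<longleftrightarrow> good d)"
        using i nu_le unfolding dp_inv_def e by auto
    qed simp
  next
    have "(cost assign_body + 8) * nu \<le> (cost assign_body + 8) * n" using nu_le by (rule mult_le_mono2)
    then show "(cost assign_body + 8) * nu + 6 + ((cost dp_body + 8) * n + 6)
      \<le> (cost assign_body + 8) * n + 6 + ((cost dp_body + 8) * n + 6)" by simp
  qed
qed (simp add: test_cost_def algebra_simps)

end

section \<open>The complete program\<close>

text \<open>Register 19 is the carry. All digits are visited even after it has died out; the cost is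
  linear, like that of the test.\<close>

definition odo_body :: ac where
  "odo_body = Cond (Var 19)
     (Cond (Op Less (Arr1 8 (Var 7)) (Arr1 6 (Var 7)))
       (Put 8 (Var 7) (Num 0) (Op Add (Arr1 8 (Var 7)) (Num 1)) ;; SetR 19 (Num 0))
       (Put 8 (Var 7) (Num 0) (Num 0)))
     Nop"

definition odo_prog :: ac where
  "odo_prog = SetR 19 (Num 1) ;; For 7 2 odo_body"

text \<open>Register 16 keeps the main loop going as long as the choice has failed and the counter
  has not wrapped around.\<close>

definition report :: ac where
  "report = SetR 0 (Op Equal (Var 18) (Num 0)) ;; SetR 16 (Op Equal (Op Add (Var 0) (Var 19)) (Num 0))"

definition main_body :: ac where
  "main_body = test_prog ;; odo_prog ;; report"

definition main_prog :: ac where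
  "main_prog = SetR 16 (Num 1) ;; Loop (Var 16) main_body"

definition header_prog :: ac where
  "header_prog = SetR 2 (Arr 0 (Num 0) (Num 0)) ;; SetR 3 (Op Add (Var 2) (Arr 0 (Num 0) (Num 1))) ;;
     SetR 4 (Arr 0 (Num 0) (Num 2)) ;; SetR 5 (Arr 0 (Num 0) (Num 3)) ;; SetR 6 (Op Add (Num 4) (Var 3))"

definition whole_prog :: ac where
  "whole_prog = header_prog ;; adj_prog ;; bfs_prog ;; nt_prog ;; main_prog"

lemma odo_writes: "mreg odo_body = {19}" "marr odo_body = {8}"
  by (auto simp: odo_body_def)

lemma test_prog_writes:
  "mreg test_prog = {7, 17, 18, 20, 21, 22, 23, 24, 25, 26, 28}"
  "marr test_prog = {9, 10, 11, 12, 13, 14, 15, 16, 17, 18, 19}"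
  unfolding test_prog_def clear_prog_def by (auto simp: test_writes)

lemma main_writes:
  "mreg main_body = {0, 7, 16, 17, 18, 19, 20, 21, 22, 23, 24, 25, 26, 28}"
  "marr main_body = {8, 9, 10, 11, 12, 13, 14, 15, 16, 17, 18, 19}"
  unfolding main_body_def odo_prog_def report_def by (auto simp: odo_writes test_prog_writes)

definition main_cost :: nat where
  "main_cost = test_cost + (cost odo_body + 8)"

context forest begin

definition ready :: "ast \<Rightarrow> bool" where
  "ready s \<longleftrightarrow> base s \<and> (\<forall>x. ar s 4 x 0 = pa x) \<and> (\<forall>p. ar s 5 p 0 = ord p) \<and> row s 6 7 = nt"

lemma ready_frame:
  assumes "ready s" "frame P s s'" "{2, 3, 4, 5, 6} \<inter> mreg P = {}" "{0, 4, 5, 6, 7} \<inter> marr P = {}"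
  shows "ready s'"
proof -
  have "base s'" using assms by (intro base_frame[OF _ assms(2)]) (auto simp: ready_def)
  moreover have "ar s' 4 = ar s 4" "ar s' 5 = ar s 5" "row s' 6 7 = row s 6 7"
    using assms(2,4) by (auto simp: frame_def intro!: row_frame)
  ultimately show ?thesis using assms(1) by (simp add: ready_def)
qed

definition digits :: "nat \<Rightarrow> ast \<Rightarrow> bool" where
  "digits t s \<longleftrightarrow> (\<forall>u<nu. ar s 8 u 0 = dig rad t u)"

definition odo_inv :: "nat \<Rightarrow> nat \<Rightarrow> ast \<Rightarrow> bool" where
  "odo_inv t i s \<longleftrightarrow> (\<forall>u<nu. ar s 8 u 0 = (if u < i then dig rad (Suc t) u else dig rad t u)) \<and>
     rg s 19 = of_bool (radix rad i dvd Suc t)"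

lemma odo_step:
  assumes st: "ready s" and inv: "odo_inv t i s" and i: "rg s 7 = i" "i < nu"
  shows "wp M odo_body (odo_inv t (Suc i)) s"
proof -
  define b where "b \<longleftrightarrow> radix rad i dvd Suc t"
  define k where "k = dig rad t i"
  define R where "R = odo_inv t (Suc i)"
  have k: "ar s 8 i 0 = k" "rg s 19 = of_bool b" using inv i by (simp_all add: odo_inv_def k_def b_def)
  have l: "ar s 6 i 0 = length (nt i)"
  proof -
    have "row s 6 7 i = nt i" using st by (simp add: ready_def)
    then show ?thesis using length_row by metis
  qed
  have lM: "length (nt i) + 1 < M" "i < M" "1 < M" using length_nt_le[OF i(2)] i nu_le M_ge by auto
  have kl: "k < Suc (length (nt i))" using dig_less[of rad i t] rad_pos by (simp add: k_def rad_def)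
  have dig: "dig rad (Suc t) i = (if b then if k < length (nt i) then k + 1 else 0 else k)"
    using dig_Suc[of rad i t] rad_pos by (simp add: b_def k_def rad_def)
  have carry: "radix rad (Suc i) dvd Suc t \<longleftrightarrow> b \<and> \<not> k < length (nt i)"
    using radix_dvd_Suc[of i rad t] rad_pos by (simp add: b_def k_def rad_def)
  have post: "R s'" if "ar s' 8 = (ar s 8)(i := (ar s 8 i)(0 := dig rad (Suc t) i))"
    "rg s' 19 = of_bool (b \<and> \<not> k < length (nt i))" for s'
    using inv that unfolding R_def odo_inv_def carry by (auto simp: less_Suc_eq)
  have "wp M odo_body R s"
  proof (cases b)
    case False
    then have "R s" using k by (intro post) (auto simp: dig fun_eq_iff)
    then show ?thesis using False k by (simp add: odo_body_def)
  next
    case b: True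
    show ?thesis
    proof (cases "k < length (nt i)")
      case True
      have "R (upd_reg (upd_arr s 8 i 0 (k + 1)) 19 0)" by (rule post) (use True b dig in simp_all)
      then show ?thesis using True b k l lM i by (simp add: odo_body_def)
    next
      case False
      have "R (upd_arr s 8 i 0 0)" by (rule post) (use False b dig k in simp_all)
      then show ?thesis using False b k l lM i kl by (simp add: odo_body_def)
    qed
  qed
  then show ?thesis unfolding R_def .
qed

lemma odo_tri:
  assumes st: "ready s" and dg: "digits t s"
  shows "tri M odo_prog s (2 + ((cost odo_body + 8) * nu + 6))
    (\<lambda>s'. digits (Suc t) s' \<and> rg s' 19 = of_bool (radix rad nu dvd Suc t))"
  unfolding odo_prog_def
proof (rule tri_seq)
  have "wp M (SetR 19 (Num 1)) (odo_inv t 0) s"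
    using dg M_ge by (simp add: odo_inv_def digits_def)
  from tri_wp[OF this] show "tri M (SetR 19 (Num 1)) s 2 (odo_inv t 0)"
    by (rule tri_mono) simp_all
next
  fix s1 assume o: "odo_inv t 0 s1" and f1: "frame (SetR 19 (Num 1)) s s1"
  have st1: "ready s1" by (rule ready_frame[OF st f1]) auto
  have "tri M (For 7 2 odo_body) s1 ((cost odo_body + 8) * nu + 6) (odo_inv t nu)"
  proof (rule tri_for[where Inv="odo_inv t"])
    show "odo_inv t 0 (upd_reg s1 7 0)" using o by (simp add: odo_inv_def)
  next
    fix i s' assume i: "i < nu" "odo_inv t i s'" "rg s' 7 = i" and f: "frame (For 7 2 odo_body) s1 s'"
    have "ready s'" by (rule ready_frame[OF st1 f]) (auto simp: odo_writes)
    from odo_step[OF this i(2,3,1)]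
    have "wp M odo_body (\<lambda>s''. odo_inv t (Suc i) (upd_reg s'' 7 (Suc i))) s'"
      by (rule wp_mono) (simp add: odo_inv_def)
    then show "tri M odo_body s' (cost odo_body) (\<lambda>s''. odo_inv t (Suc i) (upd_reg s'' 7 (Suc i)))"
      by (rule tri_wp)
  qed (use st1 nu_le M_ge in \<open>auto simp: ready_def base_def odo_writes\<close>)
  then show "tri M (For 7 2 odo_body) s1 ((cost odo_body + 8) * nu + 6)
      (\<lambda>s'. digits (Suc t) s' \<and> rg s' 19 = of_bool (radix rad nu dvd Suc t))"
    by (rule tri_mono) (simp_all add: odo_inv_def digits_def)
qed simp

definition main_inv :: "nat \<Rightarrow> ast \<Rightarrow> bool" where
  "main_inv k s \<longleftrightarrow> acc_ok s \<and> rg s 17 \<le> 2 * n \<and>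
     (rg s 16 \<noteq> 0 \<and> (\<exists>t < radix rad nu. k = radix rad nu - t \<and> digits t s \<and> (\<forall>t'<t. \<not> good (dig rad t'))) \<or>
      rg s 16 = 0 \<and> rg s 0 = of_bool (\<exists>t < radix rad nu. good (dig rad t)))"

lemma main_step:
  assumes st: "ready s" and inv: "main_inv k s" and run: "rg s 16 \<noteq> 0"
  shows "tri M main_body s (main_cost * n + 46) (\<lambda>s'. \<exists>k'<k. main_inv k' s')"
proof -
  define P where "P = radix rad nu"
  obtain t where t: "t < P" "k = P - t" "digits t s" "\<forall>t'<t. \<not> good (dig rad t')"
    and acc: "acc_ok s" and len: "rg s 17 \<le> 2 * n"
    using inv run unfolding main_inv_def P_def by blast
  interpret c: choice nu n nc m M inp pa ord comp nt "dig rad t"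
    by unfold_locales (rule dig_less, rule rad_pos)
  have st': "c.static s" using st t(3) unfolding c.static_def ready_def digits_def by blast
  \<comment> \<open>As \<open>t < P\<close>, a carry out of the last digit appears exactly when all
    counter values have been tried.\<close>
  have last: "P dvd Suc t \<longleftrightarrow> Suc t = P"
    using t(1) by (auto dest: dvd_imp_le)
  have test: "tri M test_prog s (test_cost * n + 28)
    (\<lambda>s'. acc_ok s' \<and> rg s' 17 \<le> 2 * n \<and> (rg s' 18 = 0 \<longleftrightarrow> good (dig rad t)))"
    using c.test_tri[OF st' acc len] .
  show ?thesis unfolding main_body_def
  proof (rule tri_seq[OF test])
    fix s1 assume 1: "acc_ok s1 \<and> rg s1 17 \<le> 2 * n \<and> (rg s1 18 = 0 \<longleftrightarrow> good (dig rad t))"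
      and f1: "frame test_prog s s1"
    have st1: "ready s1" by (rule ready_frame[OF st f1]) (auto simp: test_prog_writes)
    have "ar s1 8 = ar s 8" using f1 by (simp add: frame_def test_prog_writes)
    then have dg: "digits t s1" using t(3) by (simp add: digits_def)
    show "tri M (odo_prog ;; report) s1 (2 + ((cost odo_body + 8) * nu + 6) + 10) (\<lambda>s'. \<exists>k'<k. main_inv k' s')"
    proof (rule tri_seq[OF odo_tri[OF st1 dg]])
      fix s2 assume 2: "digits (Suc t) s2 \<and> rg s2 19 = of_bool (radix rad nu dvd Suc t)"
        and f2: "frame odo_prog s1 s2"
      have acc2: "acc_ok s2"
        by (rule acc_ok_frame[of s1 odo_prog]) (use 1 f2 in \<open>auto simp: odo_prog_def odo_writes\<close>)
      have r2: "rg s2 17 \<le> 2 * n" "rg s2 18 = 0 \<longleftrightarrow> good (dig rad t)" "rg s2 19 = of_bool (Suc t = P)"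
        using 1 2 f2 last by (simp_all add: frame_def odo_prog_def odo_writes P_def)
      let ?a = "of_bool (good (dig rad t)) :: nat"
      let ?r = "of_bool (\<not> good (dig rad t) \<and> Suc t \<noteq> P) :: nat"
      let ?s = "upd_reg (upd_reg s2 0 ?a) 16 ?r"
      have "\<exists>k'<k. main_inv k' ?s"
      proof (cases "\<not> good (dig rad t) \<and> Suc t \<noteq> P")
        case True
        have "main_inv (P - Suc t) ?s"
          unfolding main_inv_def P_def[symmetric]
        proof (intro conjI disjI1 exI[of _ "Suc t"])
          show "\<forall>t'<Suc t. \<not> good (dig rad t')" using t(4) True by (simp add: less_Suc_eq)
        qed (use acc2 r2 2 t True in \<open>simp_all add: acc_ok_def digits_def\<close>)
        moreover have "P - Suc t < k" using t by simp
        ultimately show ?thesis by blast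
      next
        case False
        have "(\<exists>t<P. good (dig rad t)) \<longleftrightarrow> good (dig rad t)"
        proof
          assume "\<exists>t<P. good (dig rad t)"
          then obtain t' where t': "t' < P" "good (dig rad t')" by blast
          show "good (dig rad t)"
          proof (rule ccontr)
            assume "\<not> good (dig rad t)"
            then have "t' < t \<or> t' = t" using False t' by linarith
            then show False using t(4) t' \<open>\<not> good (dig rad t)\<close> by blast
          qed
        qed (use t in blast)
        then have "main_inv 0 ?s"
          unfolding main_inv_def P_def[symmetric] using acc2 r2 False by (simp add: acc_ok_def)
        then show ?thesis using t by (intro exI[of _ 0]) simp
      qed
      then have "wp M report (\<lambda>s'. \<exists>k'<k. main_inv k' s') s2"
        using r2 M_ge by (cases "good (dig rad t)"; cases "Suc t = P") (simp_all add: report_def)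
      from tri_wp[OF this] show "tri M report s2 10 (\<lambda>s'. \<exists>k'<k. main_inv k' s')"
        by (rule tri_mono) (simp_all add: report_def)
    qed simp
  next
    have "(cost odo_body + 8) * nu \<le> (cost odo_body + 8) * n" using nu_le by (rule mult_le_mono2)
    then show "test_cost * n + 28 + (2 + ((cost odo_body + 8) * nu + 6) + 10) \<le> main_cost * n + 46"
      by (simp add: main_cost_def algebra_simps)
  qed
qed

lemma main_tri:
  assumes st: "ready s" and zero: "\<And>j. 8 \<le> j \<Longrightarrow> j < 20 \<Longrightarrow> ar s j = (\<lambda>_ _. 0)" and r: "rg s 17 = 0"
  shows "tri M main_prog s ((main_cost * n + 50) * radix rad nu + 4)
    (\<lambda>s'. rg s' 0 = of_bool (\<exists>\<sigma>. solution \<sigma>))"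
  unfolding main_prog_def
proof (rule tri_seq)
  let ?s = "upd_reg s 16 1"
  have "acc_ok ?s" unfolding acc_ok_def using zero r by (simp add: acc_start)
  moreover have "digits 0 ?s" using zero by (simp add: digits_def dig_0)
  \<comment> \<open>Even without left vertices there is one choice, the empty one.\<close>
  moreover have "0 < radix rad nu" by (rule radix_pos) (rule rad_pos)
  ultimately have "main_inv (radix rad nu) ?s"
    using r unfolding main_inv_def by (auto intro!: exI[of _ 0])
  then have "wp M (SetR 16 (Num 1)) (main_inv (radix rad nu)) s" using M_ge by simp
  from tri_wp[OF this] show "tri M (SetR 16 (Num 1)) s 2 (main_inv (radix rad nu))"
    by (rule tri_mono) simp_all
next
  fix s1 assume i: "main_inv (radix rad nu) s1" and f1: "frame (SetR 16 (Num 1)) s s1"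
  have st1: "ready s1" by (rule ready_frame[OF st f1]) auto
  have "tri M (Loop (Var 16) main_body) s1
     ((1 + exp_time (cx (Var 16)) + (main_cost * n + 46)) * radix rad nu + 1 + exp_time (cx (Var 16)))
     (\<lambda>s'. (\<exists>k'. main_inv k' s') \<and> aval s' (Var 16) = 0)"
  proof (rule tri_loop[where Inv=main_inv, OF i])
    fix k s' assume "main_inv k s'" "frame main_body s1 s'" and a: "aval s' (Var 16) \<noteq> 0"
    moreover from this(2) have "ready s'" by (rule ready_frame[OF st1]) (auto simp: main_writes)
    ultimately show "tri M main_body s' (main_cost * n + 46) (\<lambda>s''. \<exists>k''<k. main_inv k'' s'')"
      by (intro main_step) simp_all
  qed simp
  then show "tri M (Loop (Var 16) main_body) s1 ((main_cost * n + 50) * radix rad nu + 2)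
      (\<lambda>s'. rg s' 0 = of_bool (\<exists>\<sigma>. solution \<sigma>))"
  proof (rule tri_mono)
    show "rg s' 0 = of_bool (\<exists>\<sigma>. solution \<sigma>)" if "(\<exists>k'. main_inv k' s') \<and> aval s' (Var 16) = 0" for s'
      using that unfolding main_inv_def solution_iff_counter by auto
  qed (simp add: add_mult_distrib)
qed simp

end

section \<open>Composition of the phases\<close>

context words begin

definition sol :: "(nat \<Rightarrow> nat) \<Rightarrow> bool" where
  "sol \<sigma> \<longleftrightarrow> (\<forall>u<nu. \<exists>e<m. eu e = u \<and> ev e = \<sigma> u) \<and>
     (\<forall>v. nu \<le> v \<longrightarrow> v < n \<longrightarrow> (\<forall>c<nc. \<forall>c'<nc.
       card {u. u < nu \<and> \<sigma> u = v \<and> col u = c} \<le> th v + card {u. u < nu \<and> \<sigma> u = v \<and> col u = c'}))"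

text \<open>Apart from the input all arrays are zero, as the memory of the machine is; no
  initialization is charged.\<close>

definition start :: ast where
  "start = \<lparr>rg = (\<lambda>_. 0), ar = (\<lambda>j x. if j = 0 \<and> x = 0 then inp else (\<lambda>_. 0))\<rparr>"

end

text \<open>The summand 70 leaves room for the constants 6, 6, 4 and 50 in the bounds of the
  phases.\<close>

definition whole_cost :: nat where
  "whole_cost = cost header_prog + (cost adj_body + 8) + cost bfs_init + 3 * bfs_cost + (cost nt_body + 8) + main_cost + 70"

text \<open>Graph theory enters through \<open>F\<close> alone. The assumption is made for every
  labelling constant along edges because the one it is applied to, the component numbers, arises
  only during the run.\<close>

lemma (in words) whole_tri:
  assumes hdr: "inp 0 = nu" "nu + inp 1 = n" "inp 2 = nc" "inp 3 = m"
    and F: "\<And>comp :: nat \<Rightarrow> nat. (\<And>e. e < m \<Longrightarrow> comp (eu e) = comp (ev e)) \<Longrightarrow>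
      m + card (comp ` {..<n}) \<le> n + F"
  shows "tri M whole_prog start (whole_cost * (2 ^ F * (n + 1) + n + m + 1))
    (\<lambda>s'. rg s' 0 = of_bool (\<exists>\<sigma>. sol \<sigma>))"
proof -
  let ?Q = "\<lambda>s'. rg s' 0 = of_bool (\<exists>\<sigma>. sol \<sigma>)"
  let ?Tm = "(main_cost * n + 50) * 2 ^ F + 4"
  let ?Tn = "(cost nt_body + 8) * m + 6"
  let ?Tb = "cost bfs_init + (bfs_cost * (2 * m + 2 * n) + bfs_cost)"
  let ?Ta = "(cost adj_body + 8) * m + 6"
  have "wp M header_prog (\<lambda>s. base s \<and> (\<forall>j. j \<noteq> 0 \<longrightarrow> ar s j = (\<lambda>_ _. 0)) \<and> rg s 17 = 0) start"
    using hdr M_ge by (auto simp: header_prog_def start_def base_def)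
  note hd = tri_wp[OF this]
  have "tri M whole_prog start (cost header_prog + (?Ta + (?Tb + (?Tn + ?Tm)))) ?Q"
    unfolding whole_prog_def
  proof (rule tri_seq[OF hd _ order_refl])
    fix s assume s: "base s \<and> (\<forall>j. j \<noteq> 0 \<longrightarrow> ar s j = (\<lambda>_ _. 0)) \<and> rg s 17 = 0"
    have z: "ar s j = (\<lambda>_ _. 0)" if "j \<noteq> 0" for j using s that by blast
    have base: "base s" using s by blast
    show "tri M (adj_prog ;; bfs_prog ;; nt_prog ;; main_prog) s (?Ta + (?Tb + (?Tn + ?Tm))) ?Q"
    proof (rule tri_seq[OF adj_tri[OF base z] _ order_refl])
      fix s1 assume a1: "adj_inv m s1" and f1: "frame adj_prog s s1"
      have base1: "base s1"
        by (rule base_frame[OF base f1]) (auto simp: adj_prog_def adj_body_def edge_words_def)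
      have z1: "ar s1 j = (\<lambda>_ _. 0)" if "j \<notin> {0, 2, 20}" for j
        using f1 z that by (simp add: frame_def adj_prog_def adj_body_def edge_words_def)
      have r1: "rg s1 17 = 0"
        using f1 s by (simp add: frame_def adj_prog_def adj_body_def edge_words_def)
      show "tri M (bfs_prog ;; nt_prog ;; main_prog) s1 (?Tb + (?Tn + ?Tm)) ?Q"
      proof (rule tri_seq[OF bfs_tri[OF a1 base1] _ order_refl])
        show "ar s1 3 = (\<lambda>_ _. 0)" "ar s1 4 = (\<lambda>_ _. 0)" by (rule z1; simp)+
      next
        fix s2 assume b: "bfs_ok s2 \<and> rg s2 14 = 0 \<and> rg s2 10 = rg s2 11 \<and> rg s2 12 = n"
          and f2: "frame bfs_prog s1 s2"
        have base2: "base s2" by (rule base_frame[OF base1 f2]) (auto simp: bfs_prog_def bfs_writes)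
        have ar2: "ar s2 j = ar s1 j" if "j \<notin> {3, 4, 5}" for j
          using f2 that by (simp add: frame_def bfs_prog_def bfs_writes)
        have r2: "rg s2 17 = 0" using f2 r1 by (simp add: frame_def bfs_prog_def bfs_writes)
        interpret sr: search n "row s2 20 2" "rg s2 10" "rg s2 11" "rg s2 12" "rg s2 13" "rg s2 14" "rg s2 15"
          "\<lambda>x. ar s2 3 x 0" "\<lambda>x. ar s2 4 x 0" "\<lambda>x. ar s2 5 x 0"
          using b unfolding bfs_ok_def by blast
        have fin: "rg s2 14 = 0" "rg s2 10 = rg s2 11" "rg s2 12 = n" using b by blast+
        note post = sr.finished[OF fin]
        have adj2: "set (row s2 20 2 x) = nbrs m x" if "x < n" for x
        proof -
          have "row s2 20 2 = row s1 20 2" by (rule row_frame) (rule ar2; simp)+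
          then show ?thesis using a1 that by (simp add: adj_inv_def)
        qed
        show "tri M (nt_prog ;; main_prog) s2 (?Tn + ?Tm) ?Q"
        proof (rule tri_seq[OF nt_tri[OF base2] _ order_refl])
          show "ar s2 6 = (\<lambda>_ _. 0)" using ar2[of 6] z1[of 6] by simp
        next
          fix s3 assume nt3: "nt_inv (\<lambda>x. ar s2 4 x 0) m s3" and f3: "frame nt_prog s2 s3"
          have base3: "base s3"
            by (rule base_frame[OF base2 f3]) (auto simp: nt_prog_def nt_body_def edge_words_def)
          have ar3: "ar s3 j = ar s2 j" if "j \<notin> {6, 7}" for j
            using f3 that by (simp add: frame_def nt_prog_def nt_body_def edge_words_def)
          have r3: "rg s3 17 = 0" using f3 r2 by (simp add: frame_def nt_prog_def nt_body_def edge_words_def)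
          interpret forest nu n nc m M inp "\<lambda>x. ar s2 4 x 0" "\<lambda>x. ar s2 5 x 0" "\<lambda>x. ar s2 3 x 0" "row s3 6 7"
          proof
            show "bij_betw (\<lambda>x. ar s2 5 x 0) {..<n} {..<n}" by (rule post)
          next
            fix p assume p: "p < n" "ar s2 4 (ar s2 5 p 0) 0 \<noteq> 0"
            then obtain q where q: "q < p" "ar s2 4 (ar s2 5 p 0) 0 = Suc (ar s2 5 q 0)"
              "ar s2 5 p 0 \<in> set (row s2 20 2 (ar s2 5 q 0))"
              using sr.parents[of p] post(4) by auto
            have "ar s2 5 q 0 < n" using sr.queue_less[of q] q p post(4) by simp
            then show "\<exists>q<p. ar s2 4 (ar s2 5 p 0) 0 = Suc (ar s2 5 q 0) \<and> ar s2 5 p 0 \<in> nbrs m (ar s2 5 q 0)"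
              using q adj2 by auto
          next
            fix e assume e: "e < m"
            have "ev e \<in> set (row s2 20 2 (eu e))" using adj2[OF eu_less(2)[OF e]] e by (auto simp: nbrs_def)
            from post(2)[OF eu_less(2)[OF e] this] show "ar s2 3 (eu e) 0 = ar s2 3 (ev e) 0" by simp
          next
            show "inj_on (\<lambda>x. ar s2 3 x 0) {y. y < n \<and> ar s2 4 y 0 = 0}" by (rule post)
          next
            fix u assume "u < nu"
            then show "set (row s3 6 7 u) = {ev e | e. e < m \<and> eu e = u \<and> \<not> tree (\<lambda>x. ar s2 4 x 0) e}"
              using nt3 by (simp add: nt_inv_def)
          next
            show "(\<Sum>u<nu. length (row s3 6 7 u)) = card {e. e < m \<and> \<not> tree (\<lambda>x. ar s2 4 x 0) e}"
              using nt3 by (simp add: nt_inv_def)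
          qed
          have "solution = sol"
            by (intro ext) (simp add: solution_def sol_def fair_def rooted_guess.fair_def[OF rooted]
                rooted_guess.cnt_def[OF rooted])
          moreover have "ready s3" using base3 by (simp add: ready_def ar3)
          moreover have "ar s3 j = (\<lambda>_ _. 0)" if "8 \<le> j" "j < 20" for j
            using that by (simp add: ar3 ar2 z1)
          ultimately have main: "tri M main_prog s3 ((main_cost * n + 50) * radix rad nu + 4) ?Q"
            using main_tri[of s3] r3 by simp
          \<comment> \<open>The lower bound on tree edges meets the bound by \<open>F\<close>; the
            number of labels cancels.\<close>
          have "card {e. e < m \<and> \<not> tree (\<lambda>x. ar s2 4 x 0) e} \<le> F"
            using nontree_bound F[of "\<lambda>x. ar s2 3 x 0"] comp_edge by simp
          then have "radix rad nu \<le> 2 ^ F"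
            using radix_le by (meson order_trans power_increasing one_le_numeral)
          then have "(main_cost * n + 50) * radix rad nu \<le> (main_cost * n + 50) * 2 ^ F" by (rule mult_le_mono2)
          then show "tri M main_prog s3 ?Tm ?Q" using main by (elim tri_mono) simp_all
        qed
      qed
    qed simp
  qed
  moreover have "cost header_prog + (?Ta + (?Tb + (?Tn + ?Tm))) \<le> whole_cost * (2 ^ F * (n + 1) + n + m + 1)"
  proof -
    have "main_cost * n * 2 ^ F \<le> main_cost * (2 ^ F * (n + 1) + n + m + 1)"
      by (simp add: algebra_simps)
    moreover have "50 * 2 ^ F \<le> 50 * (2 ^ F * (n + 1) + n + m + 1)" by simp
    moreover have "cost header_prog + 16 \<le> (cost header_prog + 16) * (2 ^ F * (n + 1) + n + m + 1)" by simp
    moreover have "(cost adj_body + 8) * m \<le> (cost adj_body + 8) * (2 ^ F * (n + 1) + n + m + 1)"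
      by (intro mult_le_mono2) simp
    moreover have "(cost nt_body + 8) * m \<le> (cost nt_body + 8) * (2 ^ F * (n + 1) + n + m + 1)"
      by (intro mult_le_mono2) simp
    moreover have "cost bfs_init \<le> cost bfs_init * (2 ^ F * (n + 1) + n + m + 1)" by simp
    moreover have "bfs_cost * (2 * m + 2 * n) + bfs_cost \<le> 3 * bfs_cost * (2 ^ F * (n + 1) + n + m + 1)"
      by (simp add: algebra_simps)
    ultimately show ?thesis unfolding whole_cost_def by (simp only: algebra_simps)
  qed
  ultimately show ?thesis by (elim tri_mono)
qed

section \<open>Encoded instances\<close>

lemma length_concat_pairs: "length (concat (map (\<lambda>(i, j). [i, j]) es)) = 2 * length es"
  by (induction es) auto

lemma nth_concat_pairs:
  "e < length es \<Longrightarrow> concat (map (\<lambda>(i, j). [i, j]) es) ! (e + e) = fst (es ! e) \<and>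
    concat (map (\<lambda>(i, j). [i, j]) es) ! Suc (e + e) = snd (es ! e)"
proof (induction es arbitrary: e)
  case (Cons a es)
  then show ?case by (cases e; cases a) auto
qed simp

text \<open>The pairwise form is the one the evaluation works with; it covers the empty set of
  colors without a case distinction.\<close>

lemma is_fair_iff:
  assumes "finite (colors I)"
  shows "is_fair I l X \<longleftrightarrow> (\<forall>c \<in> colors I. \<forall>c' \<in> colors I.
    card (color_class I X c) \<le> l + card (color_class I X c'))"
proof (cases "colors I = {}")
  case True
  then show ?thesis by (simp add: is_fair_def)
next
  case False
  let ?A = "(\<lambda>c. card (color_class I X c)) ` colors I"
  have A: "finite ?A" "?A \<noteq> {}" using assms False by auto
  have "is_fair I l X \<longleftrightarrow> Max ?A \<le> l + Min ?A"
    using False by (simp add: is_fair_def le_diff_conv)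
  also have "\<dots> \<longleftrightarrow> (\<forall>a \<in> ?A. \<forall>b \<in> ?A. a \<le> l + b)"
  proof
    assume m: "Max ?A \<le> l + Min ?A"
    show "\<forall>a \<in> ?A. \<forall>b \<in> ?A. a \<le> l + b"
    proof (intro ballI)
      fix a b assume "a \<in> ?A" "b \<in> ?A"
      then have "a \<le> Max ?A" "Min ?A \<le> b" using A by simp_all
      then show "a \<le> l + b" using m by linarith
    qed
  next
    assume "\<forall>a \<in> ?A. \<forall>b \<in> ?A. a \<le> l + b"
    then show "Max ?A \<le> l + Min ?A" using Max_in[OF A] Min_in[OF A] by blast
  qed
  finally show ?thesis by simp
qed

locale encoding =
  fixes I :: gfm and us vs cs ks :: "nat list" and es :: "(nat \<times> nat) list" and x :: "nat list"
  assumes inst: "gfm_instance I"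
    and us: "distinct us" "set us = left I" and vs: "distinct vs" "set vs = right I"
    and cs: "distinct cs" "set cs = colors I" and ks: "length ks = length us"
    and color: "\<And>i. i < length us \<Longrightarrow> ks ! i < length cs \<and> color I (us ! i) = cs ! (ks ! i)"
    and es: "distinct es" "set es \<subseteq> {..<length us} \<times> {..<length vs}"
    and edges: "edges I = (\<lambda>(i, j). {us ! i, vs ! j}) ` set es"
    and x: "x = [length us, length vs, length cs, length es] @ ks @ map (threshold I) vs
         @ concat (map (\<lambda>(i, j). [i, j]) es)"
begin

definition nu :: nat where "nu = length us"
definition n :: nat where "n = length us + length vs"
definition nc :: nat where "nc = length cs"
definition m :: nat where "m = length es"
definition M :: nat where "M = 2 * (n + nc + 2 * m + 5)"
definition inp :: "nat \<Rightarrow> nat" where "inp k = (if k < length x then x ! k else 0)"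

lemma length_x: "length x = 4 + n + 2 * m"
  by (simp add: x ks n_def m_def length_concat_pairs del: length_concat)

lemma header: "inp 0 = nu" "nu + inp 1 = n" "inp 2 = nc" "inp 3 = m"
  unfolding inp_def by (simp_all add: x nu_def n_def nc_def m_def numeral_2_eq_2 numeral_3_eq_3)

lemma inp_color: "u < nu \<Longrightarrow> inp (4 + u) = ks ! u"
  unfolding inp_def by (simp add: x nu_def ks nth_append)

lemma inp_threshold: "j < length vs \<Longrightarrow> inp (4 + (nu + j)) = threshold I (vs ! j)"
  unfolding inp_def by (simp add: x nu_def ks nth_append)

lemma inp_edge:
  assumes "e < m"
  shows "inp (4 + n + (e + e)) = fst (es ! e)" "inp (4 + n + (e + e) + 1) = snd (es ! e)"
proof -
  define h where "h = [length us, length vs, length cs, length es] @ ks @ map (threshold I) vs"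
  have h: "x = h @ concat (map (\<lambda>(i, j). [i, j]) es)" "length h = 4 + n"
    by (simp_all add: x h_def n_def ks)
  have "inp (4 + n + k) = concat (map (\<lambda>(i, j). [i, j]) es) ! k" if "k < 2 * m" for k
    unfolding inp_def using that length_x h(2) by (simp add: h(1) nth_append)
  from this[of "e + e"] this[of "e + e + 1"] nth_concat_pairs[of e es] assms
  show "inp (4 + n + (e + e)) = fst (es ! e)" "inp (4 + n + (e + e) + 1) = snd (es ! e)"
    by (simp_all add: m_def)
qed

lemma edge_less: "e < m \<Longrightarrow> fst (es ! e) < nu \<and> snd (es ! e) < length vs"
proof -
  assume "e < m"
  then have "es ! e \<in> {..<length us} \<times> {..<length vs}" using es(2) by (intro subsetD[OF es(2)]) (simp add: m_def)
  then show ?thesis by (auto simp: nu_def mem_Times_iff)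
qed

sublocale words nu n nc m M inp
proof
  show "nu \<le> n" by (simp add: nu_def n_def)
  show "M = 2 * (n + nc + 2 * m + 5)" by (rule M_def)
next
  fix u assume "u < nu"
  then show "inp (4 + u) < nc" using color[of u] by (simp add: inp_color nc_def nu_def)
next
  fix e assume e: "e < m"
  show "inp (4 + n + (e + e)) < nu" using edge_less[OF e] inp_edge[OF e] by simp
  show "nu + inp (4 + n + (e + e) + 1) < n" using edge_less[OF e] inp_edge[OF e] by (simp add: nu_def n_def)
next
  show "inj_on (\<lambda>e. (inp (4 + n + (e + e)), inp (4 + n + (e + e) + 1))) {..<m}"
  proof (rule inj_onI)
    fix e e' assume e: "e \<in> {..<m}" "e' \<in> {..<m}"
      "(inp (4 + n + (e + e)), inp (4 + n + (e + e) + 1)) = (inp (4 + n + (e' + e')), inp (4 + n + (e' + e') + 1))"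
    then have "es ! e = es ! e'" using inp_edge[of e] inp_edge[of e'] by (simp add: prod_eq_iff)
    then show "e = e'" using e es(1) by (simp add: nth_eq_iff_index_eq m_def)
  qed
qed

lemma eu_eq: "e < m \<Longrightarrow> eu e = fst (es ! e)" and ev_eq: "e < m \<Longrightarrow> ev e = nu + snd (es ! e)"
  using inp_edge by (simp_all add: eu_def ev_def)

definition vert :: "nat \<Rightarrow> nat" where
  "vert k = (if k < nu then us ! k else vs ! (k - nu))"

lemma disjoint: "left I \<inter> right I = {}"
  using inst by (simp add: gfm_instance_def bipartite_def)

lemma vert_left: "k < nu \<Longrightarrow> vert k \<in> left I"
  by (simp add: vert_def nu_def us(2)[symmetric])

lemma vert_right: "nu \<le> k \<Longrightarrow> k < n \<Longrightarrow> vert k \<in> right I"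
  by (simp add: vert_def nu_def n_def vs(2)[symmetric])

lemma vert_inj: "inj_on vert {..<n}"
proof (rule inj_onI)
  fix a b assume ab: "a \<in> {..<n}" "b \<in> {..<n}" "vert a = vert b"
  have "a < nu \<longleftrightarrow> b < nu"
    using ab disjoint vert_left[of a] vert_left[of b] vert_right[of a] vert_right[of b]
    by (metis disjoint_iff lessThan_iff not_le)
  then show "a = b"
    using ab us(1) vs(1) by (auto simp: vert_def nu_def n_def nth_eq_iff_index_eq split: if_splits)
qed

lemma vert_image: "vert ` {..<n} = left I \<union> right I"
proof
  have "vert k \<in> left I \<union> right I" if "k < n" for k
    using vert_left[of k] vert_right[of k] that by (cases "k < nu") simp_all
  then show "vert ` {..<n} \<subseteq> left I \<union> right I" by blast
  show "left I \<union> right I \<subseteq> vert ` {..<n}"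
  proof
    fix y assume "y \<in> left I \<union> right I"
    then consider "y \<in> set us" | "y \<in> set vs" using us vs by blast
    then show "y \<in> vert ` {..<n}"
    proof cases
      case 1
      then obtain k where "k < nu" "us ! k = y" by (auto simp: in_set_conv_nth nu_def)
      then show ?thesis using nu_le by (intro image_eqI[of _ _ k]) (simp_all add: vert_def)
    next
      case 2
      then obtain k where "k < length vs" "vs ! k = y" by (auto simp: in_set_conv_nth)
      then show ?thesis by (intro image_eqI[of _ _ "nu + k"]) (simp_all add: vert_def nu_def n_def)
    qed
  qed
qed

lemma vert_eq: "a < n \<Longrightarrow> b < n \<Longrightarrow> vert a = vert b \<longleftrightarrow> a = b"
  using inj_onD[OF vert_inj] by auto

lemma left_vert: "y \<in> left I \<Longrightarrow> \<exists>u<nu. y = vert u"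
  unfolding us(2)[symmetric] by (auto simp: in_set_conv_nth vert_def nu_def)

lemma right_vert: "y \<in> right I \<Longrightarrow> \<exists>v. nu \<le> v \<and> v < n \<and> y = vert v"
proof -
  assume "y \<in> right I"
  then obtain k where "k < length vs" "vs ! k = y" unfolding vs(2)[symmetric] by (auto simp: in_set_conv_nth)
  then show ?thesis by (intro exI[of _ "nu + k"]) (simp add: vert_def nu_def n_def)
qed

lemma card_vertices: "num_vertices I = n"
  using card_image[OF vert_inj] by (simp add: num_vertices_def vert_image)

lemma edges_vert: "edges I = (\<lambda>e. {vert (eu e), vert (ev e)}) ` {..<m}"
proof -
  have "set es = (\<lambda>e. es ! e) ` {..<m}" by (auto simp: set_conv_nth m_def)
  then have "edges I = (\<lambda>e. {us ! fst (es ! e), vs ! snd (es ! e)}) ` {..<m}"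
    by (simp add: edges image_image case_prod_beta)
  also have "\<dots> = (\<lambda>e. {vert (eu e), vert (ev e)}) ` {..<m}"
    using edge_less by (intro image_cong) (auto simp: eu_eq ev_eq vert_def)
  finally show ?thesis .
qed

lemma edge_iff:
  assumes "u < nu" "nu \<le> v" "v < n"
  shows "{vert u, vert v} \<in> edges I \<longleftrightarrow> (\<exists>e<m. eu e = u \<and> ev e = v)"
proof
  assume "{vert u, vert v} \<in> edges I"
  then obtain e where e: "e < m" "{vert u, vert v} = {vert (eu e), vert (ev e)}"
    unfolding edges_vert by blast
  have "vert u \<noteq> vert (ev e)"
    using vert_left[OF assms(1)] vert_right[OF ev_less(2) ev_less(1)[OF e(1)]] disjoint by auto
  then have "vert u = vert (eu e)" "vert v = vert (ev e)" using e(2) by (auto simp: doubleton_eq_iff)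
  then have "u = eu e" "v = ev e"
    using vert_eq[of u "eu e"] vert_eq[of v "ev e"] assms nu_le eu_less(2)[OF e(1)] ev_less(1)[OF e(1)] by auto
  then show "\<exists>e<m. eu e = u \<and> ev e = v" using e by blast
qed (auto simp: edges_vert)

lemma edge_shape:
  assumes "{y, z} \<in> edges I" "y \<in> left I"
  shows "z \<in> right I"
proof -
  have "{y, z} \<in> {{u, v} | u v. u \<in> left I \<and> v \<in> right I}"
    using assms(1) inst unfolding gfm_instance_def bipartite_def by blast
  then show ?thesis using assms(2) disjoint by (auto simp: doubleton_eq_iff)
qed

lemma edge_shape_right:
  assumes "{y, z} \<in> edges I" "y \<in> right I"
  shows "z \<in> left I"
proof -
  have "{y, z} \<in> {{u, v} | u v. u \<in> left I \<and> v \<in> right I}"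
    using assms(1) inst unfolding gfm_instance_def bipartite_def by blast
  then show ?thesis using assms(2) disjoint by (auto simp: doubleton_eq_iff)
qed

lemma card_edges: "card (edges I) = m"
proof -
  have "inj_on (\<lambda>e. {vert (eu e), vert (ev e)}) {..<m}"
  proof (rule inj_onI)
    fix e e' assume e: "e \<in> {..<m}" "e' \<in> {..<m}" "{vert (eu e), vert (ev e)} = {vert (eu e'), vert (ev e')}"
    have l: "e < m" "e' < m" using e by simp_all
    have "vert (eu e) \<noteq> vert (ev e')"
      using vert_left[OF eu_less(1)[OF l(1)]] vert_right[OF ev_less(2) ev_less(1)[OF l(2)]] disjoint by auto
    then have "vert (eu e) = vert (eu e')" "vert (ev e) = vert (ev e')" using e(3) by (auto simp: doubleton_eq_iff)
    then have "eu e = eu e'" "ev e = ev e'"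
      using vert_eq eu_less(2)[OF l(1)] eu_less(2)[OF l(2)] ev_less(1)[OF l(1)] ev_less(1)[OF l(2)] by auto
    then show "e = e'" using edge_eqD l by blast
  qed
  then show ?thesis unfolding edges_vert by (simp add: card_image)
qed

text \<open>A labelling of vertex numbers is carried along the injection \<open>vert\<close> to the
  vertices of the instance, where the feedback edge number is defined.\<close>

lemma comp_bound:
  fixes comp :: "nat \<Rightarrow> nat"
  assumes "\<And>e. e < m \<Longrightarrow> comp (eu e) = comp (ev e)"
  shows "m + card (comp ` {..<n}) \<le> n + feedback_edge_number (edges I)"
proof -
  define g where "g y = comp (inv_into {..<n} vert y)" for y
  have g: "g (vert k) = comp k" if "k < n" for k
    using inv_into_f_f[OF vert_inj, of k] that by (simp add: g_def)
  have "g ` vert ` {..<n} = comp ` {..<n}"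
    unfolding image_image by (rule image_cong) (simp_all add: g)
  moreover have "card (edges I) + card (g ` vert ` {..<n}) \<le> card (vert ` {..<n}) + feedback_edge_number (edges I)"
  proof (rule card_edges_le)
    show "edges I \<subseteq> {{x, y} | x y. x \<in> vert ` {..<n} \<and> y \<in> vert ` {..<n} \<and> x \<noteq> y}"
    proof
      fix a assume "a \<in> edges I"
      then obtain e where e: "e < m" "a = {vert (eu e), vert (ev e)}" unfolding edges_vert by blast
      have "eu e \<noteq> ev e" using eu_less(1)[OF e(1)] ev_less(2)[of e] by simp
      then have "vert (eu e) \<noteq> vert (ev e)" using vert_eq eu_less(2)[OF e(1)] ev_less(1)[OF e(1)] by simp
      then show "a \<in> {{x, y} | x y. x \<in> vert ` {..<n} \<and> y \<in> vert ` {..<n} \<and> x \<noteq> y}"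
        using e eu_less(2)[OF e(1)] ev_less(1)[OF e(1)] by auto
    qed
  next
    fix y z assume "{y, z} \<in> edges I"
    then obtain e where e: "e < m" "{y, z} = {vert (eu e), vert (ev e)}" unfolding edges_vert by blast
    have "g (vert (eu e)) = g (vert (ev e))"
      using g eu_less(2)[OF e(1)] ev_less(1)[OF e(1)] assms[OF e(1)] by simp
    then show "g y = g z" using e(2) by (auto simp: doubleton_eq_iff)
  qed simp
  ultimately show ?thesis using card_image[OF vert_inj] card_edges by simp
qed

lemma threshold_vert: "nu \<le> v \<Longrightarrow> v < n \<Longrightarrow> threshold I (vert v) = th v"
  using inp_threshold[of "v - nu"] by (simp add: th_def vert_def nu_def n_def)

lemma color_vert: "u < nu \<Longrightarrow> color I (vert u) = cs ! col u \<and> col u < nc"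
  using color[of u] inp_color[of u] by (simp add: vert_def nu_def nc_def col_def)

definition describes :: "(nat \<Rightarrow> nat) \<Rightarrow> nat set set \<Rightarrow> bool" where
  "describes \<sigma> MM \<longleftrightarrow> MM \<subseteq> edges I \<and>
     (\<forall>u<nu. nu \<le> \<sigma> u \<and> \<sigma> u < n \<and> partners MM (vert u) = {vert (\<sigma> u)})"

text \<open>Every edge at a right vertex has a left end, and at the left ends the matching is given
  by \<open>\<sigma>\<close>.\<close>

lemma describes_right:
  assumes d: "describes \<sigma> MM" and v: "nu \<le> v" "v < n"
  shows "partners MM (vert v) = vert ` {u. u < nu \<and> \<sigma> u = v}"
proof (intro set_eqI iffI)
  fix y assume "y \<in> partners MM (vert v)"
  then have y: "{vert v, y} \<in> MM" by (simp add: partners_def)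
  then have "y \<in> left I" using d edge_shape_right[OF _ vert_right[OF v]] by (auto simp: describes_def)
  then obtain u where u: "u < nu" "y = vert u" using left_vert by blast
  then have "vert v \<in> partners MM (vert u)" using y by (simp add: partners_def insert_commute)
  then have "vert v = vert (\<sigma> u)" "\<sigma> u < n" using d u(1) by (auto simp: describes_def)
  then show "y \<in> vert ` {u. u < nu \<and> \<sigma> u = v}" using u v vert_eq by auto
next
  fix y assume "y \<in> vert ` {u. u < nu \<and> \<sigma> u = v}"
  then obtain u where u: "u < nu" "\<sigma> u = v" "y = vert u" by blast
  then have "vert v \<in> partners MM (vert u)" using d by (auto simp: describes_def)
  then show "y \<in> partners MM (vert v)" using u by (simp add: partners_def insert_commute)
qed

lemma describes_fair:
  assumes d: "describes \<sigma> MM"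
  shows "fair_matching I MM \<longleftrightarrow> (\<forall>v. nu \<le> v \<longrightarrow> v < n \<longrightarrow> (\<forall>c<nc. \<forall>c'<nc.
       card {u. u < nu \<and> \<sigma> u = v \<and> col u = c} \<le> th v + card {u. u < nu \<and> \<sigma> u = v \<and> col u = c'}))"
proof -
  have cls: "card (color_class I (partners MM (vert v)) (cs ! c)) = card {u. u < nu \<and> \<sigma> u = v \<and> col u = c}"
    if "nu \<le> v" "v < n" "c < nc" for v c
  proof -
    have "color_class I (partners MM (vert v)) (cs ! c) = vert ` {u. u < nu \<and> \<sigma> u = v \<and> col u = c}"
      unfolding describes_right[OF d that(1,2)] color_class_def
      using color_vert cs(1) that(3) by (auto simp: nth_eq_iff_index_eq nc_def)
    moreover have "inj_on vert {u. u < nu \<and> \<sigma> u = v \<and> col u = c}"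
      by (rule inj_on_subset[OF vert_inj]) (use nu_le in auto)
    ultimately show ?thesis by (simp add: card_image)
  qed
  have cols: "colors I = (\<lambda>c. cs ! c) ` {..<nc}" using cs(2) by (auto simp: set_conv_nth nc_def)
  have fin: "finite (colors I)" using inst by (simp add: gfm_instance_def)
  have one: "is_fair I (threshold I (vert v)) (partners MM (vert v)) \<longleftrightarrow> (\<forall>c<nc. \<forall>c'<nc.
       card {u. u < nu \<and> \<sigma> u = v \<and> col u = c} \<le> th v + card {u. u < nu \<and> \<sigma> u = v \<and> col u = c'})"
    if "nu \<le> v" "v < n" for v
  proof -
    have "is_fair I (threshold I (vert v)) (partners MM (vert v)) \<longleftrightarrow> (\<forall>c \<in> {..<nc}. \<forall>c' \<in> {..<nc}.
        card (color_class I (partners MM (vert v)) (cs ! c)) \<le>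
          th v + card (color_class I (partners MM (vert v)) (cs ! c')))"
      unfolding is_fair_iff[OF fin] cols threshold_vert[OF that] by blast
    then show ?thesis using cls[OF that] by (simp add: Ball_def)
  qed
  have "right I = vert ` {v. nu \<le> v \<and> v < n}" using vert_right right_vert by auto
  then show ?thesis unfolding fair_matching_def using one by auto
qed

text \<open>A left-perfect matching is the same as a function sending each left vertex to a
  neighbour; \<open>describes\<close> is the translation under which the fairness conditions
  agree.\<close>

lemma yes_iff: "gfm_yes I \<longleftrightarrow> (\<exists>\<sigma>. sol \<sigma>)"
proof
  assume "gfm_yes I"
  then obtain MM where MM: "MM \<subseteq> edges I" "\<forall>u \<in> left I. card (partners MM u) = 1" "fair_matching I MM"
    by (auto simp: gfm_yes_def left_perfect_matching_def)
  have "\<exists>v. nu \<le> v \<and> v < n \<and> partners MM (vert u) = {vert v}" if u: "u < nu" for u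
  proof -
    obtain y where y: "partners MM (vert u) = {y}"
      using MM(2) vert_left[OF u] by (metis card_1_singletonE)
    then have "{vert u, y} \<in> edges I" using MM(1) by (auto simp: partners_def)
    then have "y \<in> right I" using edge_shape vert_left[OF u] by blast
    then show ?thesis using y right_vert by blast
  qed
  then have "\<forall>u. \<exists>v. u < nu \<longrightarrow> nu \<le> v \<and> v < n \<and> partners MM (vert u) = {vert v}" by blast
  from choice[OF this] obtain \<sigma> where \<sigma>: "describes \<sigma> MM" using MM(1) unfolding describes_def by blast
  have "\<exists>e<m. eu e = u \<and> ev e = \<sigma> u" if u: "u < nu" for u
  proof -
    have "vert (\<sigma> u) \<in> partners MM (vert u)" "nu \<le> \<sigma> u" "\<sigma> u < n" using \<sigma> u by (auto simp: describes_def)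
    then have "{vert u, vert (\<sigma> u)} \<in> edges I" "nu \<le> \<sigma> u" "\<sigma> u < n" using MM(1) by (auto simp: partners_def)
    then show ?thesis using edge_iff[OF u] by blast
  qed
  then have "sol \<sigma>" unfolding sol_def using describes_fair[OF \<sigma>] MM(3) by blast
  then show "\<exists>\<sigma>. sol \<sigma>" by blast
next
  assume "\<exists>\<sigma>. sol \<sigma>"
  then obtain \<sigma> where \<sigma>: "sol \<sigma>" by blast
  have e: "\<exists>e<m. eu e = u \<and> ev e = \<sigma> u" if "u < nu" for u using \<sigma> that by (simp add: sol_def)
  have r: "nu \<le> \<sigma> u \<and> \<sigma> u < n" if "u < nu" for u
    using e[OF that] ev_less by metis
  define MM where "MM = (\<lambda>u. {vert u, vert (\<sigma> u)}) ` {..<nu}"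
  have "MM \<subseteq> edges I"
  proof
    fix a assume "a \<in> MM"
    then obtain u where u: "u < nu" "a = {vert u, vert (\<sigma> u)}" by (auto simp: MM_def)
    have "{vert u, vert (\<sigma> u)} \<in> edges I" using edge_iff[OF u(1)] r[OF u(1)] e[OF u(1)] by simp
    then show "a \<in> edges I" using u(2) by simp
  qed
  moreover have "partners MM (vert u) = {vert (\<sigma> u)}" if u: "u < nu" for u
  proof (intro set_eqI iffI)
    fix y assume "y \<in> partners MM (vert u)"
    then obtain u' where u': "u' < nu" "{vert u, y} = {vert u', vert (\<sigma> u')}" by (auto simp: partners_def MM_def)
    have "vert u \<noteq> vert (\<sigma> u')" using vert_left[OF u] vert_right r[OF u'(1)] disjoint by (metis disjoint_iff)
    then have 1: "vert u = vert u'" "y = vert (\<sigma> u')" using u'(2) by (auto simp: doubleton_eq_iff)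
    then have "u = u'" using vert_eq[of u u'] u u'(1) nu_le by simp
    then show "y \<in> {vert (\<sigma> u)}" using 1 by simp
  qed (use u in \<open>auto simp: partners_def MM_def\<close>)
  ultimately have d: "describes \<sigma> MM" using r by (simp add: describes_def)
  have "card (partners MM y) = 1" if "y \<in> left I" for y
    using left_vert[OF that] d by (auto simp: describes_def)
  then have "left_perfect_matching I MM" using d by (simp add: left_perfect_matching_def describes_def)
  moreover have "fair_matching I MM" using describes_fair[OF d] \<sigma> by (simp add: sol_def)
  ultimately show "gfm_yes I" unfolding gfm_yes_def by blast
qed

end

section \<open>The word RAM program\<close>

text \<open>Computes \<open>M\<close> from the header. Cell 1 holds the number of right vertices, so
  cells 0 and 1 add up to \<open>n\<close>.\<close>

definition bound_exp :: exp where
  "bound_exp = Bin Mul (Const 2) (Bin Add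
     (Bin Add (Bin Add (Load (Const 0)) (Load (Const 1))) (Load (Const 2)))
     (Bin Add (Bin Add (Load (Const 3)) (Load (Const 3))) (Const 5)))"

definition solver :: com where
  "solver = Seq (Assign 1 bound_exp) (cc whole_prog)"

text \<open>The factor 6 is what passing to the bound with the logarithm costs in
  \<open>time_bound\<close>.\<close>

definition solver_cost :: nat where
  "solver_cost = 1 + exp_time bound_exp + 6 * whole_cost"

context encoding begin

text \<open>With \<open>N\<close> the input length plus the largest word,
  \<open>M \<le> 4 * N\<close> gives \<open>32 * M * M \<le> 512 * N ^ 2\<close>, and
  \<open>4 \<le> N\<close> gives \<open>512 \<le> 4 ^ 5 \<le> N ^ 5\<close>. This is the origin of
  the exponent 7.\<close>

lemma word_bounds:
  assumes "word_size_suffices 7 x w"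
  shows "32 * M * M \<le> 2 ^ w"
proof -
  let ?N = "length x + Max (set x)"
  \<comment> \<open>The length of the input does not grow with the number of colors, which is
    bounded only as one of the input words.\<close>
  have "nc \<in> set x" by (simp add: x nc_def)
  then have "nc \<le> Max (set x)" by simp
  then have "M \<le> 4 * ?N" "4 \<le> ?N" using length_x by (simp_all add: M_def)
  have "32 * M * M \<le> 32 * (4 * ?N) * (4 * ?N)" using \<open>M \<le> 4 * ?N\<close> by (intro mult_le_mono) auto
  also have "\<dots> = 512 * ?N ^ 2" by algebra
  also have "\<dots> \<le> 4 ^ 5 * ?N ^ 2" by (intro mult_le_mono1) simp
  also have "\<dots> \<le> ?N ^ 5 * ?N ^ 2" using \<open>4 \<le> ?N\<close> by (intro mult_le_mono1 power_mono) simp_all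
  also have "\<dots> = ?N ^ 7" by (simp add: power_add[symmetric])
  also have "\<dots> \<le> 2 ^ w" using assms by (simp add: word_size_suffices_def)
  finally show ?thesis .
qed

text \<open>All partial results are at most \<open>M\<close>, hence below \<open>2 ^ w\<close>, and
  the modular arithmetic is exact.\<close>

lemma bound_val:
  assumes "32 * M * M \<le> 2 ^ w"
  shows "exp_val w (initial_state x) bound_exp = M"
proof -
  have "M \<le> 32 * M * M" by simp
  then have "M \<le> 2 ^ w" using assms by linarith
  moreover have "M * 2 \<le> 32 * M * M" using M_ge by simp
  ultimately have Mw: "2 * (n + nc + 2 * m + 5) < 2 ^ w"
    using assms M_ge by (simp add: M_def)
  have mem: "mem (initial_state x) k = inp k" for k by (simp add: initial_state_def inp_def)
  have h: "inp 0 = nu" "inp (Suc 0) = n - nu" "inp 2 = nc" "inp 3 = m"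
    using header by simp_all
  have nn: "nu + (n - nu) = n" using nu_le by simp
  have "0 < w" using Mw by (cases w) simp_all
  then show ?thesis using Mw nn by (simp add: bound_exp_def mem h M_def)
qed

text \<open>Row 0 of array 0 has the addresses below \<open>M\<close>. The input is shorter than
  \<open>M\<close>, so it lies inside this row and all other cells are beyond it.\<close>

lemma represents_start: "represents M ((initial_state x)\<lparr>regs := (regs (initial_state x))(1 := M)\<rparr>) start"
  unfolding represents_def
proof (intro conjI allI impI)
  fix j a b :: nat assume jab: "j < 32" "a < M" "b < M"
  have lx: "length x < M" unfolding length_x using M_ge by simp
  show "mem ((initial_state x)\<lparr>regs := (regs (initial_state x))(1 := M)\<rparr>) (addr M j a b) = ar start j a b"
  proof (cases "j = 0 \<and> a = 0")
    case True
    then show ?thesis by (simp add: addr_def initial_state_def start_def inp_def)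
  next
    case False
    have "1 \<le> j * M + a" using False jab by (cases j) auto
    then have "1 * M \<le> (j * M + a) * M" by (rule mult_le_mono1)
    then have "\<not> addr M j a b < length x" using lx unfolding addr_def by linarith
    then show ?thesis using False by (auto simp: initial_state_def start_def)
  qed
qed (simp_all add: initial_state_def start_def)

lemma solver_correct:
  assumes "word_size_suffices 7 x w"
  shows "\<exists>t s. run w solver (initial_state x) t s \<and> regs s 0 = (if gfm_yes I then 1 else 0) \<and>
    t \<le> 1 + exp_time bound_exp + whole_cost * (2 ^ feedback_edge_number (edges I) * (n + 1) + n + m + 1)"
proof -
  note wb = word_bounds[OF assms]
  obtain t s' where t: "arun M whole_prog start t s'" "rg s' 0 = of_bool (\<exists>\<sigma>. sol \<sigma>)"
    "t \<le> whole_cost * (2 ^ feedback_edge_number (edges I) * (n + 1) + n + m + 1)"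
    using whole_tri[OF header comp_bound] unfolding tri_def by blast
  obtain z where z: "run w (cc whole_prog) ((initial_state x)\<lparr>regs := (regs (initial_state x))(1 := M)\<rparr>) t z"
    "represents M z s'"
    using compile_correct[OF t(1) wb represents_start] by blast
  have "run w solver (initial_state x) (1 + exp_time bound_exp + t) z"
    unfolding solver_def
    by (rule run.Seq[OF _ z(1)]) (use run.Assign[of w 1 bound_exp "initial_state x"] bound_val[OF wb] in simp)
  moreover have "regs z 0 = (if gfm_yes I then 1 else 0)"
    using z(2) t(2) by (simp add: represents_def yes_iff)
  ultimately show ?thesis using t(3) by (intro exI[of _ "1 + exp_time bound_exp + t"] exI[of _ z]) simp
qed

text \<open>For \<open>2 \<le> n\<close>, \<open>m \<le> n + fes\<close> and
  \<open>fes \<le> 2 ^ fes\<close> make every nonconstant summand at most a multiple of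
  \<open>2 ^ fes * n\<close>. The additive 1 serves instances with fewer than two vertices, where
  \<open>n log n\<close> vanishes.\<close>

lemma time_bound:
  "real (1 + exp_time bound_exp + whole_cost * (2 ^ feedback_edge_number (edges I) * (n + 1) + n + m + 1))
    \<le> real solver_cost * (2 ^ feedback_edge_number (edges I) * real n * log 2 (real n) + 1)"
proof -
  let ?F = "feedback_edge_number (edges I)"
  have "2 ^ ?F * (n + 1) + n + m + 1 \<le> 6 * (2 ^ ?F * real n * log 2 (real n) + 1)"
  proof (cases "2 \<le> n")
    case True
    \<comment> \<open>The constant labelling already gives this crude bound on the number of
      edges.\<close>
    have "m \<le> n + ?F" using comp_bound[of "\<lambda>_. 0"] by simp
    moreover have "?F \<le> 2 ^ ?F" by (simp add: less_imp_le)
    moreover have "n \<le> 2 ^ ?F * n" "2 ^ ?F \<le> 2 ^ ?F * n" using True by simp_all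
    ultimately have "2 ^ ?F * (n + 1) + n + m + 1 \<le> 6 * (2 ^ ?F * n) + 1"
      unfolding distrib_left by linarith
    then have "real (2 ^ ?F * (n + 1) + n + m + 1) \<le> real (6 * (2 ^ ?F * n) + 1)" by (rule of_nat_mono)
    also have "\<dots> = 6 * (2 ^ ?F * real n) + 1" by simp
    also have "\<dots> \<le> 6 * (2 ^ ?F * real n * log 2 (real n)) + 6"
    proof -
      \<comment> \<open>From two vertices on the logarithm is at least 1, so the linear bound
        implies the claimed one.\<close>
      have "1 \<le> log 2 (real n)" using True by (simp add: le_log_iff)
      then have "2 ^ ?F * real n * 1 \<le> 2 ^ ?F * real n * log 2 (real n)" by (intro mult_left_mono) simp_all
      then show ?thesis by linarith
    qed
    finally show ?thesis by simp
  next
    case False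
    \<comment> \<open>An edge needs a vertex on each side. Without edges the feedback edge number is
      0, and the left side is at most 4.\<close>
    have m: "m = 0"
    proof (rule ccontr)
      assume "m \<noteq> 0"
      then have "eu 0 < nu" "nu \<le> ev 0" "ev 0 < n" using eu_less(1)[of 0] ev_less[of 0] by simp_all
      then show False using False by simp
    qed
    then have e: "edges I = {}" by (simp add: edges_vert)
    have "acyclic_graph {}" unfolding acyclic_graph_def is_cycle_def by force
    then have "{F. F \<subseteq> {} \<and> acyclic_graph ({} - F)} = {{}}" by auto
    then have "?F = 0" unfolding e feedback_edge_number_def by simp
    moreover have "n = 0 \<or> n = 1" using False by auto
    ultimately show ?thesis using m by auto
  qed
  then have "real whole_cost * real (2 ^ ?F * (n + 1) + n + m + 1) \<le>
      real whole_cost * (6 * (2 ^ ?F * real n * log 2 (real n) + 1))"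
    by (intro mult_left_mono) simp_all
  moreover have "0 \<le> 2 ^ ?F * real n * log 2 (real n)"
    by (cases "n = 0") (simp_all add: zero_le_log_cancel_iff)
  then have "real (1 + exp_time bound_exp) * 1 \<le>
      real (1 + exp_time bound_exp) * (2 ^ ?F * real n * log 2 (real n) + 1)"
    by (intro mult_left_mono) simp_all
  ultimately show ?thesis unfolding solver_cost_def by (simp add: algebra_simps)
qed

end

theorem theorem5:
  "\<exists>(P :: com) (d :: nat) (c :: real). solves_gfm_in_time P d
     (\<lambda>I. c * (2 ^ feedback_edge_number (edges I)
               * real (num_vertices I) * log 2 (real (num_vertices I)) + 1))"
proof (intro exI)
  show "solves_gfm_in_time solver 7
     (\<lambda>I. real solver_cost * (2 ^ feedback_edge_number (edges I)
               * real (num_vertices I) * log 2 (real (num_vertices I)) + 1))"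
    unfolding solves_gfm_in_time_def
  proof (intro allI impI)
    fix I x w
    assume inst: "gfm_instance I" and "encodes x I" and w: "word_size_suffices 7 x w"
    then obtain us vs cs ks es where "encoding I us vs cs ks es x"
      unfolding encodes_def encoding_def by blast
    then interpret encoding I us vs cs ks es x .
    obtain t s where t: "run w solver (initial_state x) t s" "regs s 0 = (if gfm_yes I then 1 else 0)"
      "t \<le> 1 + exp_time bound_exp + whole_cost * (2 ^ feedback_edge_number (edges I) * (n + 1) + n + m + 1)"
      using solver_correct[OF w] by blast
    have "real t \<le> real solver_cost * (2 ^ feedback_edge_number (edges I)
               * real (num_vertices I) * log 2 (real (num_vertices I)) + 1)"
      using of_nat_mono[OF t(3)] time_bound unfolding card_vertices by (rule order_trans)
    then show "\<exists>t s. run w solver (initial_state x) t s \<and>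
              regs s 0 = (if gfm_yes I then 1 else 0) \<and>
              real t \<le> real solver_cost * (2 ^ feedback_edge_number (edges I)
               * real (num_vertices I) * log 2 (real (num_vertices I)) + 1)"
      using t by blast
  qed
qed

end
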